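(* Let $\mathbb{K}$ be a field, let $H=(X,Y)$ be a strongly biconvex graph (with respect to the labeling $X=\{x_q,\ldots,x_f\}$, $Y=\{y_{q'},\ldots,y_g\}$) with no isolated vertices, and let $e=\{x_q,y_{q'}\}$ (which is an edge of $H$). Let $B_e$ be the induced subgraph of $H$ on $N_H(x_q)\cup N_H(y_{q'})$. Let $S$, $S_1$, $S_2$ be the polynomial rings over $\mathbb{K}$ whose variables correspond to the vertices of $H$, $H-V(B_e)$ and $H-x_q$, respectively, and let $p_1=\mathrm{proj\,dim}(S_1/I(H-V(B_e)))$ and $p_2=\mathrm{proj\,dim}(S_2/I(H-x_q))$. Then $$\mathrm{proj\,dim}(S/I(H))=\max\{p_1+\deg_H(x_q)+\deg_H(y_{q'})-1,\ p_2\}.$$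
   Context: All graphs are finite and simple. Let $H=(X,Y)$ be a bipartite graph with bipartition $X\cup Y$, where $X=\{x_q,x_{q+1},\ldots,x_f\}$ and $Y=\{y_{q'},y_{q'+1},\ldots,y_g\}$ for some $q,q'\ge 1$. $H$ is called strongly biconvex (with respect to this labeling) if: (1) if $\{x_i,y_j\}\in E(H)$, then $i<j$; and (2) for any $r$ with $i<r<j$ and $\{x_i,y_j\}\in E(H)$: (i) if $x_r\in X$, then $\{x_r,y_j\}\in E(H)$; (ii) if $y_r\in Y$, then $\{x_i,y_r\}\in E(H)$. $N_H(v)$ is the set of neighbors of $v$ and $\deg_H(v)=|N_H(v)|$. For $T\subseteq V(G)$, $G-T$ is the induced subgraph of $G$ on $V(G)\setminus T$, and $G-v=G-\{v\}$. The (monomial) edge ideal $I(G)$ of a graph $G$ is the ideal generated by the products $uv$ of variables over all edges $\{u,v\}$ of $G$, in the polynomial ring whose variables are the vertices of $G$ (so $I(G)=0$ if $G$ has no edges). $\mathrm{proj\,dim}$ denotes projective dimension over the corresponding polynomial ring. *)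

theory Defs
  imports
    "HOL-Algebra.QuotRing"
    "HOL-Algebra.Module"
    "HOL-Library.Poly_Mapping"
    "HOL-Library.Extended_Nat"
begin

section \<open>Projective dimension\<close>

definition linear_maps ::
  "('r, 's) ring_scheme \<Rightarrow> ('r, 'm) module \<Rightarrow> ('r, 'n) module \<Rightarrow> ('m \<Rightarrow> 'n) set" where
  "linear_maps R M N = {h \<in> carrier M \<rightarrow> carrier N.
     (\<forall>a\<in>carrier M. \<forall>b\<in>carrier M. h (a \<oplus>\<^bsub>M\<^esub> b) = h a \<oplus>\<^bsub>N\<^esub> h b) \<and>
     (\<forall>r\<in>carrier R. \<forall>a\<in>carrier M. h (r \<odot>\<^bsub>M\<^esub> a) = r \<odot>\<^bsub>N\<^esub> h a)}"

text \<open>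
  The lifting property. HOL cannot quantify over types inside a definition, so the test modules
  \<open>M\<close> and \<open>N\<close> have their elements in the same type \<open>'m\<close> as \<open>P\<close>. Nothing is lost if \<open>'m\<close> is
  infinite and at least as large as \<open>'r\<close>: then the free module on the elements of \<open>P\<close> has a copy
  with elements in \<open>'m\<close>, and lifting the identity of \<open>P\<close> along the surjection from that copy makes
  \<open>P\<close> a direct summand of a free module, which gives the lifting property for all modules.
\<close>

definition projective_module :: "('r, 's) ring_scheme \<Rightarrow> ('r, 'm) module \<Rightarrow> bool" where
  "projective_module R P \<longleftrightarrow> Module.module R P \<and>
     (\<forall>(M :: ('r, 'm) module) (N :: ('r, 'm) module) s t.
        Module.module R M \<and> Module.module R N \<and> s \<in> linear_maps R M N \<and> s ` carrier M = carrier N \<and>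
        t \<in> linear_maps R P N \<longrightarrow>
        (\<exists>l\<in>linear_maps R P M. \<forall>a\<in>carrier P. s (l a) = t a))"

text \<open>
  \<open>\<dots> \<rightarrow> P 2 \<rightarrow> P 1 \<rightarrow> P 0 \<rightarrow> M \<rightarrow> 0\<close> with differentials \<open>d i : P (i + 1) \<rightarrow> P i\<close> and augmentation
  \<open>\<epsilon>\<close>. The modules \<open>P i\<close> have their elements in \<open>nat \<Rightarrow> 'r\<close>. Up to isomorphism this covers every
  module of cardinality at most that of \<open>nat \<Rightarrow> 'r\<close> (in particular the free modules of countable
  rank and their submodules), so a cyclic module, being of cardinality at most that of \<open>'r\<close>, has a
  resolution of minimal length among these.
\<close>

definition projective_resolution ::
  "('r, 's) ring_scheme \<Rightarrow> ('r, 'n) module \<Rightarrow> (nat \<Rightarrow> ('r, nat \<Rightarrow> 'r) module) \<Rightarrow>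
     (nat \<Rightarrow> (nat \<Rightarrow> 'r) \<Rightarrow> (nat \<Rightarrow> 'r)) \<Rightarrow> ((nat \<Rightarrow> 'r) \<Rightarrow> 'n) \<Rightarrow> bool" where
  "projective_resolution R M P d \<epsilon> \<longleftrightarrow>
     (\<forall>i. projective_module R (P i)) \<and>
     (\<forall>i. d i \<in> linear_maps R (P (Suc i)) (P i)) \<and>
     \<epsilon> \<in> linear_maps R (P 0) M \<and>
     \<epsilon> ` carrier (P 0) = carrier M \<and>
     d 0 ` carrier (P 1) = {a \<in> carrier (P 0). \<epsilon> a = \<zero>\<^bsub>M\<^esub>} \<and>
     (\<forall>i. d (Suc i) ` carrier (P (Suc (Suc i))) = {a \<in> carrier (P (Suc i)). d i a = \<zero>\<^bsub>P i\<^esub>})"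

text \<open>
  The value is \<open>\<infinity>\<close> if there is no finite projective resolution; the zero module gets \<open>0\<close>.
\<close>

definition proj_dim :: "('r, 's) ring_scheme \<Rightarrow> ('r, 'n) module \<Rightarrow> enat" where
  "proj_dim R M =
     (INF n \<in> {n. \<exists>P d \<epsilon>. projective_resolution R M P d \<epsilon> \<and>
                          (\<forall>i>n. carrier (P i) = {\<zero>\<^bsub>P i\<^esub>})}. enat n)"

definition quot_module :: "'r ring \<Rightarrow> 'r set \<Rightarrow> ('r, 'r set) module" where
  "quot_module R I =
     \<lparr>carrier = carrier (R Quot I), mult = mult (R Quot I), one = one (R Quot I),
      zero = zero (R Quot I), add = add (R Quot I),
      smult = (\<lambda>r C. (I +>\<^bsub>R\<^esub> r) \<otimes>\<^bsub>R Quot I\<^esub> C)\<rparr>"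

lemma module_quot_module:
  assumes "cring R" and "ideal I R"
  shows "Module.module R (quot_module R I)"
proof -
  interpret R: cring R by fact
  interpret I: ideal I R by fact
  interpret Q: ring "R Quot I" by (rule I.quotient_is_ring)
  have coset: "I +>\<^bsub>R\<^esub> a \<in> carrier (R Quot I)" if "a \<in> carrier R" for a
    using that by (auto simp: FactRing_def A_RCOSETS_def')
  have hom: "I +>\<^bsub>R\<^esub> (a \<oplus>\<^bsub>R\<^esub> b) = (I +>\<^bsub>R\<^esub> a) \<oplus>\<^bsub>R Quot I\<^esub> (I +>\<^bsub>R\<^esub> b)"
    "I +>\<^bsub>R\<^esub> (a \<otimes>\<^bsub>R\<^esub> b) = (I +>\<^bsub>R\<^esub> a) \<otimes>\<^bsub>R Quot I\<^esub> (I +>\<^bsub>R\<^esub> b)"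
    if "a \<in> carrier R" "b \<in> carrier R" for a b
    using that by (rule ring_hom_add[OF I.rcos_ring_hom] ring_hom_mult[OF I.rcos_ring_hom])+
  have one: "I +>\<^bsub>R\<^esub> \<one>\<^bsub>R\<^esub> = \<one>\<^bsub>R Quot I\<^esub>"
    by (rule ring_hom_one[OF I.rcos_ring_hom])
  have "abelian_group (quot_module R I)"
    using Q.a_assoc Q.a_comm Q.l_neg
    by (intro abelian_groupI) (auto simp: quot_module_def intro!: bexI[of _ "\<ominus>\<^bsub>R Quot I\<^esub> _"])
  then show ?thesis
    using \<open>cring R\<close> coset hom one
    by (intro moduleI) (auto simp: quot_module_def Q.l_distr Q.r_distr Q.m_assoc)
qed

section \<open>Polynomial rings\<close>

text \<open>
  A polynomial is a finitely supported map from monomials (exponent vectors) to coefficients.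
  The ring \<open>poly_ring V\<close> is the polynomial ring in the variables \<open>V\<close> only.
\<close>

type_synonym ('v, 'k) mvpoly = "('v \<Rightarrow>\<^sub>0 nat) \<Rightarrow>\<^sub>0 'k"

definition mvar :: "'v \<Rightarrow> ('v, 'k::field) mvpoly" where
  "mvar v = Poly_Mapping.single (Poly_Mapping.single v 1) 1"

definition poly_ring :: "'v set \<Rightarrow> ('v, 'k::field) mvpoly ring" where
  "poly_ring V =
     \<lparr>carrier = {p. \<forall>m\<in>Poly_Mapping.keys p. Poly_Mapping.keys m \<subseteq> V},
      mult = (*), one = 1, zero = 0, add = (+)\<rparr>"

lemma cring_poly_ring: "cring (poly_ring V :: ('v, 'k::field) mvpoly ring)"
proof (intro cringI abelian_groupI comm_monoidI)
  fix p q :: "('v, 'k) mvpoly"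
  assume pq: "p \<in> carrier (poly_ring V)" "q \<in> carrier (poly_ring V)"
  show "p \<oplus>\<^bsub>poly_ring V\<^esub> q \<in> carrier (poly_ring V)"
    using pq Poly_Mapping.keys_add[of p q] by (simp add: poly_ring_def) blast
  show "p \<otimes>\<^bsub>poly_ring V\<^esub> q \<in> carrier (poly_ring V)"
  proof -
    have "Poly_Mapping.keys m \<subseteq> V" if "m \<in> Poly_Mapping.keys (p * q)" for m
    proof -
      from that keys_mult[of p q] obtain a b
        where "m = a + b" "a \<in> Poly_Mapping.keys p" "b \<in> Poly_Mapping.keys q" by blast
      with pq Poly_Mapping.keys_add[of a b] show ?thesis by (force simp: poly_ring_def)
    qed
    then show ?thesis by (simp add: poly_ring_def)
  qed
next
  fix p :: "('v, 'k) mvpoly"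
  assume "p \<in> carrier (poly_ring V)"
  then show "\<exists>q\<in>carrier (poly_ring V). q \<oplus>\<^bsub>poly_ring V\<^esub> p = \<zero>\<^bsub>poly_ring V\<^esub>"
    by (intro bexI[of _ "- p"]) (auto simp: poly_ring_def)
qed (simp_all add: poly_ring_def ac_simps distrib_left)

section \<open>Graphs\<close>

record 'v sgraph =
  verts :: "'v set"
  edges :: "'v set set"

definition simple_graph :: "'v sgraph \<Rightarrow> bool" where
  "simple_graph G \<longleftrightarrow> finite (verts G) \<and> (\<forall>e\<in>edges G. e \<subseteq> verts G \<and> card e = 2)"

definition nbhd :: "'v sgraph \<Rightarrow> 'v \<Rightarrow> 'v set" where
  "nbhd G v = {w. {v, w} \<in> edges G}"

definition degree :: "'v sgraph \<Rightarrow> 'v \<Rightarrow> nat" where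
  "degree G v = card (nbhd G v)"

definition no_isolated_vertices :: "'v sgraph \<Rightarrow> bool" where
  "no_isolated_vertices G \<longleftrightarrow> (\<forall>v\<in>verts G. nbhd G v \<noteq> {})"

definition induced_subgraph :: "'v sgraph \<Rightarrow> 'v set \<Rightarrow> 'v sgraph" where
  "induced_subgraph G W = \<lparr>verts = verts G \<inter> W, edges = {e \<in> edges G. e \<subseteq> W}\<rparr>"

definition remove_verts :: "'v sgraph \<Rightarrow> 'v set \<Rightarrow> 'v sgraph" where
  "remove_verts G T = induced_subgraph G (verts G - T)"

definition edge_ideal :: "'v sgraph \<Rightarrow> ('v, 'k::field) mvpoly set" where
  "edge_ideal G = Idl\<^bsub>poly_ring (verts G)\<^esub> {mvar u * mvar v |u v. {u, v} \<in> edges G}"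

text \<open>
  The bipartition is \<open>X = {x q, \<dots>, x f}\<close> and \<open>Y = {y q', \<dots>, y g}\<close>; both parts are nonempty.
\<close>

definition strongly_biconvex ::
  "'v sgraph \<Rightarrow> (nat \<Rightarrow> 'v) \<Rightarrow> nat \<Rightarrow> nat \<Rightarrow> (nat \<Rightarrow> 'v) \<Rightarrow> nat \<Rightarrow> nat \<Rightarrow> bool" where
  "strongly_biconvex H x q f y q' g \<longleftrightarrow>
     simple_graph H \<and>
     1 \<le> q \<and> q \<le> f \<and> 1 \<le> q' \<and> q' \<le> g \<and>
     inj_on x {q..f} \<and> inj_on y {q'..g} \<and> x ` {q..f} \<inter> y ` {q'..g} = {} \<and>
     verts H = x ` {q..f} \<union> y ` {q'..g} \<and>
     (\<forall>e\<in>edges H. \<exists>i\<in>{q..f}. \<exists>j\<in>{q'..g}. e = {x i, y j}) \<and>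
     (\<forall>i\<in>{q..f}. \<forall>j\<in>{q'..g}. {x i, y j} \<in> edges H \<longrightarrow>
        i < j \<and>
        (\<forall>r. i < r \<and> r < j \<longrightarrow>
           (r \<in> {q..f} \<longrightarrow> {x r, y j} \<in> edges H) \<and>
           (r \<in> {q'..g} \<longrightarrow> {x i, y r} \<in> edges H)))"

lemma strongly_biconvex_first_edge:
  assumes H: "strongly_biconvex H x q f y q' g" and "no_isolated_vertices H"
  shows "{x q, y q'} \<in> edges H"
proof -
  have le: "q \<le> f" "q' \<le> g" and disj: "x ` {q..f} \<inter> y ` {q'..g} = {}"
    and vs: "verts H = x ` {q..f} \<union> y ` {q'..g}"
    using H unfolding strongly_biconvex_def by - (elim conjE, assumption)+
  from le have q: "q \<in> {q..f}" "q' \<in> {q'..g}" by simp_all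
  have bip: "\<exists>i\<in>{q..f}. \<exists>j\<in>{q'..g}. e = {x i, y j}" if "e \<in> edges H" for e
    using H that unfolding strongly_biconvex_def by (elim conjE) (rule bspec)
  have cond: "i < j \<and> (\<forall>r. i < r \<and> r < j \<longrightarrow>
      (r \<in> {q..f} \<longrightarrow> {x r, y j} \<in> edges H) \<and> (r \<in> {q'..g} \<longrightarrow> {x i, y r} \<in> edges H))"
    if "i \<in> {q..f}" "j \<in> {q'..g}" "{x i, y j} \<in> edges H" for i j
    using H that unfolding strongly_biconvex_def by (elim conjE) (drule (1) bspec, drule (1) bspec, erule (1) mp)
  obtain v where v: "{x q, v} \<in> edges H"
    using assms(2) q vs by (fastforce simp: no_isolated_vertices_def nbhd_def)
  obtain i j where ij: "i \<in> {q..f}" "j \<in> {q'..g}" "{x q, v} = {x i, y j}"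
    using bip[OF v] by blast
  then have "x q \<noteq> y j" using disj q by blast
  with ij v have xq: "{x q, y j} \<in> edges H" by (metis doubleton_eq_iff)
  obtain w where w: "{y q', w} \<in> edges H"
    using assms(2) q vs by (fastforce simp: no_isolated_vertices_def nbhd_def)
  obtain k l where kl: "k \<in> {q..f}" "l \<in> {q'..g}" "{y q', w} = {x k, y l}"
    using bip[OF w] by blast
  then have "y q' \<noteq> x k" using disj q by blast
  with kl w have yq: "{x k, y q'} \<in> edges H" by (metis doubleton_eq_iff insert_commute)
  have "q < q'" using cond[OF kl(1) q(2) yq] kl(1) by simp
  then show ?thesis
    using cond[OF q(1) ij(2) xq] xq ij(2) q(2) by (cases "q' = j") auto
qed

end

theory Submission
  imports Defs "HOL-Library.Function_Algebras"
begin

text \<open>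
  The projective dimension is computed by a form of Hochster's formula: for a simplicial complex
  \<open>\<Delta>\<close> on a vertex set \<open>V\<close> with Stanley-Reisner ideal \<open>I\<close>, the projective dimension of \<open>S/I\<close> is the largest
  \<open>card \<sigma> - j\<close> for which the complex induced on \<open>\<sigma> \<subseteq> V\<close> has nonzero reduced cohomology on its faces of
  cardinality \<open>j\<close>. It is read off the finite free resolution with basis the pairs \<open>(F, G)\<close> of
  disjoint sets with \<open>G \<in> \<Delta>\<close>, in homological degree \<open>card F\<close>, whose differential removes a vertex
  \<open>v\<close> from \<open>F\<close> and either multiplies by the variable \<open>v\<close> or adds \<open>v\<close> to \<open>G\<close>. Modulo the
  variables it is the direct sum over \<open>\<sigma> = F \<union> G\<close> of the cochain complexes of the induced
  subcomplexes. It splits above degree \<open>n\<close> if and only if these are acyclic there, since the terms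
  involving variables strictly decrease \<open>card (F \<union> G)\<close>.

  The edge ideal is the Stanley-Reisner ideal of the independence complex. If \<open>x\<^sub>q \<notin> \<sigma>\<close>, then
  \<open>\<sigma>\<close> is counted by \<open>p\<^sub>2\<close>. If \<open>x\<^sub>q \<in> \<sigma>\<close>, deleting the neighbours \<open>y\<^sub>l\<close> of \<open>x\<^sub>q\<close> in \<open>\<sigma>\<close> from the
  largest index down reduces the cohomology to that of the link of the last one, which avoids \<open>B\<^sub>e\<close>;
  as \<open>N(y\<^sub>l)\<close> gains at most one vertex per index, this gives the bound \<open>p\<^sub>1 + deg + deg - 1\<close>.
  The bound is attained because \<open>B\<^sub>e\<close> is complete bipartite: adding both sides of \<open>B\<^sub>e\<close> to a vertex
  set that avoids \<open>B\<^sub>e\<close> suspends its independence complex.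
\<close>

section \<open>Linear maps and transport of modules\<close>

text \<open>\<open>proj_dim\<close> is an infimum over arbitrary projective resolutions, so both
  halves of the Hochster-type criterion work with splittings of one fixed free resolution. Given a
  projective resolution of length at most \<open>n\<close>, comparison maps in both directions
  contract the free one above degree \<open>n\<close>, and the constant terms of the contraction
  solve the cocycle equations. Conversely, a contraction over the field, applied over the polynomial
  ring, has an error coming from the variables alone; finitely many corrections turn it into a
  projection onto the boundaries in degree \<open>n\<close>, and the resolution can be cut off
  there. The constant \<open>deg + deg - 1\<close> is one less than the number of vertices of
  \<open>B_e\<close>: adding these vertices raises \<open>card \<sigma>\<close> by
  \<open>deg + deg\<close>, the suspension raises \<open>j\<close> by one, so
  \<open>card \<sigma> - j\<close> grows by exactly this amount. Projective dimensions are handled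
  only through the statements \<open>\<le> enat n\<close> for all \<open>n\<close>. These determine
  an element of \<open>enat\<close>, so infinite values need no separate finiteness proof.\<close>

lemma linear_maps_closed: "h \<in> linear_maps R M N \<Longrightarrow> a \<in> carrier M \<Longrightarrow> h a \<in> carrier N"
  by (auto simp: linear_maps_def)

lemma linear_maps_add:
  "h \<in> linear_maps R M N \<Longrightarrow> a \<in> carrier M \<Longrightarrow> b \<in> carrier M \<Longrightarrow>
    h (a \<oplus>\<^bsub>M\<^esub> b) = h a \<oplus>\<^bsub>N\<^esub> h b"
  by (auto simp: linear_maps_def)

lemma linear_maps_smult:
  "h \<in> linear_maps R M N \<Longrightarrow> r \<in> carrier R \<Longrightarrow> a \<in> carrier M \<Longrightarrow>
    h (r \<odot>\<^bsub>M\<^esub> a) = r \<odot>\<^bsub>N\<^esub> h a"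
  by (auto simp: linear_maps_def)

lemmas linear_mapsD = linear_maps_closed linear_maps_add linear_maps_smult

lemma linear_mapsI:
  assumes "\<And>a. a \<in> carrier M \<Longrightarrow> h a \<in> carrier N"
    and "\<And>a b. a \<in> carrier M \<Longrightarrow> b \<in> carrier M \<Longrightarrow> h (a \<oplus>\<^bsub>M\<^esub> b) = h a \<oplus>\<^bsub>N\<^esub> h b"
    and "\<And>r a. r \<in> carrier R \<Longrightarrow> a \<in> carrier M \<Longrightarrow> h (r \<odot>\<^bsub>M\<^esub> a) = r \<odot>\<^bsub>N\<^esub> h a"
  shows "h \<in> linear_maps R M N"
  using assms by (auto simp: linear_maps_def)

lemma linear_maps_zero:
  assumes "Module.module R M" "Module.module R N" "h \<in> linear_maps R M N"
  shows "h \<zero>\<^bsub>M\<^esub> = \<zero>\<^bsub>N\<^esub>"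
proof -
  interpret M: Module.module R M by fact
  interpret N: Module.module R N by fact
  have "h \<zero>\<^bsub>M\<^esub> = h (\<zero>\<^bsub>R\<^esub> \<odot>\<^bsub>M\<^esub> \<zero>\<^bsub>M\<^esub>)" by simp
  also have "\<dots> = \<zero>\<^bsub>N\<^esub>"
    using assms(3) by (subst linear_maps_smult[OF assms(3)]) (simp_all add: linear_maps_closed)
  finally show ?thesis .
qed

lemma linear_maps_id: "(\<lambda>a. a) \<in> linear_maps R M M"
  by (auto simp: linear_maps_def)

lemma linear_maps_comp:
  "h \<in> linear_maps R M N \<Longrightarrow> g \<in> linear_maps R N L \<Longrightarrow> (\<lambda>a. g (h a)) \<in> linear_maps R M L"
  by (intro linear_mapsI) (simp_all add: linear_mapsD)

lemma linear_maps_plus: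
  assumes "Module.module R N" "g \<in> linear_maps R M N" "h \<in> linear_maps R M N"
  shows "(\<lambda>a. g a \<oplus>\<^bsub>N\<^esub> h a) \<in> linear_maps R M N"
proof -
  interpret N: Module.module R N by fact
  note D = linear_mapsD[OF assms(2)] linear_mapsD[OF assms(3)]
  show ?thesis by (intro linear_mapsI) (simp_all add: D N.smult_r_distr N.M.a_ac)
qed

lemma linear_maps_minus:
  assumes "Module.module R N" "g \<in> linear_maps R M N" "h \<in> linear_maps R M N"
  shows "(\<lambda>a. g a \<ominus>\<^bsub>N\<^esub> h a) \<in> linear_maps R M N"
proof -
  interpret N: Module.module R N by fact
  note D = linear_mapsD[OF assms(2)] linear_mapsD[OF assms(3)]
  show ?thesis
    by (intro linear_mapsI)
      (simp_all add: D a_minus_def N.smult_r_distr N.M.a_ac N.M.minus_add N.smult_r_minus)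
qed

lemma submodule_image:
  assumes "Module.module R M" "Module.module R N" "h \<in> linear_maps R M N"
  shows "submodule (h ` carrier M) R N"
proof -
  interpret M: Module.module R M by fact
  interpret N: Module.module R N by fact
  note D = linear_mapsD[OF assms(3)]
  have neg: "\<ominus>\<^bsub>N\<^esub> h a = h (\<ominus>\<^bsub>M\<^esub> a)" if "a \<in> carrier M" for a
  proof -
    have "h (\<ominus>\<^bsub>M\<^esub> a) \<oplus>\<^bsub>N\<^esub> h a = \<zero>\<^bsub>N\<^esub>"
      using that by (simp flip: D(2) add: M.M.l_neg linear_maps_zero[OF assms])
    then show ?thesis using that by (simp add: D N.M.minus_equality)
  qed
  show ?thesis
  proof (unfold_locales; (elim imageE)?)
    show "h ` carrier M \<subseteq> carrier (add_monoid N)" by (auto simp: D)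
    show "\<one>\<^bsub>add_monoid N\<^esub> \<in> h ` carrier M"
      using linear_maps_zero[OF assms] by (metis M.M.zero_closed image_eqI monoid.simps(2))
  next
    fix x y a b assume "x = h a" "y = h b" "a \<in> carrier M" "b \<in> carrier M"
    then show "x \<otimes>\<^bsub>add_monoid N\<^esub> y \<in> h ` carrier M"
      by (auto simp flip: D(2))
  next
    fix x a assume "x = h a" "a \<in> carrier M"
    then show "inv\<^bsub>add_monoid N\<^esub> x \<in> h ` carrier M"
      using neg by (auto simp flip: a_inv_def)
  next
    fix r x a assume "x = h a" "a \<in> carrier M" "r \<in> carrier R"
    then show "r \<odot>\<^bsub>N\<^esub> x \<in> h ` carrier M"
      by (auto simp flip: D(3))
  qed
qed

lemma module_image:
  assumes "Module.module R M" "Module.module R N" "h \<in> linear_maps R M N"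
  shows "Module.module R (N\<lparr>carrier := h ` carrier M\<rparr>)"
proof -
  interpret N: Module.module R N by fact
  show ?thesis using submodule.submodule_is_module[OF submodule_image[OF assms]] N.module_axioms by blast
qed

definition transport :: "('m \<Rightarrow> 'n) \<Rightarrow> ('r, 'm) module \<Rightarrow> ('r, 'n) module" where
  "transport j M =
     \<lparr>carrier = j ` carrier M, mult = (\<lambda>a b. j \<zero>\<^bsub>M\<^esub>), one = j \<zero>\<^bsub>M\<^esub>, zero = j \<zero>\<^bsub>M\<^esub>,
      add = (\<lambda>a b. j (inv_into (carrier M) j a \<oplus>\<^bsub>M\<^esub> inv_into (carrier M) j b)),
      smult = (\<lambda>r a. j (r \<odot>\<^bsub>M\<^esub> inv_into (carrier M) j a))\<rparr>"

lemma transport_simps [simp]: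
  "carrier (transport j M) = j ` carrier M"
  "\<zero>\<^bsub>transport j M\<^esub> = j \<zero>\<^bsub>M\<^esub>"
  by (simp_all add: transport_def)

lemma
  assumes "inj_on j (carrier M)"
  shows transport_add: "a \<in> carrier M \<Longrightarrow> b \<in> carrier M \<Longrightarrow> j a \<oplus>\<^bsub>transport j M\<^esub> j b = j (a \<oplus>\<^bsub>M\<^esub> b)"
    and transport_smult: "a \<in> carrier M \<Longrightarrow> r \<odot>\<^bsub>transport j M\<^esub> j a = j (r \<odot>\<^bsub>M\<^esub> a)"
  using assms by (simp_all add: transport_def)

lemma module_transport:
  assumes "Module.module R M" "inj_on j (carrier M)"
  shows "Module.module R (transport j M)"
proof -
  interpret M: Module.module R M by fact
  note T = transport_add[OF assms(2)] transport_smult[OF assms(2)]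
  have "abelian_group (transport j M)"
  proof (rule abelian_groupI)
    show "\<exists>y\<in>carrier (transport j M). y \<oplus>\<^bsub>transport j M\<^esub> x = \<zero>\<^bsub>transport j M\<^esub>"
      if "x \<in> carrier (transport j M)" for x
    proof -
      from that obtain a where a: "a \<in> carrier M" "x = j a" by auto
      then show ?thesis by (intro bexI[of _ "j (\<ominus>\<^bsub>M\<^esub> a)"]) (simp_all add: T M.M.l_neg)
    qed
  qed (auto simp: T M.M.a_ac)
  then show ?thesis
    by (intro moduleI M.R.cring_axioms)
      (auto simp: T M.smult_l_distr M.smult_r_distr M.smult_assoc1)
qed

lemma linear_maps_transport:
  assumes "inj_on j (carrier M)" "Module.module R M"
  shows "j \<in> linear_maps R M (transport j M)"
    and "inv_into (carrier M) j \<in> linear_maps R (transport j M) M"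
proof -
  interpret M: Module.module R M by fact
  note T = transport_add[OF assms(1)] transport_smult[OF assms(1)]
  show "j \<in> linear_maps R M (transport j M)"
    by (intro linear_mapsI) (simp_all add: T)
  show "inv_into (carrier M) j \<in> linear_maps R (transport j M) M"
    using assms(1) by (intro linear_mapsI) (auto simp: T)
qed

text \<open>\<open>projective_module\<close> tests only modules with elements in \<open>'m\<close>
  and only surjective \<open>s\<close>. The embeddings \<open>i\<close> and \<open>j\<close> carry
  modules of other types into \<open>'m\<close>, and \<open>N\<close> is first cut down to the image
  of \<open>s\<close>, where \<open>s\<close> is onto.\<close>

lemma projective_module_lift:
  fixes P :: "('r, 'm) module" and M :: "('r, 'a) module" and N :: "('r, 'b) module"
    and i :: "'a \<Rightarrow> 'm" and j :: "'b \<Rightarrow> 'm"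
  assumes P: "projective_module R P" and M: "Module.module R M" and N: "Module.module R N"
    and i: "inj_on i (carrier M)" and j: "inj_on j (carrier N)"
    and s: "s \<in> linear_maps R M N" and t: "t \<in> linear_maps R P N"
    and sub: "t ` carrier P \<subseteq> s ` carrier M"
  shows "\<exists>l\<in>linear_maps R P M. \<forall>a\<in>carrier P. s (l a) = t a"
proof -
  let ?N = "N\<lparr>carrier := s ` carrier M\<rparr>"
  have N': "Module.module R ?N" by (rule module_image[OF M N s])
  have subN: "s ` carrier M \<subseteq> carrier N" using linear_maps_closed[OF s] by auto
  then have j': "inj_on j (carrier ?N)" using j by (auto intro: inj_on_subset)
  have s': "s \<in> linear_maps R M ?N" using s by (auto simp: linear_maps_def)
  have t': "t \<in> linear_maps R P ?N" using t sub by (auto simp: linear_maps_def)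
  let ?s = "\<lambda>a. j (s (inv_into (carrier M) i a))" and ?t = "\<lambda>a. j (t a)"
  have s2: "?s \<in> linear_maps R (transport i M) (transport j ?N)"
    using linear_maps_comp[OF linear_maps_comp[OF linear_maps_transport(2)[OF i M] s']
        linear_maps_transport(1)[OF j' N']] .
  have t2: "?t \<in> linear_maps R P (transport j ?N)"
    using linear_maps_comp[OF t' linear_maps_transport(1)[OF j' N']] .
  have surj: "?s ` carrier (transport i M) = carrier (transport j ?N)"
    using i by (auto simp: image_image)
  obtain l where l: "l \<in> linear_maps R P (transport i M)" "\<forall>a\<in>carrier P. ?s (l a) = ?t a"
    using P module_transport[OF M i] module_transport[OF N' j'] s2 t2 surj
    unfolding projective_module_def by blast
  show ?thesis
  proof (intro bexI[of _ "\<lambda>a. inv_into (carrier M) i (l a)"] ballI)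
    show l': "(\<lambda>a. inv_into (carrier M) i (l a)) \<in> linear_maps R P M"
      using linear_maps_comp[OF l(1) linear_maps_transport(2)[OF i M]] .
    fix a assume a: "a \<in> carrier P"
    show "s (inv_into (carrier M) i (l a)) = t a"
      using l(2) a j' linear_maps_closed[OF t' a] linear_maps_closed[OF s' linear_maps_closed[OF l' a]]
      by (auto simp: inj_on_def)
  qed
qed

section \<open>Free modules on a finite set and lifting of maps out of them\<close>

definition free_mod :: "('r, 's) ring_scheme \<Rightarrow> 'b set \<Rightarrow> ('r, 'b \<Rightarrow> 'r) module" where
  "free_mod R J =
     \<lparr>carrier = {c. \<forall>b. c b \<in> carrier R \<and> (b \<notin> J \<longrightarrow> c b = \<zero>\<^bsub>R\<^esub>)}, mult = (\<lambda>a b. a),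
      one = (\<lambda>b. \<zero>\<^bsub>R\<^esub>), zero = (\<lambda>b. \<zero>\<^bsub>R\<^esub>), add = (\<lambda>c c' b. c b \<oplus>\<^bsub>R\<^esub> c' b),
      smult = (\<lambda>r c b. r \<otimes>\<^bsub>R\<^esub> c b)\<rparr>"

lemma free_mod_simps [simp]:
  "carrier (free_mod R J) = {c. \<forall>b. c b \<in> carrier R \<and> (b \<notin> J \<longrightarrow> c b = \<zero>\<^bsub>R\<^esub>)}"
  "\<zero>\<^bsub>free_mod R J\<^esub> = (\<lambda>b. \<zero>\<^bsub>R\<^esub>)"
  "c \<oplus>\<^bsub>free_mod R J\<^esub> c' = (\<lambda>b. c b \<oplus>\<^bsub>R\<^esub> c' b)"
  "r \<odot>\<^bsub>free_mod R J\<^esub> c = (\<lambda>b. r \<otimes>\<^bsub>R\<^esub> c b)"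
  by (simp_all add: free_mod_def)

lemma module_free_mod:
  assumes "cring R"
  shows "Module.module R (free_mod R J)"
proof -
  interpret cring R by fact
  have "abelian_group (free_mod R J)"
  proof (rule abelian_groupI)
    show "\<exists>y\<in>carrier (free_mod R J). y \<oplus>\<^bsub>free_mod R J\<^esub> x = \<zero>\<^bsub>free_mod R J\<^esub>"
      if "x \<in> carrier (free_mod R J)" for x
      using that by (intro bexI[of _ "\<lambda>b. \<ominus>\<^bsub>R\<^esub> x b"]) (auto simp: l_neg)
  qed (auto simp: a_ac)
  then show ?thesis
    by (intro moduleI assms) (auto simp: l_distr r_distr m_assoc)
qed

text \<open>Induction on \<open>J\<close>: the coordinate \<open>x\<close> is sent to a chosen
  preimage \<open>m\<close> of the image of its unit vector. \<open>free_mod\<close> imposes no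
  finite support, so \<open>J\<close> has to be finite. Unlike in \<open>projective_module\<close>,
  the types of \<open>M\<close> and \<open>N\<close> are arbitrary.\<close>

lemma free_mod_lift:
  assumes R: "cring R" and "finite J" and M: "Module.module R M" and N: "Module.module R N"
    and s: "s \<in> linear_maps R M N"
    and "h \<in> linear_maps R (free_mod R J) N"
    and "h ` carrier (free_mod R J) \<subseteq> s ` carrier M"
  shows "\<exists>l\<in>linear_maps R (free_mod R J) M. \<forall>c\<in>carrier (free_mod R J). s (l c) = h c"
  using assms(2,6,7)
proof (induction J)
  interpret R: cring R by fact
  interpret M: Module.module R M by fact
  interpret N: Module.module R N by fact
  case empty
  have h0: "h (\<lambda>b. \<zero>\<^bsub>R\<^esub>) = \<zero>\<^bsub>N\<^esub>"
    using linear_maps_zero[OF module_free_mod[OF R] N empty(1)] by simp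
  have c0: "c = (\<lambda>b. \<zero>\<^bsub>R\<^esub>)" if "c \<in> carrier (free_mod R {})" for c
    using that by (intro ext) simp
  have "(\<lambda>c. \<zero>\<^bsub>M\<^esub>) \<in> linear_maps R (free_mod R {}) M"
    by (intro linear_mapsI) (simp_all del: free_mod_simps)
  moreover have "s \<zero>\<^bsub>M\<^esub> = h c" if "c \<in> carrier (free_mod R {})" for c
    using c0[OF that] h0 linear_maps_zero[OF M N s] by simp
  ultimately show ?case by (intro bexI[of _ "\<lambda>c. \<zero>\<^bsub>M\<^esub>"]) (simp_all del: free_mod_simps)
next
  interpret R: cring R by fact
  interpret M: Module.module R M by fact
  interpret N: Module.module R N by fact
  case (insert x J)
  let ?F = "free_mod R J" and ?F' = "free_mod R (insert x J)"
  let ?e = "(\<lambda>b. \<zero>\<^bsub>R\<^esub>)(x := \<one>\<^bsub>R\<^esub>)"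
  have sub: "carrier ?F \<subseteq> carrier ?F'" by auto
  have h1: "h \<in> linear_maps R ?F N"
    using linear_maps_closed[OF insert.prems(1) subsetD[OF sub]]
      linear_maps_smult[OF insert.prems(1) _ subsetD[OF sub]]
      linear_maps_add[OF insert.prems(1) subsetD[OF sub] subsetD[OF sub]]
    by (intro linear_mapsI) simp_all
  have h2: "h ` carrier ?F \<subseteq> s ` carrier M"
    by (rule subset_trans[OF image_mono[OF sub] insert.prems(2)])
  obtain l where l: "l \<in> linear_maps R ?F M" and sl: "\<forall>c\<in>carrier ?F. s (l c) = h c"
    using insert.IH[OF h1 h2] by (elim bexE) (rule that)
  have e: "?e \<in> carrier ?F'" by auto
  obtain m where m: "m \<in> carrier M" "s m = h ?e"
    using subsetD[OF insert.prems(2) imageI[OF e]] by (elim imageE) (rule that, assumption, rule sym, assumption)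
  let ?r = "\<lambda>c. c(x := \<zero>\<^bsub>R\<^esub>)"
  have r: "?r c \<in> carrier ?F" if "c \<in> carrier ?F'" for c using that by auto
  let ?l = "\<lambda>c. l (?r c) \<oplus>\<^bsub>M\<^esub> c x \<odot>\<^bsub>M\<^esub> m"
  note D = linear_mapsD[OF l] linear_mapsD[OF s] linear_mapsD[OF insert.prems(1)]
  have "?l \<in> linear_maps R ?F' M"
  proof (rule linear_mapsI)
    fix c assume c: "c \<in> carrier ?F'"
    show "?l c \<in> carrier M" using D(1)[OF r[OF c]] c m by auto
  next
    fix c c' assume c: "c \<in> carrier ?F'" "c' \<in> carrier ?F'"
    have "?r (c \<oplus>\<^bsub>?F'\<^esub> c') = ?r c \<oplus>\<^bsub>?F\<^esub> ?r c'" by auto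
    then have "l (?r (c \<oplus>\<^bsub>?F'\<^esub> c')) = l (?r c) \<oplus>\<^bsub>M\<^esub> l (?r c')"
      using D(2)[OF r[OF c(1)] r[OF c(2)]] by simp
    then show "?l (c \<oplus>\<^bsub>?F'\<^esub> c') = ?l c \<oplus>\<^bsub>M\<^esub> ?l c'"
      using D(1)[OF r[OF c(1)]] D(1)[OF r[OF c(2)]] c m by (simp add: M.smult_l_distr M.M.a_ac)
  next
    fix a c assume a: "a \<in> carrier R" and c: "c \<in> carrier ?F'"
    have "?r (a \<odot>\<^bsub>?F'\<^esub> c) = a \<odot>\<^bsub>?F\<^esub> ?r c" using a by auto
    then have "l (?r (a \<odot>\<^bsub>?F'\<^esub> c)) = a \<odot>\<^bsub>M\<^esub> l (?r c)"
      using D(3)[OF a r[OF c]] by simp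
    then show "?l (a \<odot>\<^bsub>?F'\<^esub> c) = a \<odot>\<^bsub>M\<^esub> ?l c"
      using D(1)[OF r[OF c]] a c m by (simp add: M.smult_r_distr M.smult_assoc1)
  qed
  moreover have "s (?l c) = h c" if c: "c \<in> carrier ?F'" for c
  proof -
    have "s (?l c) = h (?r c) \<oplus>\<^bsub>N\<^esub> c x \<odot>\<^bsub>N\<^esub> h ?e"
      using D(1)[OF r[OF c]] c m sl r[OF c] by (simp add: D)
    also have "\<dots> = h (?r c \<oplus>\<^bsub>?F'\<^esub> c x \<odot>\<^bsub>?F'\<^esub> ?e)"
    proof -
      have cx: "c x \<in> carrier R" using c by auto
      interpret F: Module.module R ?F' by (rule module_free_mod[OF R])
      have 1: "c x \<odot>\<^bsub>?F'\<^esub> ?e \<in> carrier ?F'" by (rule F.smult_closed[OF cx e])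
      have 2: "?r c \<in> carrier ?F'" by (rule subsetD[OF sub r[OF c]])
      show ?thesis by (simp only: D(8)[OF 2 1] D(9)[OF cx e])
    qed
    also have "?r c \<oplus>\<^bsub>?F'\<^esub> c x \<odot>\<^bsub>?F'\<^esub> ?e = c"
      using c by auto
    finally show ?thesis .
  qed
  ultimately show ?case by (intro bexI[of _ ?l]) (simp_all del: free_mod_simps)
qed

section \<open>Resolutions by free modules\<close>

lemma (in Module.module) minus_zero_right:
  assumes "c \<in> carrier M"
  shows "c \<ominus>\<^bsub>M\<^esub> \<zero>\<^bsub>M\<^esub> = c"
proof -
  have "\<ominus>\<^bsub>M\<^esub> \<zero>\<^bsub>M\<^esub> = \<zero>\<^bsub>M\<^esub>" by (rule M.minus_equality) simp_all
  then show ?thesis using assms by (simp add: a_minus_def)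
qed

lemma linear_maps_a_minus:
  assumes "Module.module R M" "Module.module R N" "h \<in> linear_maps R M N"
    and "a \<in> carrier M" "b \<in> carrier M"
  shows "h (a \<ominus>\<^bsub>M\<^esub> b) = h a \<ominus>\<^bsub>N\<^esub> h b"
proof -
  interpret M: Module.module R M by fact
  interpret N: Module.module R N by fact
  note D = linear_mapsD[OF assms(3)]
  have "h (a \<ominus>\<^bsub>M\<^esub> b) \<oplus>\<^bsub>N\<^esub> h b = h a"
    using assms(4,5) by (simp flip: D(2) add: a_minus_def M.M.a_assoc M.M.l_neg)
  then have "h a \<ominus>\<^bsub>N\<^esub> h b = (h (a \<ominus>\<^bsub>M\<^esub> b) \<oplus>\<^bsub>N\<^esub> h b) \<ominus>\<^bsub>N\<^esub> h b" by simp
  also have "\<dots> = h (a \<ominus>\<^bsub>M\<^esub> b)"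
    using assms(4,5) by (simp add: D a_minus_def N.M.a_assoc N.M.r_neg)
  finally show ?thesis by simp
qed

lemma linear_maps_minus_kernel:
  assumes "Module.module R M" "Module.module R N" "h \<in> linear_maps R M N"
    and "a \<in> carrier M" "b \<in> carrier M" "h b = \<zero>\<^bsub>N\<^esub>"
  shows "h (a \<ominus>\<^bsub>M\<^esub> b) = h a"
proof -
  interpret N: Module.module R N by fact
  show ?thesis
    unfolding linear_maps_a_minus[OF assms(1-5)] assms(6)
    by (rule N.minus_zero_right[OF linear_maps_closed[OF assms(3,4)]])
qed

text \<open>The exactness part of \<open>projective_resolution\<close>, with terms of any type, so
  that it also applies to the free modules on cells.\<close>

definition resolution ::
  "('r, 's) ring_scheme \<Rightarrow> ('r, 'm) module \<Rightarrow> (nat \<Rightarrow> ('r, 'n) module) \<Rightarrow>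
     (nat \<Rightarrow> 'n \<Rightarrow> 'n) \<Rightarrow> ('n \<Rightarrow> 'm) \<Rightarrow> bool" where
  "resolution R M X d e \<longleftrightarrow>
     (\<forall>i. d i \<in> linear_maps R (X (Suc i)) (X i)) \<and>
     e \<in> linear_maps R (X 0) M \<and>
     e ` carrier (X 0) = carrier M \<and>
     d 0 ` carrier (X 1) = {a \<in> carrier (X 0). e a = \<zero>\<^bsub>M\<^esub>} \<and>
     (\<forall>i. d (Suc i) ` carrier (X (Suc (Suc i))) = {a \<in> carrier (X (Suc i)). d i a = \<zero>\<^bsub>X i\<^esub>})"

lemma
  assumes "resolution R M X d e"
  shows resolution_d: "d i \<in> linear_maps R (X (Suc i)) (X i)"
    and resolution_e: "e \<in> linear_maps R (X 0) M"
    and resolution_surj: "e ` carrier (X 0) = carrier M"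
    and resolution_exact_0: "d 0 ` carrier (X (Suc 0)) = {a \<in> carrier (X 0). e a = \<zero>\<^bsub>M\<^esub>}"
    and resolution_exact: "d (Suc i) ` carrier (X (Suc (Suc i))) = {a \<in> carrier (X (Suc i)). d i a = \<zero>\<^bsub>X i\<^esub>}"
  using assms unfolding resolution_def One_nat_def by - (elim conjE, (assumption | erule spec))+

lemma
  assumes "resolution R M X d e"
  shows resolution_ed: "a \<in> carrier (X (Suc 0)) \<Longrightarrow> e (d 0 a) = \<zero>\<^bsub>M\<^esub>"
    and resolution_dd: "a \<in> carrier (X (Suc (Suc i))) \<Longrightarrow> d i (d (Suc i) a) = \<zero>\<^bsub>X i\<^esub>"
    and resolution_lift_0: "b \<in> carrier (X 0) \<Longrightarrow> e b = \<zero>\<^bsub>M\<^esub> \<Longrightarrow> b \<in> d 0 ` carrier (X (Suc 0))"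
    and resolution_lift: "b \<in> carrier (X (Suc i)) \<Longrightarrow> d i b = \<zero>\<^bsub>X i\<^esub> \<Longrightarrow>
      b \<in> d (Suc i) ` carrier (X (Suc (Suc i)))"
proof -
  have "d 0 a \<in> {a \<in> carrier (X 0). e a = \<zero>\<^bsub>M\<^esub>}" if "a \<in> carrier (X (Suc 0))"
    unfolding resolution_exact_0[OF assms, symmetric] using that by (rule imageI)
  then show "a \<in> carrier (X (Suc 0)) \<Longrightarrow> e (d 0 a) = \<zero>\<^bsub>M\<^esub>" by blast
  have "d (Suc i) a \<in> {a \<in> carrier (X (Suc i)). d i a = \<zero>\<^bsub>X i\<^esub>}" if "a \<in> carrier (X (Suc (Suc i)))"
    unfolding resolution_exact[OF assms, symmetric] using that by (rule imageI)
  then show "a \<in> carrier (X (Suc (Suc i))) \<Longrightarrow> d i (d (Suc i) a) = \<zero>\<^bsub>X i\<^esub>" by blast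
qed (simp_all add: resolution_exact_0[OF assms] resolution_exact[OF assms])

text \<open>The comparison theorem. Lifting is assumed for the pair \<open>X\<close>,
  \<open>Y\<close> instead of projectivity of \<open>X\<close>, because maps out of free modules and
  maps out of modules satisfying \<open>projective_module\<close> are lifted by different lemmas,
  and the result is used in both directions.\<close>

lemma comparison_maps:
  assumes modX: "\<And>i. Module.module R (X i)" and modY: "\<And>i. Module.module R (Y i)"
    and X: "resolution R M X dX eX" and Y: "resolution R M Y dY eY"
    and lift0: "\<exists>l\<in>linear_maps R (X 0) (Y 0). \<forall>a\<in>carrier (X 0). eY (l a) = eX a"
    and liftS: "\<And>i t. t \<in> linear_maps R (X (Suc i)) (Y i) \<Longrightarrow>
      t ` carrier (X (Suc i)) \<subseteq> dY i ` carrier (Y (Suc i)) \<Longrightarrow>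
      \<exists>l\<in>linear_maps R (X (Suc i)) (Y (Suc i)). \<forall>a\<in>carrier (X (Suc i)). dY i (l a) = t a"
  shows "\<exists>f. (\<forall>i. f i \<in> linear_maps R (X i) (Y i)) \<and> (\<forall>a\<in>carrier (X 0). eY (f 0 a) = eX a) \<and>
    (\<forall>i. \<forall>a\<in>carrier (X (Suc i)). dY i (f (Suc i) a) = f i (dX i a))"
proof -
  \<comment> \<open>The last conjunct makes the choice continue: it says that \<open>f\<close> after
    the differential lands in the boundaries of \<open>Y\<close>, which is what the next lift
    requires.\<close>
  define P where "P i f \<longleftrightarrow> f \<in> linear_maps R (X i) (Y i) \<and>
    (i = 0 \<longrightarrow> (\<forall>a\<in>carrier (X 0). eY (f a) = eX a)) \<and>
    (\<forall>a\<in>carrier (X (Suc i)). f (dX i a) \<in> dY i ` carrier (Y (Suc i)))" for i f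
  define Q where "Q i f f' \<longleftrightarrow> (\<forall>a\<in>carrier (X (Suc i)). dY i (f' a) = f (dX i a))" for i f f'
  have "\<exists>f. \<forall>i. P i (f i) \<and> Q i (f i) (f (Suc i))"
  proof (rule dependent_nat_choice)
    from lift0 obtain l where l: "l \<in> linear_maps R (X 0) (Y 0)"
      "\<And>a. a \<in> carrier (X 0) \<Longrightarrow> eY (l a) = eX a" by blast
    have "l (dX 0 a) \<in> dY 0 ` carrier (Y (Suc 0))" if "a \<in> carrier (X (Suc 0))" for a
      using that by (intro resolution_lift_0[OF Y]) (simp_all add: l resolution_ed[OF X] linear_maps_closed[OF l(1)] linear_maps_closed[OF resolution_d[OF X]])
    with l show "\<exists>f. P 0 f" unfolding P_def by blast
  next
    fix f i assume f: "P i f"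
    have c: "(\<lambda>a. f (dX i a)) \<in> linear_maps R (X (Suc i)) (Y i)"
      using f resolution_d[OF X] by (auto simp: P_def intro: linear_maps_comp)
    have "(\<lambda>a. f (dX i a)) ` carrier (X (Suc i)) \<subseteq> dY i ` carrier (Y (Suc i))"
      using f by (auto simp: P_def)
    from liftS[OF c this] obtain l where l: "l \<in> linear_maps R (X (Suc i)) (Y (Suc i))"
      "\<And>a. a \<in> carrier (X (Suc i)) \<Longrightarrow> dY i (l a) = f (dX i a)" by blast
    have "l (dX (Suc i) a) \<in> dY (Suc i) ` carrier (Y (Suc (Suc i)))"
      if a: "a \<in> carrier (X (Suc (Suc i)))" for a
    proof (rule resolution_lift[OF Y])
      have b: "dX (Suc i) a \<in> carrier (X (Suc i))" using linear_maps_closed[OF resolution_d[OF X] a] .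
      then show "l (dX (Suc i) a) \<in> carrier (Y (Suc i))" by (rule linear_maps_closed[OF l(1)])
      have "f \<zero>\<^bsub>X i\<^esub> = \<zero>\<^bsub>Y i\<^esub>"
        using f by (intro linear_maps_zero[OF modX modY]) (simp add: P_def)
      then show "dY i (l (dX (Suc i) a)) = \<zero>\<^bsub>Y i\<^esub>" by (simp add: l(2)[OF b] resolution_dd[OF X a])
    qed
    with l show "\<exists>f'. P (Suc i) f' \<and> Q i f f'" unfolding P_def Q_def by blast
  qed
  then obtain f where "\<And>i. P i (f i)" "\<And>i. Q i (f i) (f (Suc i))" by blast
  then show ?thesis by (intro exI[of _ f]) (simp add: P_def Q_def)
qed

text \<open>A chain map that covers the zero map of the resolved modules is null-homotopic. The
  homotopy formula is recorded in positive degrees only, which are the degrees above some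
  \<open>n\<close>.\<close>

lemma null_homotopy:
  assumes modX: "\<And>i. Module.module R (X i)" and modY: "\<And>i. Module.module R (Y i)"
    and X: "resolution R N X dX eX" and Y: "resolution R M Y dY eY"
    and lift: "\<And>i t. t \<in> linear_maps R (X i) (Y i) \<Longrightarrow>
      t ` carrier (X i) \<subseteq> dY i ` carrier (Y (Suc i)) \<Longrightarrow>
      \<exists>l\<in>linear_maps R (X i) (Y (Suc i)). \<forall>a\<in>carrier (X i). dY i (l a) = t a"
    and r: "\<And>i. r i \<in> linear_maps R (X i) (Y i)"
    and r0: "\<And>a. a \<in> carrier (X 0) \<Longrightarrow> eY (r 0 a) = \<zero>\<^bsub>M\<^esub>"
    and rS: "\<And>i a. a \<in> carrier (X (Suc i)) \<Longrightarrow> dY i (r (Suc i) a) = r i (dX i a)"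
  shows "\<exists>s. (\<forall>i. s i \<in> linear_maps R (X i) (Y (Suc i))) \<and>
    (\<forall>i. \<forall>a\<in>carrier (X (Suc i)).
      r (Suc i) a = dY (Suc i) (s (Suc i) a) \<oplus>\<^bsub>Y (Suc i)\<^esub> s i (dX i a))"
proof -
  \<comment> \<open>On boundaries of \<open>X\<close> the map \<open>s\<close> already solves the
    homotopy equation. Hence \<open>r (Suc i) - s \<circ> d\<close> takes values in cycles of
    \<open>Y\<close> and can be lifted once more.\<close>
  define P where "P i s \<longleftrightarrow> s \<in> linear_maps R (X i) (Y (Suc i)) \<and>
    (\<forall>a\<in>carrier (X (Suc i)). dY i (s (dX i a)) = r i (dX i a))" for i s
  define Q where "Q i s s' \<longleftrightarrow> (\<forall>a\<in>carrier (X (Suc i)).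
    dY (Suc i) (s' a) = r (Suc i) a \<ominus>\<^bsub>Y (Suc i)\<^esub> s (dX i a))" for i s s'
  have dXc: "dX i a \<in> carrier (X i)" if "a \<in> carrier (X (Suc i))" for i a
    using linear_maps_closed[OF resolution_d[OF X] that] .
  have "\<exists>s. \<forall>i. P i (s i) \<and> Q i (s i) (s (Suc i))"
  proof (rule dependent_nat_choice)
    have "r 0 ` carrier (X 0) \<subseteq> dY 0 ` carrier (Y (Suc 0))"
      using resolution_lift_0[OF Y] r0 linear_maps_closed[OF r] by blast
    from lift[OF r this] obtain l where "l \<in> linear_maps R (X 0) (Y (Suc 0))"
      "\<And>a. a \<in> carrier (X 0) \<Longrightarrow> dY 0 (l a) = r 0 a" by blast
    then show "\<exists>s. P 0 s" unfolding P_def using dXc by blast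
  next
    fix s i assume s: "P i s"
    then have sl: "s \<in> linear_maps R (X i) (Y (Suc i))" by (simp add: P_def)
    let ?t = "\<lambda>a. r (Suc i) a \<ominus>\<^bsub>Y (Suc i)\<^esub> s (dX i a)"
    have t: "?t \<in> linear_maps R (X (Suc i)) (Y (Suc i))"
      by (intro linear_maps_minus modY r linear_maps_comp[OF resolution_d[OF X] sl])
    have "?t a \<in> dY (Suc i) ` carrier (Y (Suc (Suc i)))" if a: "a \<in> carrier (X (Suc i))" for a
    proof (rule resolution_lift[OF Y])
      interpret Yi: Module.module R "Y i" by (rule modY)
      show "?t a \<in> carrier (Y (Suc i))" by (rule linear_maps_closed[OF t a])
      have "dY i (?t a) = dY i (r (Suc i) a) \<ominus>\<^bsub>Y i\<^esub> dY i (s (dX i a))"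
        by (intro linear_maps_a_minus[OF modY modY resolution_d[OF Y]] linear_maps_closed[OF r a]
            linear_maps_closed[OF sl dXc[OF a]])
      also have "\<dots> = r i (dX i a) \<ominus>\<^bsub>Y i\<^esub> r i (dX i a)" using s a by (simp add: P_def rS)
      also have "\<dots> = \<zero>\<^bsub>Y i\<^esub>"
        using linear_maps_closed[OF r dXc[OF a]] by (simp add: a_minus_def Yi.M.r_neg)
      finally show "dY i (?t a) = \<zero>\<^bsub>Y i\<^esub>" .
    qed
    then have "?t ` carrier (X (Suc i)) \<subseteq> dY (Suc i) ` carrier (Y (Suc (Suc i)))" by blast
    from lift[OF t this] obtain l where l: "l \<in> linear_maps R (X (Suc i)) (Y (Suc (Suc i)))"
      "\<And>a. a \<in> carrier (X (Suc i)) \<Longrightarrow> dY (Suc i) (l a) = ?t a" by blast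
    have "dY (Suc i) (l (dX (Suc i) a)) = r (Suc i) (dX (Suc i) a)"
      if a: "a \<in> carrier (X (Suc (Suc i)))" for a
    proof -
      interpret Yi: Module.module R "Y (Suc i)" by (rule modY)
      have "dY (Suc i) (l (dX (Suc i) a)) = r (Suc i) (dX (Suc i) a) \<ominus>\<^bsub>Y (Suc i)\<^esub> \<zero>\<^bsub>Y (Suc i)\<^esub>"
        by (simp add: l(2)[OF dXc[OF a]] resolution_dd[OF X a] linear_maps_zero[OF modX modY sl])
      then show ?thesis using linear_maps_closed[OF r dXc[OF a]] by (simp add: a_minus_def)
    qed
    with l show "\<exists>s'. P (Suc i) s' \<and> Q i s s'" unfolding P_def Q_def by blast
  qed
  then obtain s where s: "\<And>i. P i (s i)" "\<And>i. Q i (s i) (s (Suc i))" by blast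
  show ?thesis
  proof (intro exI[of _ s] conjI allI ballI)
    show sl: "s i \<in> linear_maps R (X i) (Y (Suc i))" for i using s(1) by (simp add: P_def)
    fix i a assume a: "a \<in> carrier (X (Suc i))"
    interpret Yi: Module.module R "Y (Suc i)" by (rule modY)
    note c = linear_maps_closed[OF r a] linear_maps_closed[OF sl dXc[OF a]]
    have "dY (Suc i) (s (Suc i) a) = r (Suc i) a \<ominus>\<^bsub>Y (Suc i)\<^esub> s i (dX i a)"
      using s(2)[of i] a unfolding Q_def by (rule bspec)
    then show "r (Suc i) a = dY (Suc i) (s (Suc i) a) \<oplus>\<^bsub>Y (Suc i)\<^esub> s i (dX i a)"
      by (simp only: a_minus_def Yi.M.a_assoc c Yi.M.a_inv_closed Yi.M.l_neg Yi.M.r_zero)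
  qed
qed

text \<open>A function vanishing outside the finite set \<open>J\<close> is determined by its values
  along an enumeration of \<open>J\<close>. The target \<open>nat \<Rightarrow> 'r\<close> is the
  type over which \<open>projective_resolution\<close> quantifies.\<close>

lemma ex_embedding_free_mod:
  assumes "finite J"
  shows "\<exists>i :: ('b \<Rightarrow> 'r) \<Rightarrow> (nat \<Rightarrow> 'r). inj_on i (carrier (free_mod R (J :: 'b set)))"
proof -
  obtain g :: "'b \<Rightarrow> nat" where g: "inj_on g J" using assms by (meson finite_imp_inj_to_nat_seg)
  show ?thesis
  proof (intro exI[of _ "\<lambda>c k. c (inv_into J g k)"] inj_onI ext)
    fix c c' b assume c: "c \<in> carrier (free_mod R J)" "c' \<in> carrier (free_mod R J)"
      and eq: "(\<lambda>k. c (inv_into J g k)) = (\<lambda>k. c' (inv_into J g k))"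
    show "c b = c' b"
    proof (cases "b \<in> J")
      case True
      then show ?thesis using fun_cong[OF eq, of "g b"] g by simp
    qed (use c in simp)
  qed
qed

text \<open>Take a projective resolution \<open>P\<close> of length at most \<open>n\<close> and
  comparison maps \<open>f\<close> to \<open>P\<close> and \<open>g\<close> back. The map
  \<open>id - g \<circ> f\<close> covers zero, so it is null-homotopic; above degree
  \<open>n\<close> the modules \<open>P k\<close> vanish, so there the identity itself is
  null-homotopic. The embedding of \<open>M\<close> allows lifting along the augmentation.\<close>

theorem ex_contraction_above_proj_dim:
  fixes R :: "('r, 's) ring_scheme" and M :: "('r, 'm) module" and J :: "nat \<Rightarrow> 'b set"
    and i :: "'m \<Rightarrow> nat \<Rightarrow> 'r"
  assumes R: "cring R" and M: "Module.module R M" and i: "inj_on i (carrier M)"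
    and fin: "\<And>k. finite (J k)" and F: "resolution R M (\<lambda>k. free_mod R (J k)) d e"
    and pd: "proj_dim R M \<le> enat n"
  obtains s where "\<And>k. s k \<in> linear_maps R (free_mod R (J k)) (free_mod R (J (Suc k)))"
    and "\<And>k c. n \<le> k \<Longrightarrow> c \<in> carrier (free_mod R (J (Suc k))) \<Longrightarrow>
      c = d (Suc k) (s (Suc k) c) \<oplus>\<^bsub>free_mod R (J (Suc k))\<^esub> s k (d k c)"
proof -
  let ?F = "\<lambda>k. free_mod R (J k)"
  have modF: "Module.module R (?F k)" for k by (rule module_free_mod[OF R])
  have d: "d k \<in> linear_maps R (?F (Suc k)) (?F k)" for k by (rule resolution_d[OF F])
  have e: "e \<in> linear_maps R (?F 0) M" by (rule resolution_e[OF F])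
  let ?A = "{n. \<exists>P d \<epsilon>. projective_resolution R M P d \<epsilon> \<and> (\<forall>i>n. carrier (P i) = {\<zero>\<^bsub>P i\<^esub>})}"
  \<comment> \<open>If every length occurring in \<open>?A\<close> exceeded \<open>n\<close>, the
    infimum would be at least \<open>n + 1\<close>.\<close>
  have "\<exists>m\<in>?A. m \<le> n"
  proof (rule ccontr)
    assume "\<not> ?thesis"
    then have "enat (Suc n) \<le> proj_dim R M"
      unfolding proj_dim_def by (intro INF_greatest) (auto simp: not_le Suc_le_eq)
    from order_trans[OF this pd] show False by simp
  qed
  then obtain P dP eP where res: "projective_resolution R M P dP eP"
    and "\<forall>i>n. carrier (P i) = {\<zero>\<^bsub>P i\<^esub>}" by (auto intro: le_less_trans)
  then have van: "carrier (P k) = {\<zero>\<^bsub>P k\<^esub>}" if "n < k" for k using that by blast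
  from res have P: "resolution R M P dP eP"
    unfolding projective_resolution_def resolution_def by (elim conjE) (intro conjI)
  have proj: "projective_module R (P k)" for k
    using res unfolding projective_resolution_def by (elim conjE) (erule spec)
  have modP: "Module.module R (P k)" for k using proj by (simp add: projective_module_def)
  have "\<exists>j :: ('b \<Rightarrow> 'r) \<Rightarrow> (nat \<Rightarrow> 'r). inj_on j (carrier (?F k))" for k
    by (rule ex_embedding_free_mod[OF fin])
  then obtain j :: "nat \<Rightarrow> ('b \<Rightarrow> 'r) \<Rightarrow> (nat \<Rightarrow> 'r)" where j: "\<And>k. inj_on (j k) (carrier (?F k))"
    by metis
  have "\<exists>f. (\<forall>k. f k \<in> linear_maps R (?F k) (P k)) \<and> (\<forall>a\<in>carrier (?F 0). eP (f 0 a) = e a) \<and>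
    (\<forall>k. \<forall>a\<in>carrier (?F (Suc k)). dP k (f (Suc k) a) = f k (d k a))"
  proof (rule comparison_maps[OF modF modP F P])
    show "\<exists>l\<in>linear_maps R (?F 0) (P 0). \<forall>a\<in>carrier (?F 0). eP (l a) = e a"
      using resolution_surj[OF F] resolution_surj[OF P] by (intro free_mod_lift[OF R fin modP M resolution_e[OF P] e]) simp
    show "\<exists>l\<in>linear_maps R (?F (Suc k)) (P (Suc k)). \<forall>a\<in>carrier (?F (Suc k)). dP k (l a) = t a"
      if "t \<in> linear_maps R (?F (Suc k)) (P k)" "t ` carrier (?F (Suc k)) \<subseteq> dP k ` carrier (P (Suc k))"
      for k t
      using that by (intro free_mod_lift[OF R fin modP modP resolution_d[OF P]])
  qed
  then obtain f where f: "\<And>k. f k \<in> linear_maps R (?F k) (P k)"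
    "\<And>a. a \<in> carrier (?F 0) \<Longrightarrow> eP (f 0 a) = e a"
    "\<And>k a. a \<in> carrier (?F (Suc k)) \<Longrightarrow> dP k (f (Suc k) a) = f k (d k a)"
    by (elim exE conjE) (rule that; (erule spec bspec | erule allE, erule bspec))
  have "\<exists>g. (\<forall>k. g k \<in> linear_maps R (P k) (?F k)) \<and> (\<forall>a\<in>carrier (P 0). e (g 0 a) = eP a) \<and>
    (\<forall>k. \<forall>a\<in>carrier (P (Suc k)). d k (g (Suc k) a) = g k (dP k a))"
  proof (rule comparison_maps[OF modP modF P F])
    show "\<exists>l\<in>linear_maps R (P 0) (?F 0). \<forall>a\<in>carrier (P 0). e (l a) = eP a"
      using resolution_surj[OF F] resolution_surj[OF P] by (intro projective_module_lift[OF proj modF M j i e resolution_e[OF P]]) simp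
    show "\<exists>l\<in>linear_maps R (P (Suc k)) (?F (Suc k)). \<forall>a\<in>carrier (P (Suc k)). d k (l a) = t a"
      if "t \<in> linear_maps R (P (Suc k)) (?F k)" "t ` carrier (P (Suc k)) \<subseteq> d k ` carrier (?F (Suc k))"
      for k t
      using that by (intro projective_module_lift[OF proj modF modF j j d])
  qed
  then obtain g where g: "\<And>k. g k \<in> linear_maps R (P k) (?F k)"
    "\<And>a. a \<in> carrier (P 0) \<Longrightarrow> e (g 0 a) = eP a"
    "\<And>k a. a \<in> carrier (P (Suc k)) \<Longrightarrow> d k (g (Suc k) a) = g k (dP k a)"
    by (elim exE conjE) (rule that; (erule spec bspec | erule allE, erule bspec))
  let ?r = "\<lambda>k c. c \<ominus>\<^bsub>?F k\<^esub> g k (f k c)"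
  have gf: "(\<lambda>c. g k (f k c)) \<in> linear_maps R (?F k) (?F k)" for k
    by (rule linear_maps_comp[OF f(1) g(1)])
  have "\<exists>s. (\<forall>k. s k \<in> linear_maps R (?F k) (?F (Suc k))) \<and> (\<forall>k. \<forall>c\<in>carrier (?F (Suc k)).
      ?r (Suc k) c = d (Suc k) (s (Suc k) c) \<oplus>\<^bsub>?F (Suc k)\<^esub> s k (d k c))"
  proof (rule null_homotopy[OF modF modF F F])
    show "\<exists>l\<in>linear_maps R (?F k) (?F (Suc k)). \<forall>a\<in>carrier (?F k). d k (l a) = t a"
      if "t \<in> linear_maps R (?F k) (?F k)" "t ` carrier (?F k) \<subseteq> d k ` carrier (?F (Suc k))" for k t
      using that by (intro free_mod_lift[OF R fin modF modF d])
    show "?r k \<in> linear_maps R (?F k) (?F k)" for k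
      by (intro linear_maps_minus modF gf linear_maps_id)
    fix a assume a: "a \<in> carrier (?F 0)"
    interpret M: Module.module R M by fact
    have "e (?r 0 a) = e a \<ominus>\<^bsub>M\<^esub> e (g 0 (f 0 a))"
      by (rule linear_maps_a_minus[OF modF M e a linear_maps_closed[OF gf a]])
    also have "\<dots> = \<zero>\<^bsub>M\<^esub>"
      using linear_maps_closed[OF e a]
      by (simp add: g(2)[OF linear_maps_closed[OF f(1) a]] f(2)[OF a] a_minus_def M.M.r_neg)
    finally show "e (?r 0 a) = \<zero>\<^bsub>M\<^esub>" .
  next
    fix k a assume a: "a \<in> carrier (?F (Suc k))"
    have "d k (?r (Suc k) a) = d k a \<ominus>\<^bsub>?F k\<^esub> d k (g (Suc k) (f (Suc k) a))"
      by (rule linear_maps_a_minus[OF modF modF d a linear_maps_closed[OF gf a]])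
    then show "d k (?r (Suc k) a) = ?r k (d k a)"
      by (simp only: g(3)[OF linear_maps_closed[OF f(1) a]] f(3)[OF a])
  qed
  then obtain s where s: "\<And>k. s k \<in> linear_maps R (?F k) (?F (Suc k))"
    "\<And>k c. c \<in> carrier (?F (Suc k)) \<Longrightarrow>
      ?r (Suc k) c = d (Suc k) (s (Suc k) c) \<oplus>\<^bsub>?F (Suc k)\<^esub> s k (d k c)"
    by (elim exE conjE) (rule that; (erule spec bspec | erule allE, erule bspec))
  show ?thesis
  proof (rule that[of s])
    fix k c assume k: "n \<le> k" and c: "c \<in> carrier (?F (Suc k))"
    interpret Fk: Module.module R "?F (Suc k)" by (rule modF)
    have "f (Suc k) c = \<zero>\<^bsub>P (Suc k)\<^esub>" using linear_maps_closed[OF f(1) c] van[of "Suc k"] k by simp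
    then have "g (Suc k) (f (Suc k) c) = \<zero>\<^bsub>?F (Suc k)\<^esub>"
      by (simp only: linear_maps_zero[OF modP modF g(1)])
    then have "?r (Suc k) c = c \<ominus>\<^bsub>?F (Suc k)\<^esub> \<zero>\<^bsub>?F (Suc k)\<^esub>" by (simp only:)
    also have "\<dots> = c"
      by (rule Fk.minus_zero_right[OF c])
    finally have "?r (Suc k) c = c" .
    then show "c = d (Suc k) (s (Suc k) c) \<oplus>\<^bsub>?F (Suc k)\<^esub> s k (d k c)"
      using s(2)[OF c] by simp
  qed (rule s(1))
qed

text \<open>The image of an idempotent of a free module is a direct summand, so a map out of it
  extends to the whole free module by precomposing with \<open>p\<close>, lifts there, and restricts
  back.\<close>

lemma projective_module_retract:
  fixes i :: "('b \<Rightarrow> 'r) \<Rightarrow> 'm"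
  assumes R: "cring R" and J: "finite J" and i: "inj_on i (carrier (free_mod R J))"
    and p: "p \<in> linear_maps R (free_mod R J) (free_mod R J)"
    and pp: "\<And>c. c \<in> carrier (free_mod R J) \<Longrightarrow> p (p c) = p c"
  shows "projective_module R (transport i ((free_mod R J)\<lparr>carrier := p ` carrier (free_mod R J)\<rparr>))"
proof -
  let ?F = "free_mod R J"
  let ?P = "?F\<lparr>carrier := p ` carrier ?F\<rparr>"
  have modF: "Module.module R ?F" by (rule module_free_mod[OF R])
  have modP: "Module.module R ?P" by (rule module_image[OF modF modF p])
  have sub: "carrier ?P \<subseteq> carrier ?F" using linear_maps_closed[OF p] by (auto simp del: free_mod_simps)
  have iP: "inj_on i (carrier ?P)" by (rule inj_on_subset[OF i sub])
  have pF: "p \<in> linear_maps R ?F ?P" using p by (auto simp: linear_maps_def simp del: free_mod_simps)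
  have iF: "i \<in> linear_maps R ?P (transport i ?P)" and qP: "inv_into (carrier ?P) i \<in> linear_maps R (transport i ?P) ?P"
    by (rule linear_maps_transport[OF iP modP])+
  have incl: "(\<lambda>a. a) \<in> linear_maps R ?P ?F"
    using sub by (intro linear_mapsI) (auto simp del: free_mod_simps)
  have "\<exists>l\<in>linear_maps R (transport i ?P) M. \<forall>a\<in>carrier (transport i ?P). s (l a) = t a"
    if MN: "Module.module R M" "Module.module R N" and s: "s \<in> linear_maps R M N" "s ` carrier M = carrier N"
      and t: "t \<in> linear_maps R (transport i ?P) N" for M N :: "('r, 'm) module" and s t
  proof -
    let ?h = "\<lambda>c. t (i (p c))"
    have h: "?h \<in> linear_maps R ?F N"
      by (rule linear_maps_comp[OF linear_maps_comp[OF pF iF] t])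
    have "?h ` carrier ?F \<subseteq> s ` carrier M" unfolding s(2) using linear_maps_closed[OF h] by blast
    from free_mod_lift[OF R J MN s(1) h this] obtain l
      where l: "l \<in> linear_maps R ?F M" "\<And>c. c \<in> carrier ?F \<Longrightarrow> s (l c) = ?h c" by blast
    show ?thesis
    proof (intro bexI ballI)
      show "(\<lambda>a. l (inv_into (carrier ?P) i a)) \<in> linear_maps R (transport i ?P) M"
        by (rule linear_maps_comp[OF linear_maps_comp[OF qP incl] l(1)])
      fix a assume "a \<in> carrier (transport i ?P)"
      then obtain c where c: "c \<in> carrier ?F" "a = i (p c)" by (auto simp del: free_mod_simps)
      have pc: "p c \<in> carrier ?P" using c(1) by (simp del: free_mod_simps)
      then have "inv_into (carrier ?P) i a = p c" unfolding c(2) by (rule inv_into_f_f[OF iP])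
      then show "s (l (inv_into (carrier ?P) i a)) = t a"
        using l(2)[OF subsetD[OF sub pc]] by (simp only: pp[OF c(1)] c(2))
    qed
  qed
  then show ?thesis unfolding projective_module_def using module_transport[OF modP iP] by blast
qed

text \<open>The hypotheses make \<open>q\<close> a projection of the term in degree \<open>n\<close>
  onto the image of \<open>d n\<close>. That term is thus the direct sum of the boundaries and of
  the kernel of \<open>q\<close>; replacing it by this kernel, which is projective, and everything
  above by zero leaves a resolution of length at most \<open>n\<close>.\<close>

theorem proj_dim_le_of_retraction:
  fixes R :: "('r, 's) ring_scheme" and M :: "('r, 'm) module" and J :: "nat \<Rightarrow> 'b set"
  assumes R: "cring R" and M: "Module.module R M"
    and fin: "\<And>k. finite (J k)" and F: "resolution R M (\<lambda>k. free_mod R (J k)) d e"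
    and q: "q \<in> linear_maps R (free_mod R (J n)) (free_mod R (J n))"
    and qd: "q ` carrier (free_mod R (J n)) \<subseteq> d n ` carrier (free_mod R (J (Suc n)))"
    and qid: "\<And>c. c \<in> carrier (free_mod R (J (Suc n))) \<Longrightarrow> q (d n c) = d n c"
  shows "proj_dim R M \<le> enat n"
proof -
  let ?F = "\<lambda>k. free_mod R (J k)"
  have modF: "Module.module R (?F k)" for k by (rule module_free_mod[OF R])
  have d: "d k \<in> linear_maps R (?F (Suc k)) (?F k)" for k by (rule resolution_d[OF F])
  have e: "e \<in> linear_maps R (?F 0) M" by (rule resolution_e[OF F])
  note ex0 = resolution_exact_0[OF F] and exS = resolution_exact[OF F]
  \<comment> \<open>Idempotents that cut out the truncated resolution: the identity below
    \<open>n\<close>, the projection onto the kernel of \<open>q\<close> in degree \<open>n\<close>,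
    zero above.\<close>
  define p where "p k = (if k < n then (\<lambda>c. c) else if k = n then (\<lambda>c. c \<ominus>\<^bsub>?F n\<^esub> q c) else (\<lambda>c. \<zero>\<^bsub>?F k\<^esub>))" for k
  have pn: "p n = (\<lambda>c. c \<ominus>\<^bsub>?F n\<^esub> q c)" by (simp add: p_def)
  have plin: "p k \<in> linear_maps R (?F k) (?F k)" for k
  proof -
    interpret Fk: Module.module R "?F k" by (rule modF)
    have "(\<lambda>c. \<zero>\<^bsub>?F k\<^esub>) \<in> linear_maps R (?F k) (?F k)"
      by (intro linear_mapsI) (simp_all del: free_mod_simps)
    then show ?thesis
      using linear_maps_minus[OF modF linear_maps_id q] by (auto simp: p_def linear_maps_id simp del: free_mod_simps)
  qed
  note pc = linear_maps_closed[OF plin]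
  have qc: "q c \<in> carrier (?F n)" if "c \<in> carrier (?F n)" for c
    using linear_maps_closed[OF q that] .
  have qq: "q (q c) = q c" if c: "c \<in> carrier (?F n)" for c
  proof -
    obtain b where "b \<in> carrier (?F (Suc n))" "q c = d n b"
      using subsetD[OF qd imageI[OF c]] by blast
    then show ?thesis using qid by simp
  qed
  have qp: "q (p n c) = \<zero>\<^bsub>?F n\<^esub>" if c: "c \<in> carrier (?F n)" for c
  proof -
    interpret Fn: Module.module R "?F n" by (rule modF)
    have "q (p n c) = q c \<ominus>\<^bsub>?F n\<^esub> q c"
      unfolding pn using linear_maps_a_minus[OF modF modF q c qc[OF c]] by (simp only: qq[OF c])
    also have "\<dots> = \<zero>\<^bsub>?F n\<^esub>" by (simp only: a_minus_def Fn.M.r_neg[OF qc[OF c]])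
    finally show ?thesis .
  qed
  have p_fix: "p n c = c" if c: "c \<in> carrier (?F n)" and "q c = \<zero>\<^bsub>?F n\<^esub>" for c
  proof -
    interpret Fn: Module.module R "?F n" by (rule modF)
    show ?thesis unfolding pn that(2) by (rule Fn.minus_zero_right[OF c])
  qed
  have pp: "p k (p k c) = p k c" if c: "c \<in> carrier (?F k)" for k c
  proof (cases "k = n")
    case True
    then show ?thesis using p_fix[OF pc] qp c by blast
  qed (simp add: p_def)
  define Q where "Q k = ?F k\<lparr>carrier := p k ` carrier (?F k)\<rparr>" for k
  have ops: "zero (Q k) = zero (?F k)" "add (Q k) = add (?F k)" "smult (Q k) = smult (?F k)"
    and Qc: "carrier (Q k) = p k ` carrier (?F k)" for k
    by (simp_all add: Q_def del: free_mod_simps)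
  have modQ: "Module.module R (Q k)" for k
    unfolding Q_def by (rule module_image[OF modF modF plin])
  have Qlt: "carrier (Q k) = carrier (?F k)" if "k < n" for k using that by (simp add: Qc p_def)
  have Qgt: "carrier (Q k) = {\<zero>\<^bsub>?F k\<^esub>}" if "n < k" for k
  proof -
    interpret Fk: Module.module R "?F k" by (rule modF)
    have pk: "p k = (\<lambda>c. \<zero>\<^bsub>?F k\<^esub>)" using that by (simp add: p_def)
    show ?thesis unfolding Qc pk using Fk.M.zero_closed by blast
  qed
  have Qn: "carrier (Q n) = {c \<in> carrier (?F n). q c = \<zero>\<^bsub>?F n\<^esub>}"
  proof (intro equalityI subsetI)
    fix c assume "c \<in> {c \<in> carrier (?F n). q c = \<zero>\<^bsub>?F n\<^esub>}"
    then have "c \<in> carrier (?F n)" "p n c = c" using p_fix by blast+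
    then show "c \<in> carrier (Q n)" unfolding Qc by (metis imageI)
  qed (use pc qp in \<open>auto simp: Qc simp del: free_mod_simps\<close>)
  have sub: "carrier (Q k) \<subseteq> carrier (?F k)" for k unfolding Qc using pc by blast
  have Qn_zero: "c = \<zero>\<^bsub>?F n\<^esub>" if "c \<in> carrier (Q n)" "c \<in> d n ` carrier (?F (Suc n))" for c
    using that qid unfolding Qn by force
  have dQ: "d k \<in> linear_maps R (Q (Suc k)) (Q k)" for k
  proof -
    have "d k c \<in> carrier (Q k)" if c: "c \<in> carrier (Q (Suc k))" for c
    proof (cases "k < n")
      case True
      then show ?thesis using linear_maps_closed[OF d subsetD[OF sub c]] by (simp only: Qlt)
    next
      case False
      interpret Qk: Module.module R "Q k" by (rule modQ)
      have "c = \<zero>\<^bsub>?F (Suc k)\<^esub>" using False c Qgt[of "Suc k"] by simp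
      then have "d k c = \<zero>\<^bsub>Q k\<^esub>" by (simp only: linear_maps_zero[OF modF modF d] ops)
      then show ?thesis by (simp only: Qk.M.zero_closed)
    qed
    then show ?thesis
      using linear_maps_add[OF d subsetD[OF sub] subsetD[OF sub]]
        linear_maps_smult[OF d _ subsetD[OF sub]]
      by (intro linear_mapsI) (simp_all only: ops)
  qed
  have eQ: "e \<in> linear_maps R (Q 0) M"
    using linear_maps_closed[OF e subsetD[OF sub]] linear_maps_add[OF e subsetD[OF sub] subsetD[OF sub]]
      linear_maps_smult[OF e _ subsetD[OF sub]]
    by (intro linear_mapsI) (simp_all only: ops)
  have qim: "\<exists>b\<in>carrier (?F (Suc n)). q c = d n b" if "c \<in> carrier (?F n)" for c
    using qd that by blast
  have pQ: "p n c \<in> carrier (Q n)" if "c \<in> carrier (?F n)" for c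
    unfolding Qc using that by blast
  have esurjQ: "e ` carrier (Q 0) = carrier M"
  proof (cases "n = 0")
    case True
    have "e c \<in> e ` carrier (Q 0)" if c: "c \<in> carrier (?F 0)" for c
    proof (rule image_eqI)
      show "p 0 c \<in> carrier (Q 0)" using pQ c True by blast
      obtain b where b: "b \<in> carrier (?F (Suc n))" "q c = d n b" using qim c True by blast
      have eq: "e (q c) = \<zero>\<^bsub>M\<^esub>" unfolding b(2) using resolution_ed[OF F, of b] b(1) True by simp
      have "e (p n c) = e c"
        unfolding pn using c qc[of c] e eq True by (intro linear_maps_minus_kernel[OF modF M]) (simp_all only:)
      then show "e c = e (p 0 c)" using True by (simp only:)
    qed
    then have "e ` carrier (?F 0) \<subseteq> e ` carrier (Q 0)" by (rule image_subsetI)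
    then show ?thesis unfolding resolution_surj[OF F, symmetric] using image_mono[OF sub] by (rule subset_antisym[rotated])
  qed (use resolution_surj[OF F] Qlt in simp)
  \<comment> \<open>One formula for all degrees. If \<open>Suc k = n\<close>, passing from
    \<open>c\<close> to \<open>c - q c\<close> changes \<open>c\<close> by a boundary, which
    \<open>d k\<close> kills. If \<open>k \<ge> n\<close>, both sides are zero, since the kernel of
    \<open>q\<close> contains no nonzero boundary.\<close>
  have exact: "d k ` carrier (Q (Suc k)) = carrier (Q k) \<inter> d k ` carrier (?F (Suc k))" for k
  proof (cases "k < n")
    case lt: True
    show ?thesis
    proof (cases "Suc k = n")
      case True
      have "d k c \<in> d k ` carrier (Q (Suc k))" if c: "c \<in> carrier (?F (Suc k))" for c
      proof (rule image_eqI)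
        show "p n c \<in> carrier (Q (Suc k))" using pQ c True by blast
        obtain b where b: "b \<in> carrier (?F (Suc n))" "q c = d n b" using qim c True by blast
        have eq: "d k (q c) = \<zero>\<^bsub>?F k\<^esub>"
          unfolding b(2) using resolution_dd[OF F, of b k] b(1) True by (simp del: free_mod_simps)
        have "d k (p n c) = d k c"
          unfolding pn using c qc[of c] d[of k] eq True
          by (intro linear_maps_minus_kernel[OF modF modF]) (simp_all only:)
        then show "d k c = d k (p n c)" by (rule sym)
      qed
      then have "d k ` carrier (?F (Suc k)) \<subseteq> d k ` carrier (Q (Suc k))" by (rule image_subsetI)
      then have "d k ` carrier (Q (Suc k)) = d k ` carrier (?F (Suc k))"
        using image_mono[OF sub] by (rule subset_antisym[rotated])
      moreover have "d k ` carrier (?F (Suc k)) \<subseteq> carrier (?F k)"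
        by (rule image_subsetI) (rule linear_maps_closed[OF d])
      ultimately show ?thesis unfolding Qlt[OF lt] by (simp only: Int_absorb1)
    next
      case False
      have "d k ` carrier (?F (Suc k)) \<subseteq> carrier (?F k)"
        by (rule image_subsetI) (rule linear_maps_closed[OF d])
      moreover have "Suc k < n" using False lt by simp
      ultimately show ?thesis unfolding Qlt[OF lt] by (simp only: Int_absorb1 Qlt)
    qed
  next
    case False
    then have "carrier (Q k) \<inter> d k ` carrier (?F (Suc k)) \<subseteq> {\<zero>\<^bsub>?F k\<^esub>}"
      using Qn_zero Qgt[of k] by (cases "k = n") (auto simp del: free_mod_simps)
    moreover have "d k ` carrier (Q (Suc k)) = {\<zero>\<^bsub>?F k\<^esub>}"
      using Qgt[of "Suc k"] False linear_maps_zero[OF modF modF d] by (simp del: free_mod_simps)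
    moreover have "d k ` carrier (Q (Suc k)) \<subseteq> carrier (Q k) \<inter> d k ` carrier (?F (Suc k))"
      using linear_maps_closed[OF dQ] sub[of "Suc k"] by blast
    ultimately show ?thesis by blast
  qed
  have "\<exists>j :: ('b \<Rightarrow> 'r) \<Rightarrow> (nat \<Rightarrow> 'r). inj_on j (carrier (?F k))" for k
    by (rule ex_embedding_free_mod[OF fin])
  then obtain j :: "nat \<Rightarrow> ('b \<Rightarrow> 'r) \<Rightarrow> (nat \<Rightarrow> 'r)" where j: "\<And>k. inj_on (j k) (carrier (?F k))"
    by metis
  have jQ: "inj_on (j k) (carrier (Q k))" for k by (rule inj_on_subset[OF j sub])
  let ?P = "\<lambda>k. transport (j k) (Q k)" and ?i = "\<lambda>k. inv_into (carrier (Q k)) (j k)"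
  note tr = linear_maps_transport[OF jQ modQ]
  have inv: "?i k (j k c) = c" if "c \<in> carrier (Q k)" for k c
    using inv_into_f_f[OF jQ that] .
  have "projective_resolution R M ?P (\<lambda>k a. j k (d k (?i (Suc k) a))) (\<lambda>a. e (?i 0 a))"
    unfolding projective_resolution_def One_nat_def
  proof (intro conjI allI)
    show "projective_module R (?P k)" for k
      unfolding Q_def by (rule projective_module_retract[OF R fin j plin pp])
    show "(\<lambda>a. j k (d k (?i (Suc k) a))) \<in> linear_maps R (?P (Suc k)) (?P k)" for k
      by (rule linear_maps_comp[OF linear_maps_comp[OF tr(2) dQ] tr(1)])
    show "(\<lambda>a. e (?i 0 a)) \<in> linear_maps R (?P 0) M"
      by (rule linear_maps_comp[OF tr(2) eQ])
    show "(\<lambda>a. e (?i 0 a)) ` carrier (?P 0) = carrier M"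
      unfolding transport_simps image_image by (simp add: inv esurjQ cong: image_cong)
    have im: "(\<lambda>a. j k (d k (?i (Suc k) a))) ` carrier (?P (Suc k)) =
      j k ` (carrier (Q k) \<inter> d k ` carrier (?F (Suc k)))" for k
      unfolding transport_simps image_image exact[symmetric] by (simp add: inv cong: image_cong)
    show "(\<lambda>a. j 0 (d 0 (?i (Suc 0) a))) ` carrier (?P (Suc 0)) =
      {a \<in> carrier (?P 0). e (?i 0 a) = \<zero>\<^bsub>M\<^esub>}"
      unfolding im ex0 using sub[of 0] by (auto simp: inv simp del: free_mod_simps)
    show "(\<lambda>a. j (Suc k) (d (Suc k) (?i (Suc (Suc k)) a))) ` carrier (?P (Suc (Suc k))) =
      {a \<in> carrier (?P (Suc k)). j k (d k (?i (Suc k) a)) = \<zero>\<^bsub>?P k\<^esub>}" for k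
    proof -
      have "j k (d k c) = j k \<zero>\<^bsub>Q k\<^esub> \<longleftrightarrow> d k c = \<zero>\<^bsub>?F k\<^esub>" if "c \<in> carrier (Q (Suc k))" for c
      proof -
        interpret Qk: Module.module R "Q k" by (rule modQ)
        show ?thesis
          using inj_on_eq_iff[OF jQ linear_maps_closed[OF dQ that] Qk.M.zero_closed] by (simp only: ops)
      qed
      then show ?thesis
        unfolding im exS using sub[of "Suc k"] by (auto simp: inv ops simp del: free_mod_simps)
    qed
  qed
  moreover have "carrier (?P k) = {\<zero>\<^bsub>?P k\<^esub>}" if "n < k" for k
    using Qgt[OF that] by (simp add: ops del: free_mod_simps)
  ultimately show ?thesis
    unfolding proj_dim_def by (intro INF_lower) blast
qed

section \<open>The Koszul-type complex of a simplicial complex\<close>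

text \<open>The usual incidence sign for inserting \<open>v\<close> into \<open>F\<close>, with the
  vertices ordered by their rank \<open>r\<close>.\<close>

definition vsign :: "('v \<Rightarrow> nat) \<Rightarrow> 'v \<Rightarrow> 'v set \<Rightarrow> 'r::comm_ring_1" where
  "vsign r v F = (- 1) ^ card {w \<in> F. r w < r v}"

lemma vsign_empty [simp]: "vsign r v {} = 1"
  by (simp add: vsign_def)

lemma vsign_cases: "vsign r v F = 1 \<or> vsign r v F = - 1"
  by (simp add: vsign_def minus_one_power_iff)

lemma vsign_square [simp]: "vsign r v F * vsign r v F = 1"
  by (simp add: vsign_def minus_one_power_iff)

lemma vsign_square_left [simp]: "vsign r v F * (vsign r v F * a) = a"
  by (simp flip: mult.assoc)

lemma vsign_nonzero [simp]: "vsign r v F \<noteq> 0"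
  using vsign_square[of r v F] by (metis mult_zero_left zero_neq_one)

lemma vsign_insert:
  assumes "finite F" "w \<notin> F"
  shows "vsign r v (insert w F) = (if r w < r v then - vsign r v F else vsign r v F)"
proof -
  have "{u \<in> insert w F. r u < r v} =
    (if r w < r v then insert w {u \<in> F. r u < r v} else {u \<in> F. r u < r v})" by auto
  with assms show ?thesis by (simp add: vsign_def)
qed

lemma vsign_union:
  assumes "finite F" "finite G" "F \<inter> G = {}"
  shows "vsign r v (F \<union> G) = vsign r v F * vsign r v G"
proof -
  have "{u \<in> F \<union> G. r u < r v} = {u \<in> F. r u < r v} \<union> {u \<in> G. r u < r v}" by auto
  with assms show ?thesis
    by (simp add: vsign_def card_Un_disjoint disjoint_iff flip: power_add)
qed

lemma vsign_anticommute:
  assumes "finite F" "v \<notin> F" "w \<notin> F" "r v \<noteq> r w"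
  shows "vsign r v (insert w F) * vsign r w F = - (vsign r w (insert v F) * vsign r v F)"
  using assms by (simp add: vsign_insert)

lemma vsign_anticommute':
  assumes "finite F" "v \<notin> F" "w \<notin> F" "r v \<noteq> r w"
  shows "vsign r v (insert w F) * vsign r w (insert v F) = - (vsign r v F * vsign r w F)"
  using assms by (simp add: vsign_insert)

text \<open>The terms of each unordered pair cancel. The ranks select one ordered pair from each,
  because an argument by halving the sum would fail in characteristic 2.\<close>

lemma sum_antisymmetric:
  fixes f :: "'v \<Rightarrow> 'v \<Rightarrow> 'r::comm_ring_1"
  assumes "finite A" "inj_on (r :: 'v \<Rightarrow> nat) A"
    and anti: "\<And>v w. v \<in> A \<Longrightarrow> w \<in> A \<Longrightarrow> v \<noteq> w \<Longrightarrow> f v w = - f w v"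
  shows "(\<Sum>v\<in>A. \<Sum>w\<in>A - {v}. f v w) = 0"
proof -
  let ?L = "\<lambda>v w. if r w < r v then f v w else 0"
  have "(\<Sum>w\<in>A - {v}. f v w) = (\<Sum>w\<in>A. ?L v w) - (\<Sum>w\<in>A. ?L w v)" if v: "v \<in> A" for v
  proof -
    have "f v w = ?L v w - ?L w v" if "w \<in> A - {v}" for w
      using that v anti[of w v] inj_onD[OF assms(2), of v w] by (auto simp: not_less le_less)
    then have "(\<Sum>w\<in>A - {v}. f v w) = (\<Sum>w\<in>A - {v}. ?L v w - ?L w v)" by (rule sum.cong[OF refl])
    also have "\<dots> = (\<Sum>w\<in>A. ?L v w - ?L w v)"
      using assms(1) by (intro sum.mono_neutral_left) auto
    finally show ?thesis by (simp only: sum_subtractf)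
  qed
  then have "(\<Sum>v\<in>A. \<Sum>w\<in>A - {v}. f v w) = (\<Sum>v\<in>A. (\<Sum>w\<in>A. ?L v w) - (\<Sum>w\<in>A. ?L w v))"
    by (rule sum.cong[OF refl])
  also have "\<dots> = (\<Sum>v\<in>A. \<Sum>w\<in>A. ?L v w) - (\<Sum>v\<in>A. \<Sum>w\<in>A. ?L w v)"
    by (rule sum_subtractf)
  also have "(\<Sum>v\<in>A. \<Sum>w\<in>A. ?L w v) = (\<Sum>v\<in>A. \<Sum>w\<in>A. ?L v w)" by (rule sum.swap)
  finally show ?thesis by simp
qed

definition cells :: "'v set \<Rightarrow> 'v set set \<Rightarrow> nat \<Rightarrow> ('v set \<times> 'v set) set" where
  "cells V \<Delta> i = {(F, G). F \<subseteq> V \<and> G \<subseteq> V \<and> F \<inter> G = {} \<and> G \<in> \<Delta> \<and> card F = i}"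

text \<open>The squarefree part of the Koszul complex of the elements
  \<open>x_v \<otimes> 1 - 1 \<otimes> x_v\<close> on \<open>S \<otimes> S/I\<close>: a vertex
  leaving \<open>F\<close> multiplies the coefficient or, with a minus sign, the monomial
  \<open>G\<close>. It is written in coordinates, so the value at \<open>(F, G)\<close> collects the
  cells that map to it. The scalars \<open>e\<close> are a parameter: \<open>mvar\<close> gives the
  resolution, 1 a single multidegree, and 0 the reduction modulo the variables.\<close>

definition koszul ::
  "'v set \<Rightarrow> ('v \<Rightarrow> nat) \<Rightarrow> 'v set set \<Rightarrow> ('v \<Rightarrow> 'r::comm_ring_1) \<Rightarrow>
     ('v set \<times> 'v set \<Rightarrow> 'r) \<Rightarrow> 'v set \<times> 'v set \<Rightarrow> 'r" where
  "koszul V r \<Delta> e c = (\<lambda>(F, G). if F \<subseteq> V \<and> G \<subseteq> V \<and> F \<inter> G = {} \<and> G \<in> \<Delta>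
     then (\<Sum>v\<in>V - F. vsign r v F *
       (if v \<in> G then - c (insert v F, G - {v}) else e v * c (insert v F, G))) else 0)"

lemma finite_cells: "finite V \<Longrightarrow> finite (cells V \<Delta> i)"
  by (rule finite_subset[of _ "Pow V \<times> Pow V"]) (auto simp: cells_def)

lemma koszul_cells:
  "(F, G) \<in> cells V \<Delta> i \<Longrightarrow> koszul V r \<Delta> e c (F, G) = (\<Sum>v\<in>V - F. vsign r v F *
       (if v \<in> G then - c (insert v F, G - {v}) else e v * c (insert v F, G)))"
  by (simp add: koszul_def cells_def)

lemma koszul_zero [simp]: "koszul V r \<Delta> e (\<lambda>p. 0) = (\<lambda>p. 0)"
  by (auto simp: koszul_def fun_eq_iff intro!: sum.neutral)

lemma koszul_add: "koszul V r \<Delta> e (\<lambda>p. a p + b p) = (\<lambda>p. koszul V r \<Delta> e a p + koszul V r \<Delta> e b p)"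
  by (auto simp: koszul_def fun_eq_iff algebra_simps simp flip: sum.distrib intro!: sum.cong)

lemma koszul_scale: "koszul V r \<Delta> e (\<lambda>p. x * a p) = (\<lambda>p. x * koszul V r \<Delta> e a p)"
  by (auto simp: koszul_def fun_eq_iff algebra_simps sum_distrib_left intro!: sum.cong)

lemma koszul_diff: "koszul V r \<Delta> e (\<lambda>p. a p - b p) = (\<lambda>p. koszul V r \<Delta> e a p - koszul V r \<Delta> e b p)"
  using koszul_add[of V r \<Delta> e a "\<lambda>p. - 1 * b p"] koszul_scale[of V r \<Delta> e "- 1" b] by simp

lemma koszul_sum: "koszul V r \<Delta> e (\<lambda>p. \<Sum>t\<in>T. a t p) = (\<lambda>p. \<Sum>t\<in>T. koszul V r \<Delta> e (a t) p)"
  by (induction T rule: infinite_finite_induct) (simp_all add: koszul_add)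

lemma koszul_supp:
  assumes V: "finite V" and c: "\<And>p. p \<notin> cells V \<Delta> (Suc i) \<Longrightarrow> c p = 0" and p: "p \<notin> cells V \<Delta> i"
  shows "koszul V r \<Delta> e c p = 0"
proof (cases p)
  case (Pair F G)
  show ?thesis
  proof (cases "F \<subseteq> V \<and> G \<subseteq> V \<and> F \<inter> G = {} \<and> G \<in> \<Delta>")
    case True
    then have "finite F" "card F \<noteq> i" using p V by (auto simp: Pair cells_def intro: finite_subset)
    then have "c (insert v F, G') = 0" if "v \<in> V - F" for v G'
      using that by (intro c) (auto simp: cells_def)
    then show ?thesis by (auto simp: Pair koszul_def intro!: sum.neutral)
  qed (simp only: Pair koszul_def split if_False)
qed

locale ranked_complex =
  fixes V :: "'v set" and r :: "'v \<Rightarrow> nat" and \<Delta> :: "'v set set"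
  assumes finite_V: "finite V" and inj_r: "inj_on r V"
    and down: "G \<in> \<Delta> \<Longrightarrow> G' \<subseteq> G \<Longrightarrow> G' \<in> \<Delta>"
begin

text \<open>The effects of removing \<open>v\<close> and \<open>w\<close> from \<open>F\<close>
  commute, which is the symmetry of \<open>X\<close> in the proof, while the signs
  anticommute.\<close>

lemma koszul_koszul: "koszul V r \<Delta> e (koszul V r \<Delta> e c) = (\<lambda>p. 0)"
proof (intro ext)
  fix p :: "'v set \<times> 'v set"
  obtain F G where p: "p = (F, G)" by (cases p)
  show "koszul V r \<Delta> e (koszul V r \<Delta> e c) p = 0"
  proof (cases "F \<subseteq> V \<and> G \<subseteq> V \<and> F \<inter> G = {} \<and> G \<in> \<Delta>")
    case True
    then have fin: "finite F" using finite_V by (auto intro: finite_subset)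
    define X where "X v w =
      (if v \<in> G then - (if w \<in> G then - c (insert w (insert v F), G - {v} - {w})
                         else e w * c (insert w (insert v F), G - {v}))
       else e v * (if w \<in> G then - c (insert w (insert v F), G - {w})
                   else e w * c (insert w (insert v F), G)))" for v w
    have X: "X v w = X w v" if "v \<noteq> w" for v w
      using that by (auto simp: X_def insert_commute Diff_insert[symmetric] mult.left_commute)
    have inner: "(if v \<in> G then - koszul V r \<Delta> e c (insert v F, G - {v})
        else e v * koszul V r \<Delta> e c (insert v F, G)) =
      (\<Sum>w\<in>V - F - {v}. vsign r w (insert v F) * X v w)" if v: "v \<in> V - F" for v
    proof (cases "v \<in> G")
      case vG: True
      have "G - {v} \<in> \<Delta>" using True down by blast
      then have "koszul V r \<Delta> e c (insert v F, G - {v}) = (\<Sum>w\<in>V - insert v F. vsign r w (insert v F) *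
        (if w \<in> G - {v} then - c (insert w (insert v F), G - {v} - {w})
         else e w * c (insert w (insert v F), G - {v})))"
        using True v by (auto simp: koszul_def)
      also have "\<dots> = (\<Sum>w\<in>V - F - {v}. - (vsign r w (insert v F) * X v w))"
        using vG by (intro sum.cong) (auto simp: X_def)
      finally show ?thesis using vG by (simp add: sum_negf)
    next
      case vG: False
      have "koszul V r \<Delta> e c (insert v F, G) = (\<Sum>w\<in>V - insert v F. vsign r w (insert v F) *
        (if w \<in> G then - c (insert w (insert v F), G - {w})
         else e w * c (insert w (insert v F), G)))"
        using True v vG by (auto simp: koszul_def)
      then show ?thesis
        using vG by (auto simp: X_def sum_distrib_left algebra_simps intro!: sum.cong)
    qed
    have "koszul V r \<Delta> e (koszul V r \<Delta> e c) p =
      (\<Sum>v\<in>V - F. vsign r v F * (\<Sum>w\<in>V - F - {v}. vsign r w (insert v F) * X v w))"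
      unfolding p using True inner by (subst koszul_def) (auto intro!: sum.cong)
    also have "\<dots> = (\<Sum>v\<in>V - F. \<Sum>w\<in>V - F - {v}. vsign r w (insert v F) * vsign r v F * X v w)"
      by (simp add: sum_distrib_left algebra_simps)
    also have "\<dots> = 0"
    proof (rule sum_antisymmetric[where r = r])
      fix v w assume vw: "v \<in> V - F" "w \<in> V - F" "v \<noteq> w"
      then have "r v \<noteq> r w" using inj_r by (auto dest: inj_onD)
      then have "vsign r w (insert v F) * vsign r v F = (- (vsign r v (insert w F) * vsign r w F) :: 'a)"
        using vw fin by (intro vsign_anticommute) auto
      then show "vsign r w (insert v F) * vsign r v F * X v w = - (vsign r v (insert w F) * vsign r w F * X w v)"
        using X[of v w] vw by simp
    qed (use finite_V inj_r in \<open>auto intro: inj_on_subset\<close>)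
    finally show ?thesis .
  qed (simp only: p koszul_def split if_False)
qed

text \<open>The coefficient \<open>c ({v}, G)\<close> occurs at the face \<open>G\<close> and, with
  opposite sign, at \<open>insert v G\<close> when this is a face; only the non-faces survive. With
  \<open>X = 1\<close> on a full simplex nothing remains, and with monomials for \<open>X\<close>
  the rest lies in the Stanley-Reisner ideal.\<close>

lemma augmentation_koszul:
  fixes X :: "'v set \<Rightarrow> 'r::comm_ring_1"
  assumes X: "\<And>v G. v \<in> V \<Longrightarrow> G \<subseteq> V \<Longrightarrow> v \<notin> G \<Longrightarrow> X (insert v G) = X G * e v"
  shows "(\<Sum>G\<in>\<Delta> \<inter> Pow V. X G * koszul V r \<Delta> e c ({}, G)) =
    (\<Sum>v\<in>V. \<Sum>G | G \<in> \<Delta> \<inter> Pow V \<and> v \<notin> G \<and> insert v G \<notin> \<Delta>. X (insert v G) * c ({v}, G))"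
proof -
  let ?D = "\<Delta> \<inter> Pow V"
  have fin: "finite {G \<in> ?D. P G}" for P using finite_V by (auto intro: finite_subset[of _ "Pow V"])
  have finD: "finite ?D" using finite_V by blast
  have "(\<Sum>G\<in>?D. X G * koszul V r \<Delta> e c ({}, G)) =
    (\<Sum>G\<in>?D. \<Sum>v\<in>V. X G * (if v \<in> G then - c ({v}, G - {v}) else e v * c ({v}, G)))"
    by (intro sum.cong) (auto simp: koszul_def sum_distrib_left)
  also have "\<dots> = (\<Sum>v\<in>V. \<Sum>G\<in>?D. X G * (if v \<in> G then - c ({v}, G - {v}) else e v * c ({v}, G)))"
    by (rule sum.swap)
  also have "\<dots> = (\<Sum>v\<in>V. \<Sum>G | G \<in> ?D \<and> v \<notin> G \<and> insert v G \<notin> \<Delta>. X (insert v G) * c ({v}, G))"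
  proof (rule sum.cong[OF refl])
    fix v assume v: "v \<in> V"
    let ?f = "\<lambda>G. X (insert v G) * c ({v}, G)"
    have "(\<Sum>G\<in>?D. X G * (if v \<in> G then - c ({v}, G - {v}) else e v * c ({v}, G))) =
      (\<Sum>G\<in>?D. (if v \<notin> G then ?f G else 0) - (if v \<in> G then ?f (G - {v}) else 0))"
      using v X by (intro sum.cong) (auto simp: insert_absorb mult.assoc)
    also have "\<dots> = (\<Sum>G | G \<in> ?D \<and> v \<notin> G. ?f G) - (\<Sum>G | G \<in> ?D \<and> v \<in> G. ?f (G - {v}))"
      by (simp only: sum_subtractf sum.inter_filter[OF finD])
    also have "(\<Sum>G | G \<in> ?D \<and> v \<in> G. ?f (G - {v})) = (\<Sum>G | G \<in> ?D \<and> v \<notin> G \<and> insert v G \<in> \<Delta>. ?f G)"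
    proof (rule sum.reindex_bij_witness[of _ "insert v" "\<lambda>G. G - {v}"])
      show "insert v G \<in> {G \<in> ?D. v \<in> G}" if "G \<in> {G \<in> ?D. v \<notin> G \<and> insert v G \<in> \<Delta>}" for G
        using that v by auto
      show "G - {v} \<in> {G \<in> ?D. v \<notin> G \<and> insert v G \<in> \<Delta>}" if "G \<in> {G \<in> ?D. v \<in> G}" for G
        using that down[of G "G - {v}"] by (auto simp: insert_absorb)
    qed auto
    also have "(\<Sum>G | G \<in> ?D \<and> v \<notin> G. ?f G) =
      (\<Sum>G | G \<in> ?D \<and> v \<notin> G \<and> insert v G \<in> \<Delta>. ?f G) + (\<Sum>G | G \<in> ?D \<and> v \<notin> G \<and> insert v G \<notin> \<Delta>. ?f G)"
      by (subst sum.union_disjoint[symmetric]) (auto intro!: sum.cong rev_finite_subset[of "Pow V"] simp: finite_V)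
    finally show "(\<Sum>G\<in>?D. X G * (if v \<in> G then - c ({v}, G - {v}) else e v * c ({v}, G))) =
      (\<Sum>G | G \<in> ?D \<and> v \<notin> G \<and> insert v G \<notin> \<Delta>. ?f G)" by simp
  qed
  finally show ?thesis .
qed

text \<open>
  On the part with fixed \<open>G \<noteq> V\<close> the differential is, up to terms in which \<open>G\<close> is larger, that of a full
  simplex on \<open>V - G\<close>, which is contracted by adding a fixed vertex outside \<open>G\<close> to \<open>F\<close>.
\<close>

lemma koszul_contraction_step:
  fixes c :: "'v set \<times> 'v set \<Rightarrow> 'r::comm_ring_1"
  assumes c: "\<And>p. p \<notin> cells V \<Delta> i \<Longrightarrow> c p = 0"
    and cm: "\<And>F G. card G < m \<Longrightarrow> c (F, G) = 0"
    and cyc: "i > 0 \<Longrightarrow> koszul V r \<Delta> (\<lambda>_. 1) c = (\<lambda>_. 0)"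
    and aug: "i = 0 \<Longrightarrow> V \<in> \<Delta> \<Longrightarrow> (\<Sum>G\<in>\<Delta> \<inter> Pow V. c ({}, G)) = 0"
  shows "\<exists>b. (\<forall>p. p \<notin> cells V \<Delta> (Suc i) \<longrightarrow> b p = 0) \<and>
    (\<forall>F G. card G < Suc m \<longrightarrow> koszul V r \<Delta> (\<lambda>_. 1) b (F, G) = c (F, G))"
proof -
  define u where "u G = (SOME v. v \<in> V - G)" for G
  have u: "u G \<in> V - G" if "G \<subseteq> V" "G \<noteq> V" for G
  proof -
    have "\<exists>v. v \<in> V - G" using that by blast
    then show ?thesis unfolding u_def by (rule someI_ex)
  qed
  \<comment> \<open>The cone contraction with apex \<open>u G\<close>, applied only to the layer
    \<open>card G = m\<close>; smaller faces are already settled and larger ones are left to later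
    rounds.\<close>
  define b where "b = (\<lambda>(F, G). if (F, G) \<in> cells V \<Delta> (Suc i) \<and> card G = m \<and> u G \<in> F
    then vsign r (u G) (F - {u G}) * c (F - {u G}, G) else 0)"
  have b: "b p = 0" if "p \<notin> cells V \<Delta> (Suc i)" for p
    using that by (cases p) (simp add: b_def)
  have "koszul V r \<Delta> (\<lambda>_. 1) b (F, G) = c (F, G)" if m: "card G < Suc m" for F G
  proof (cases "(F, G) \<in> cells V \<Delta> i")
    case False
    then show ?thesis using koszul_supp[OF finite_V b False] c by simp
  next
    case FG: True
    then have sub: "F \<subseteq> V" "G \<subseteq> V" "F \<inter> G = {}" "G \<in> \<Delta>" "card F = i" by (auto simp: cells_def)
    have fin: "finite F" "finite G" "finite (V - F)" using sub finite_V by (auto intro: finite_subset)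
    have small: "card (G - {v}) < m" if "v \<in> G" for v
      using card_Diff1_less[OF fin(2) that] m by simp
    have kb: "koszul V r \<Delta> (\<lambda>_. 1) b (F, G) =
        (\<Sum>v\<in>V - F. vsign r v F * (if v \<in> G then 0 else b (insert v F, G)))"
      unfolding koszul_cells[OF FG] using small
      by (intro sum.cong refl) (auto simp: b_def)
    show ?thesis
    proof (cases "card G = m")
      case False
      then have "koszul V r \<Delta> (\<lambda>_. 1) b (F, G) = 0"
        unfolding kb by (intro sum.neutral) (auto simp: b_def)
      with False cm[of G F] m show ?thesis by simp
    next
      case Gm: True
      have cells': "(insert v F, G) \<in> cells V \<Delta> (Suc i)" if "v \<in> V - F" "v \<notin> G" for v
        using that sub fin by (auto simp: cells_def)
      show ?thesis
      proof (cases "G = V")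
        \<comment> \<open>No vertex is left outside \<open>G\<close>, so there is no apex. All other
          faces are smaller than \<open>m\<close>, hence the augmentation sum reduces to the single
          coefficient of \<open>({}, V)\<close>, which is therefore zero.\<close>
        case True
        then have F: "F = {}" using sub by auto
        then have i: "i = 0" using sub by simp
        have "c ({}, G') = 0" if "G' \<in> \<Delta> \<inter> Pow V - {G}" for G'
          using that True Gm finite_V by (intro cm) (auto intro: psubset_card_mono)
        then have "c ({}, G) = (\<Sum>G'\<in>\<Delta> \<inter> Pow V. c ({}, G'))"
          using finite_V sub by (subst sum.remove[of _ G]) auto
        also have "\<dots> = 0" using aug i sub True by simp
        finally have "c (F, G) = 0" by (simp add: F)
        moreover have "koszul V r \<Delta> (\<lambda>_. 1) b (F, G) = 0"
          unfolding kb using True by (intro sum.neutral) auto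
        ultimately show ?thesis by simp
      next
        case False
        let ?u = "u G"
        have uV: "?u \<in> V" "?u \<notin> G" using u[OF sub(2) False] by auto
        show ?thesis
        proof (cases "?u \<in> F")
          case uF: False
          have "koszul V r \<Delta> (\<lambda>_. 1) b (F, G) =
            (\<Sum>v\<in>V - F. if v = ?u then vsign r ?u F * b (insert ?u F, G) else 0)"
            unfolding kb using uV by (intro sum.cong) (auto simp: b_def uF)
          also have "\<dots> = vsign r ?u F * b (insert ?u F, G)"
            using uV uF fin by (subst sum.delta) auto
          also have "\<dots> = c (F, G)" using cells' uV uF Gm by (simp add: b_def)
          finally show ?thesis .
        next
          case uF: True
          define F0 where "F0 = F - {?u}"
          have F: "F = insert ?u F0" "?u \<notin> F0" "finite F0" using uF fin by (auto simp: F0_def)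
          have i: "i = Suc (card F0)" using sub(5) F by simp
          have FG0: "(F0, G) \<in> cells V \<Delta> (card F0)" using sub by (auto simp: cells_def F0_def)
          \<comment> \<open>The cycle condition at \<open>F0 = F - {u G}\<close> expresses
            \<open>c (F, G)\<close> by the cells that contain \<open>F0\<close> but not the apex.
            The terms with \<open>v \<in> G\<close> belong to smaller faces, where \<open>c\<close>
            vanishes.\<close>
          have "koszul V r \<Delta> (\<lambda>_. 1) c (F0, G) = 0" using cyc i by simp
          then have "0 = (\<Sum>v\<in>V - F0. vsign r v F0 * (if v \<in> G then 0 else c (insert v F0, G)))"
            unfolding koszul_cells[OF FG0] using small cm
            by (subst (asm) sum.cong[where h = "\<lambda>v. vsign r v F0 * (if v \<in> G then 0 else c (insert v F0, G))", OF refl]) auto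
          also have "V - F0 = insert ?u (V - F)" using F uV by auto
          also have "(\<Sum>v\<in>insert ?u (V - F). vsign r v F0 * (if v \<in> G then 0 else c (insert v F0, G))) =
            vsign r ?u F0 * c (F, G) + (\<Sum>v\<in>V - F. vsign r v F0 * (if v \<in> G then 0 else c (insert v F0, G)))"
            using fin uV by (subst sum.insert) (auto simp: F)
          finally have cycle: "(\<Sum>v\<in>V - F. vsign r v F0 * (if v \<in> G then 0 else c (insert v F0, G))) =
            - (vsign r ?u F0 * c (F, G))" by (simp add: eq_neg_iff_add_eq_0 add.commute)
          have "vsign r v F * (if v \<in> G then 0 else b (insert v F, G)) =
            - vsign r ?u F0 * (vsign r v F0 * (if v \<in> G then 0 else c (insert v F0, G)))"
            if v: "v \<in> V - F" for v
          proof (cases "v \<in> G")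
            case False
            have ne: "v \<noteq> ?u" "v \<notin> F0" using v F by auto
            have "insert v F - {?u} = insert v F0" using ne F by auto
            then have bv: "b (insert v F, G) = vsign r ?u (insert v F0) * c (insert v F0, G)"
              using cells'[OF v False] Gm uF by (simp add: b_def)
            have sg: "vsign r v (insert ?u F0) * vsign r ?u (insert v F0) =
              (- (vsign r v F0 * vsign r ?u F0) :: 'r)"
              using ne F v uV inj_r by (intro vsign_anticommute') (auto dest: inj_onD)
            have "vsign r v F * b (insert v F, G) =
              vsign r v (insert ?u F0) * vsign r ?u (insert v F0) * c (insert v F0, G)"
              unfolding bv F(1)[symmetric] by (simp only: mult.assoc)
            then show ?thesis using False unfolding sg by (simp add: mult_ac)
          qed simp
          then have "koszul V r \<Delta> (\<lambda>_. 1) b (F, G) =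
            - vsign r ?u F0 * (\<Sum>v\<in>V - F. vsign r v F0 * (if v \<in> G then 0 else c (insert v F0, G)))"
            unfolding kb sum_distrib_left by (rule sum.cong[OF refl])
          then show ?thesis unfolding cycle by simp
        qed
      qed
    qed
  qed
  with b show ?thesis by blast
qed

text \<open>The contraction step is iterated over \<open>card G\<close>, each round acting on the
  error left by the previous one. In degree 0 the augmentation replaces the cycle condition, and it
  matters only for \<open>V \<in> \<Delta>\<close>: otherwise a monomial with support
  \<open>V\<close> is zero in the quotient.\<close>

lemma koszul_exact:
  fixes c :: "'v set \<times> 'v set \<Rightarrow> 'r::comm_ring_1"
  assumes c: "\<And>p. p \<notin> cells V \<Delta> i \<Longrightarrow> c p = 0"
    and cyc: "i > 0 \<Longrightarrow> koszul V r \<Delta> (\<lambda>_. 1) c = (\<lambda>_. 0)"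
    and aug: "i = 0 \<Longrightarrow> V \<in> \<Delta> \<Longrightarrow> (\<Sum>G\<in>\<Delta> \<inter> Pow V. c ({}, G)) = 0"
  shows "\<exists>b. (\<forall>p. p \<notin> cells V \<Delta> (Suc i) \<longrightarrow> b p = 0) \<and> koszul V r \<Delta> (\<lambda>_. 1) b = c"
proof -
  let ?d = "koszul V r \<Delta> (\<lambda>_. 1 :: 'r)"
  have "\<exists>b. (\<forall>p. p \<notin> cells V \<Delta> (Suc i) \<longrightarrow> b p = 0) \<and>
    (\<forall>F G. card G < m \<longrightarrow> c (F, G) - ?d b (F, G) = 0)" for m
  proof (induction m)
    case 0
    then show ?case by (intro exI[of _ "\<lambda>_. 0"]) simp
  next
    case (Suc m)
    then obtain b where b: "\<And>p. p \<notin> cells V \<Delta> (Suc i) \<Longrightarrow> b p = 0"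
      "\<And>F G. card G < m \<Longrightarrow> c (F, G) - ?d b (F, G) = 0" by blast
    let ?c = "\<lambda>p. c p - ?d b p"
    have "\<exists>b'. (\<forall>p. p \<notin> cells V \<Delta> (Suc i) \<longrightarrow> b' p = 0) \<and>
      (\<forall>F G. card G < Suc m \<longrightarrow> ?d b' (F, G) = ?c (F, G))"
    proof (rule koszul_contraction_step)
      show "?c p = 0" if "p \<notin> cells V \<Delta> i" for p
        using koszul_supp[OF finite_V b(1) that] c that by simp
      show "?c (F, G) = 0" if "card G < m" for F G using b(2) that .
      show "?d ?c = (\<lambda>_. 0)" if "i > 0"
        using cyc[OF that] by (simp add: koszul_diff koszul_koszul)
      \<comment> \<open>All subsets of \<open>V\<close> are faces here, so boundaries have
        augmentation zero and the error still satisfies \<open>aug\<close>.\<close>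
      assume i: "i = 0" and V: "V \<in> \<Delta>"
      have "(\<Sum>G\<in>\<Delta> \<inter> Pow V. 1 * ?d b ({}, G)) =
        (\<Sum>v\<in>V. \<Sum>G | G \<in> \<Delta> \<inter> Pow V \<and> v \<notin> G \<and> insert v G \<notin> \<Delta>. 1 * b ({v}, G))"
        by (rule augmentation_koszul) simp
      also have "\<dots> = 0"
        using down[OF V] by (intro sum.neutral ballI) auto
      finally show "(\<Sum>G\<in>\<Delta> \<inter> Pow V. ?c ({}, G)) = 0"
        using aug[OF i V] by (simp add: sum_subtractf)
    qed
    then obtain b' where b': "\<And>p. p \<notin> cells V \<Delta> (Suc i) \<Longrightarrow> b' p = 0"
      "\<And>F G. card G < Suc m \<Longrightarrow> ?d b' (F, G) = ?c (F, G)" by blast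
    then show ?case
      using b(1) by (intro exI[of _ "\<lambda>p. b p + b' p"]) (simp add: koszul_add)
  qed
  from this[of "Suc (card V)"] obtain b where b: "\<And>p. p \<notin> cells V \<Delta> (Suc i) \<Longrightarrow> b p = 0"
    "\<And>F G. card G < Suc (card V) \<Longrightarrow> c (F, G) - ?d b (F, G) = 0" by blast
  have "?d b p = c p" for p
  proof (cases "p \<in> cells V \<Delta> i")
    case True
    then obtain F G where p: "p = (F, G)" "G \<subseteq> V" by (auto simp: cells_def)
    then have "card G < Suc (card V)" using card_mono[OF finite_V] by (simp add: less_Suc_eq_le)
    then show ?thesis using b(2) p by simp
  qed (use koszul_supp[OF finite_V b(1)] c in simp)
  with b show ?thesis by blast
qed

end

section \<open>The complex over the polynomial ring\<close>

abbreviation "keys \<equiv> Poly_Mapping.keys"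
abbreviation "lookup \<equiv> Poly_Mapping.lookup"
abbreviation "single \<equiv> Poly_Mapping.single"

lemma poly_ring_simps [simp]:
  "\<zero>\<^bsub>poly_ring V\<^esub> = 0" "\<one>\<^bsub>poly_ring V\<^esub> = 1"
  "p \<oplus>\<^bsub>poly_ring V\<^esub> q = p + q" "p \<otimes>\<^bsub>poly_ring V\<^esub> q = p * q"
  by (simp_all add: poly_ring_def)

abbreviation polys :: "'v set \<Rightarrow> ('v, 'k::field) mvpoly set" where
  "polys V \<equiv> carrier (poly_ring V)"

lemma polys_iff: "p \<in> polys V \<longleftrightarrow> (\<forall>m\<in>keys p. keys m \<subseteq> V)"
  by (simp add: poly_ring_def)

lemma polys_zero [simp]: "0 \<in> polys V" and polys_one [simp]: "1 \<in> polys V"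
  using ring.ring_simprules(2,6)[OF cring.axioms(1)[OF cring_poly_ring]] by (simp_all add: polys_iff)

lemma polys_add [simp]: "p \<in> polys V \<Longrightarrow> q \<in> polys V \<Longrightarrow> p + q \<in> polys V"
  using ring.ring_simprules(1)[OF cring.axioms(1)[OF cring_poly_ring]] by fastforce

lemma polys_mult [simp]: "p \<in> polys V \<Longrightarrow> q \<in> polys V \<Longrightarrow> p * q \<in> polys V"
  using ring.ring_simprules(5)[OF cring.axioms(1)[OF cring_poly_ring]] by fastforce

lemma polys_uminus [simp]: "p \<in> polys V \<Longrightarrow> - p \<in> polys V"
  by (simp add: polys_iff)

lemma polys_sum [simp]: "(\<And>t. t \<in> T \<Longrightarrow> f t \<in> polys V) \<Longrightarrow> sum f T \<in> polys V"
  by (induction T rule: infinite_finite_induct) auto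

lemma polys_single [simp]: "keys m \<subseteq> V \<Longrightarrow> single m a \<in> polys V"
  by (simp add: polys_iff)

lemma polys_mvar [simp]: "v \<in> V \<Longrightarrow> mvar v \<in> polys V"
  by (simp add: mvar_def)

lemma polys_vsign [simp]: "vsign r v F \<in> polys V"
  using vsign_cases[of r v F] by (metis polys_one polys_uminus)

lemma single_sum: "single m (\<Sum>t\<in>T. f t) = (\<Sum>t\<in>T. single m (f t))"
  by (induction T rule: infinite_finite_induct) (simp_all add: single_add)

lemma lookup_sum': "lookup (\<Sum>t\<in>T. f t) m = (\<Sum>t\<in>T. lookup (f t) m)"
  by (induction T rule: infinite_finite_induct) (simp_all add: lookup_add)

lemma vsign_mult_single:
  "vsign r v F * single m a = single m (vsign r v F * a :: 'k::field)"
  by (simp add: vsign_def minus_one_power_iff flip: single_uminus)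

section \<open>Squarefree monomials and multidegrees\<close>

definition support_monomial :: "'v set \<Rightarrow> 'v \<Rightarrow>\<^sub>0 nat" where
  "support_monomial A = (\<Sum>a\<in>A. single a 1)"

lemma lookup_support_monomial:
  "finite A \<Longrightarrow> lookup (support_monomial A) v = (if v \<in> A then 1 else 0)"
  by (simp add: support_monomial_def lookup_sum' lookup_single when_def)

lemma keys_support_monomial: "finite A \<Longrightarrow> keys (support_monomial A) = A"
  by (auto simp: in_keys_iff lookup_support_monomial split: if_splits)

lemma keys_iff_pos: "v \<in> keys (m :: 'v \<Rightarrow>\<^sub>0 nat) \<longleftrightarrow> 0 < lookup m v"
  by (simp add: in_keys_iff)

lemma keys_minus_subset: "keys (m - n :: 'v \<Rightarrow>\<^sub>0 nat) \<subseteq> keys m"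
  by (auto simp: keys_iff_pos lookup_minus)

lemma keys_add_nat: "keys (m + n :: 'v \<Rightarrow>\<^sub>0 nat) = keys m \<union> keys n"
  by (auto simp: keys_iff_pos lookup_add)

text \<open>Subtraction of exponents is truncated; \<open>A \<subseteq> keys t\<close> ensures that
  nothing is cut off.\<close>

lemma minus_support_monomial_eq_iff:
  assumes "finite A" "A \<subseteq> keys t"
  shows "t - support_monomial A = m \<longleftrightarrow> t = m + support_monomial A"
proof
  assume *: "t - support_monomial A = m"
  show "t = m + support_monomial A"
  proof (rule poly_mapping_eqI)
    fix v
    show "lookup t v = lookup (m + support_monomial A) v"
      using assms by (auto simp: lookup_add lookup_minus lookup_support_monomial keys_iff_pos simp flip: *)
  qed
qed simp

lemma mvar_mult_single:
  assumes "finite A" "v \<notin> A" "v \<in> keys t"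
  shows "mvar v * single (t - support_monomial (insert v A)) a =
    single (t - support_monomial A) a"
proof -
  have "single v 1 + (t - support_monomial (insert v A)) = t - support_monomial A"
  proof (rule poly_mapping_eqI)
    fix w
    show "lookup (single v 1 + (t - support_monomial (insert v A))) w =
      lookup (t - support_monomial A) w"
      using assms by (auto simp: lookup_add lookup_minus lookup_support_monomial keys_iff_pos
          lookup_single when_def)
  qed
  then show ?thesis by (simp add: mvar_def mult_single)
qed

text \<open>
  The part of multidegree \<open>t\<close> of the complex over the polynomial ring is a copy of the complex
  of the vertex set \<open>keys t\<close> with all variables set to \<open>1\<close>: the cell \<open>(F, G)\<close> has multidegree
  \<open>F \<union> G\<close>, so its coefficient is determined by \<open>t\<close> up to a scalar.
\<close>

definition lift_strand ::
  "('v \<Rightarrow>\<^sub>0 nat) \<Rightarrow> ('v set \<times> 'v set \<Rightarrow> 'k) \<Rightarrow> 'v set \<times> 'v set \<Rightarrow> ('v, 'k::field) mvpoly" where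
  "lift_strand t c = (\<lambda>(F, G). if F \<union> G \<subseteq> keys t
     then single (t - support_monomial (F \<union> G)) (c (F, G)) else 0)"

definition strand ::
  "('v \<Rightarrow>\<^sub>0 nat) \<Rightarrow> ('v set \<times> 'v set \<Rightarrow> ('v, 'k::field) mvpoly) \<Rightarrow> 'v set \<times> 'v set \<Rightarrow> 'k" where
  "strand t c = (\<lambda>(F, G). if F \<union> G \<subseteq> keys t
     then lookup (c (F, G)) (t - support_monomial (F \<union> G)) else 0)"

text \<open>At a given cell the multidegree \<open>t\<close> contributes only to the monomial
  \<open>t\<close> divided by that of \<open>F \<union> G\<close>. Distinct multidegrees therefore
  never mix, and each can be read off from the sum.\<close>

lemma lookup_sum_lift_strand:
  assumes fin: "finite T" and FG: "finite F" "finite G"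
  shows "lookup (\<Sum>t\<in>T. lift_strand t (c t) (F, G)) m =
    (if m + support_monomial (F \<union> G) \<in> T then c (m + support_monomial (F \<union> G)) (F, G) else 0)"
proof -
  let ?s = "support_monomial (F \<union> G)"
  have "lookup (lift_strand t (c t) (F, G)) m = (if t = m + ?s then c t (F, G) else 0)" for t
  proof (cases "F \<union> G \<subseteq> keys t")
    case True
    then show ?thesis
      using minus_support_monomial_eq_iff[of "F \<union> G" t m] FG
      by (auto simp: lift_strand_def lookup_single when_def)
  next
    case False
    then have "t \<noteq> m + ?s" using FG by (auto simp: keys_add_nat keys_support_monomial)
    with False show ?thesis by (simp only: lift_strand_def split if_False lookup_zero)
  qed
  then show ?thesis using fin by (simp add: lookup_sum')
qed

lemma sum_lift_strand:
  assumes "finite T" "finite F" "finite G"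
    and "\<And>m. m \<in> keys (c (F, G)) \<Longrightarrow> m + support_monomial (F \<union> G) \<in> T"
  shows "(\<Sum>t\<in>T. lift_strand t (strand t c) (F, G)) = c (F, G)"
proof (rule poly_mapping_eqI)
  fix m
  have "strand (m + support_monomial (F \<union> G)) c (F, G) = lookup (c (F, G)) m"
    using assms(2,3) by (auto simp: strand_def keys_add_nat keys_support_monomial)
  then show "lookup (\<Sum>t\<in>T. lift_strand t (strand t c) (F, G)) m = lookup (c (F, G)) m"
    using assms by (subst lookup_sum_lift_strand) (auto simp: in_keys_iff)
qed

text \<open>The Stanley-Reisner ideal, given by its monomials instead of generators, so that
  membership is tested one monomial at a time.\<close>

definition sr_ideal :: "'v set \<Rightarrow> 'v set set \<Rightarrow> ('v, 'k::field) mvpoly set" where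
  "sr_ideal V \<Delta> = {p \<in> polys V. \<forall>m\<in>keys p. keys m \<notin> \<Delta>}"

definition augmentation ::
  "'v set \<Rightarrow> 'v set set \<Rightarrow> ('v set \<times> 'v set \<Rightarrow> ('v, 'k::field) mvpoly) \<Rightarrow> ('v, 'k) mvpoly" where
  "augmentation V \<Delta> c =
     (\<Sum>G\<in>\<Delta> \<inter> Pow V. single (support_monomial G) 1 * c ({}, G))"

context ranked_complex
begin

text \<open>The differential is multihomogeneous: moving \<open>v\<close> between \<open>F\<close>
  and \<open>G\<close> keeps the union, and where the union of the source cell is larger by
  \<open>v\<close>, the factor \<open>mvar v\<close> makes up for it.\<close>

lemma koszul_lift_strand:
  fixes c :: "'v set \<times> 'v set \<Rightarrow> 'k::field"
  assumes t: "keys t \<subseteq> V"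
  shows "koszul V r \<Delta> mvar (lift_strand t c) =
    lift_strand t (koszul (keys t) r \<Delta> (\<lambda>_. 1) c)"
proof (intro ext)
  fix p :: "'v set \<times> 'v set"
  obtain F G where p: "p = (F, G)" by (cases p)
  let ?T = "keys t"
  show "koszul V r \<Delta> mvar (lift_strand t c) p = lift_strand t (koszul ?T r \<Delta> (\<lambda>_. 1) c) p"
  proof (cases "F \<subseteq> V \<and> G \<subseteq> V \<and> F \<inter> G = {} \<and> G \<in> \<Delta>")
    case valid: True
    show ?thesis
    proof (cases "F \<union> G \<subseteq> ?T")
      case True
      have fin: "finite F" "finite G" using valid finite_V by (auto intro: finite_subset)
      let ?m = "t - support_monomial (F \<union> G)"
      let ?f = "\<lambda>v. vsign r v F * (if v \<in> G then - lift_strand t c (insert v F, G - {v})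
        else mvar v * lift_strand t c (insert v F, G))"
      have f: "?f v = single ?m (vsign r v F *
          (if v \<in> G then - c (insert v F, G - {v}) else 1 * c (insert v F, G)))" if v: "v \<in> ?T - F" for v
      proof (cases "v \<in> G")
        case vG: True
        then have "insert v F \<union> (G - {v}) = F \<union> G" by blast
        then have "lift_strand t c (insert v F, G - {v}) = single ?m (c (insert v F, G - {v}))"
          using True by (simp only: lift_strand_def split if_True)
        then show ?thesis using vG by (simp add: vsign_mult_single flip: single_uminus)
      next
        case vG: False
        have "insert v F \<union> G = insert v (F \<union> G)" by blast
        then have "lift_strand t c (insert v F, G) =
          single (t - support_monomial (insert v (F \<union> G))) (c (insert v F, G))"
          using True v by (simp add: lift_strand_def)
        moreover have "mvar v * \<dots> = single ?m (c (insert v F, G))"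
          using v vG fin by (intro mvar_mult_single) auto
        ultimately show ?thesis using vG by (simp add: vsign_mult_single)
      qed
      have "koszul V r \<Delta> mvar (lift_strand t c) p = (\<Sum>v\<in>V - F. ?f v)"
        using valid by (simp add: p koszul_def)
      also have "\<dots> = (\<Sum>v\<in>?T - F. ?f v)"
        using t finite_V by (intro sum.mono_neutral_right) (auto simp: lift_strand_def)
      also have "\<dots> = (\<Sum>v\<in>?T - F. single ?m (vsign r v F *
          (if v \<in> G then - c (insert v F, G - {v}) else 1 * c (insert v F, G))))"
        by (rule sum.cong[OF refl f])
      also have "\<dots> = single ?m (koszul ?T r \<Delta> (\<lambda>_. 1) c (F, G))"
        using valid True by (simp add: koszul_def single_sum)
      finally show ?thesis using True by (simp add: p lift_strand_def)
    next
      \<comment> \<open>Every cell contributing to \<open>(F, G)\<close> has a union containing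
        \<open>F \<union> G\<close>, hence also one outside \<open>keys t\<close>.\<close>
      case False
      have "koszul V r \<Delta> mvar (lift_strand t c) p = 0"
      proof -
        have z: "lift_strand t c (insert v F, G') = 0" if "F \<union> G \<subseteq> insert v F \<union> G'" for v G'
        proof -
          have "\<not> insert v F \<union> G' \<subseteq> ?T" using that False by blast
          then show ?thesis by (simp only: lift_strand_def split if_False)
        qed
        have "lift_strand t c (insert v F, G - {v}) = 0" "lift_strand t c (insert v F, G) = 0" for v
          by (rule z, blast)+
        then show ?thesis using valid by (auto simp: p koszul_def intro!: sum.neutral)
      qed
      then show ?thesis using False by (simp only: p lift_strand_def split if_False)
    qed
  next
    case False
    then have "\<not> (F \<subseteq> ?T \<and> G \<subseteq> ?T \<and> F \<inter> G = {} \<and> G \<in> \<Delta>)" using t by blast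
    with False show ?thesis by (auto simp: p koszul_def lift_strand_def)
  qed
qed

lemma augmentation_sum: "augmentation V \<Delta> (\<lambda>p. \<Sum>t\<in>T. c t p) = (\<Sum>t\<in>T. augmentation V \<Delta> (c t))"
  unfolding augmentation_def sum_distrib_left by (rule sum.swap)

lemma augmentation_lift_strand:
  fixes c :: "'v set \<times> 'v set \<Rightarrow> 'k::field"
  assumes t: "keys t \<subseteq> V"
  shows "augmentation V \<Delta> (lift_strand t c) =
    single t (\<Sum>G\<in>\<Delta> \<inter> Pow (keys t). c ({}, G))"
proof -
  have "augmentation V \<Delta> (lift_strand t c) = (\<Sum>G\<in>\<Delta> \<inter> Pow (keys t).
      single (support_monomial G) 1 * lift_strand t c ({}, G))"
    unfolding augmentation_def
    using t finite_V by (intro sum.mono_neutral_right) (auto simp: lift_strand_def)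
  also have "\<dots> = (\<Sum>G\<in>\<Delta> \<inter> Pow (keys t). single t (c ({}, G)))"
  proof (intro sum.cong refl)
    fix G assume G: "G \<in> \<Delta> \<inter> Pow (keys t)"
    then have "support_monomial G + (t - support_monomial G) = t"
      using minus_support_monomial_eq_iff[of G t "t - support_monomial G"]
      by (metis IntD2 Pow_iff add.commute finite_keys finite_subset)
    with G show "single (support_monomial G) 1 * lift_strand t c ({}, G) =
      single t (c ({}, G))" by (simp add: lift_strand_def mult_single)
  qed
  finally show ?thesis by (simp add: single_sum)
qed

text \<open>Only finitely many multidegrees occur in \<open>c\<close>. In each of them the equation
  is solved by \<open>koszul_exact\<close> on the vertex set \<open>keys t\<close>, and the
  solutions are added up.\<close>

lemma koszul_exact_poly:
  fixes c :: "'v set \<times> 'v set \<Rightarrow> ('v, 'k::field) mvpoly"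
  assumes c: "c \<in> carrier (free_mod (poly_ring V) (cells V \<Delta> i))"
    and cyc: "i > 0 \<Longrightarrow> koszul V r \<Delta> mvar c = (\<lambda>_. 0)"
    and aug: "i = 0 \<Longrightarrow> augmentation V \<Delta> c \<in> sr_ideal V \<Delta>"
  shows "\<exists>b\<in>carrier (free_mod (poly_ring V) (cells V \<Delta> (Suc i))). koszul V r \<Delta> mvar b = c"
proof -
  define T where "T = (\<Union>p\<in>cells V \<Delta> i.
    (\<lambda>m. m + support_monomial (fst p \<union> snd p)) ` keys (c p))"
  have c_polys: "c p \<in> polys V" and c0: "p \<notin> cells V \<Delta> i \<Longrightarrow> c p = 0" for p
    using c by (cases p; simp)+
  have finT: "finite T" unfolding T_def by (simp add: finite_cells finite_V)
  have TV: "keys t \<subseteq> V" if "t \<in> T" for t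
  proof -
    from that obtain F G m where FG: "(F, G) \<in> cells V \<Delta> i" and m: "m \<in> keys (c (F, G))"
      and t: "t = m + support_monomial (F \<union> G)" by (auto simp: T_def)
    have "F \<subseteq> V" "G \<subseteq> V" using FG by (auto simp: cells_def)
    moreover from this have "finite (F \<union> G)" using finite_V by (auto intro: finite_subset)
    moreover have "keys m \<subseteq> V" using c_polys m by (auto simp: polys_iff)
    ultimately show ?thesis by (simp add: t keys_add_nat keys_support_monomial)
  qed
  have decomp: "c = (\<lambda>p. \<Sum>t\<in>T. lift_strand t (strand t c) p)"
  proof (intro ext)
    fix p
    show "c p = (\<Sum>t\<in>T. lift_strand t (strand t c) p)"
    proof (cases "p \<in> cells V \<Delta> i")
      case True
      then obtain F G where p: "p = (F, G)" "F \<subseteq> V" "G \<subseteq> V" by (auto simp: cells_def)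
      have "m + support_monomial (F \<union> G) \<in> T" if "m \<in> keys (c (F, G))" for m
        using True that by (force simp: T_def p)
      moreover have "finite F" "finite G" using p finite_V by (auto intro: finite_subset)
      ultimately show ?thesis using sum_lift_strand[OF finT, of F G c] by (simp add: p)
    next
      case False
      then have "lift_strand t (strand t c) p = 0" for t
        using c0[OF False] by (cases p) (simp add: lift_strand_def strand_def)
      then show ?thesis using c0[OF False] by simp
    qed
  qed
  have strand_supp: "strand t c p = 0" if "p \<notin> cells (keys t) \<Delta> i" "t \<in> T" for t p
    using that c0[of p] TV[of t] by (cases p) (auto simp: strand_def cells_def)
  have strand_cyc: "koszul (keys t) r \<Delta> (\<lambda>_. 1) (strand t c) = (\<lambda>_. 0)"
    if i: "i > 0" and t: "t \<in> T" for t
  proof (intro ext)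
    fix p :: "'v set \<times> 'v set"
    let ?k = "\<lambda>t. koszul (keys t) r \<Delta> (\<lambda>_. 1) (strand t c)"
    obtain F G where p: "p = (F, G)" by (cases p)
    show "?k t p = 0"
    proof (cases "F \<union> G \<subseteq> keys t")
      case True
      then have fin: "finite F" "finite G" by (auto intro: finite_subset)
      have "(\<lambda>p. \<Sum>t\<in>T. lift_strand t (?k t) p) = koszul V r \<Delta> mvar c"
        by (subst decomp) (simp add: koszul_sum koszul_lift_strand TV cong: sum.cong)
      also have "\<dots> = (\<lambda>_. 0)" by (rule cyc[OF i])
      finally have "(\<Sum>t\<in>T. lift_strand t (?k t) (F, G)) = 0" by (rule fun_cong)
      then have "lookup (\<Sum>t\<in>T. lift_strand t (?k t) (F, G)) (t - support_monomial (F \<union> G)) = 0"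
        by simp
      moreover have "t - support_monomial (F \<union> G) + support_monomial (F \<union> G) = t"
        by (rule iffD1[OF minus_support_monomial_eq_iff refl, symmetric]) (use True fin in auto)
      ultimately show ?thesis using t by (simp add: lookup_sum_lift_strand[OF finT fin] p)
    qed (auto simp: p koszul_def)
  qed
  \<comment> \<open>Membership in the ideal kills exactly the coefficients at monomials whose
    support is a face. This is the case \<open>keys t \<in> \<Delta>\<close> in which
    \<open>koszul_exact\<close> asks for the augmentation.\<close>
  have strand_aug: "(\<Sum>G\<in>\<Delta> \<inter> Pow (keys t). strand t c ({}, G)) = 0"
    if i: "i = 0" and t: "t \<in> T" and "keys t \<in> \<Delta>" for t
  proof -
    let ?a = "\<lambda>t. \<Sum>G\<in>\<Delta> \<inter> Pow (keys t). strand t c ({}, G)"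
    have "augmentation V \<Delta> c = (\<Sum>t\<in>T. single t (?a t))"
      by (subst decomp) (simp add: augmentation_sum augmentation_lift_strand TV cong: sum.cong)
    then have "lookup (augmentation V \<Delta> c) t = ?a t"
      using t finT by (simp add: lookup_sum' lookup_single when_def)
    moreover have "lookup (augmentation V \<Delta> c) t = 0"
      using aug[OF i] that(3) by (auto simp: sr_ideal_def in_keys_iff)
    ultimately show ?thesis by simp
  qed
  have "\<exists>b. (\<forall>p. p \<notin> cells (keys t) \<Delta> (Suc i) \<longrightarrow> b p = 0) \<and>
    koszul (keys t) r \<Delta> (\<lambda>_. 1) b = strand t c" if t: "t \<in> T" for t
  proof -
    interpret T: ranked_complex "keys t" r \<Delta>
      using TV[OF t] inj_r by unfold_locales (auto intro: inj_on_subset down)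
    show ?thesis
      by (rule T.koszul_exact) (use t strand_supp strand_cyc strand_aug in auto)
  qed
  then obtain b where b: "\<And>t p. t \<in> T \<Longrightarrow> p \<notin> cells (keys t) \<Delta> (Suc i) \<Longrightarrow> b t p = 0"
    "\<And>t. t \<in> T \<Longrightarrow> koszul (keys t) r \<Delta> (\<lambda>_. 1) (b t) = strand t c" by metis
  let ?b = "\<lambda>p. \<Sum>t\<in>T. lift_strand t (b t) p"
  show ?thesis
  proof (rule bexI)
    have "koszul V r \<Delta> mvar ?b = (\<lambda>p. \<Sum>t\<in>T. lift_strand t (strand t c) p)"
      by (simp add: koszul_sum koszul_lift_strand TV b(2) cong: sum.cong)
    then show "koszul V r \<Delta> mvar ?b = c" by (simp only: decomp[symmetric])
    have "lift_strand t (b t) p \<in> polys V" if "t \<in> T" for t p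
      using subset_trans[OF keys_minus_subset TV[OF that]]
      by (cases p) (simp add: lift_strand_def)
    moreover have "lift_strand t (b t) p = 0" if "t \<in> T" "p \<notin> cells V \<Delta> (Suc i)" for t p
    proof -
      have "p \<notin> cells (keys t) \<Delta> (Suc i)" using that TV[OF that(1)] by (auto simp: cells_def)
      then show ?thesis using b(1)[OF that(1)] by (cases p) (simp add: lift_strand_def)
    qed
    ultimately show "?b \<in> carrier (free_mod (poly_ring V) (cells V \<Delta> (Suc i)))" by simp
  qed
qed

end

section \<open>The Stanley-Reisner ideal and its free resolution\<close>

lemma poly_ring_minus: "p \<in> polys V \<Longrightarrow> \<ominus>\<^bsub>poly_ring V\<^esub> p = - p"
proof -
  assume p: "p \<in> polys V"
  interpret cring "poly_ring V" by (rule cring_poly_ring)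
  show ?thesis by (rule minus_equality) (use p in simp_all)
qed

context ranked_complex
begin

lemma single_mult_sr_ideal:
  assumes p: "p \<in> polys V" and m: "keys m \<subseteq> V" "keys m \<notin> \<Delta>"
  shows "single m a * p \<in> sr_ideal V \<Delta>"
  unfolding sr_ideal_def mem_Collect_eq
proof (intro conjI ballI)
  show "single m a * p \<in> polys V" using p m by simp
  fix m' assume "m' \<in> keys (single m a * p)"
  then obtain b where "m' = m + b"
    using keys_mult[of "single m a" p] by (auto split: if_splits)
  then have "keys m \<subseteq> keys m'" by (simp add: keys_add_nat)
  with m(2) down show "keys m' \<notin> \<Delta>" by blast
qed

lemma sr_ideal_add: "p \<in> sr_ideal V \<Delta> \<Longrightarrow> q \<in> sr_ideal V \<Delta> \<Longrightarrow> p + q \<in> sr_ideal V \<Delta>"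
  using Poly_Mapping.keys_add[of p q] unfolding sr_ideal_def by fastforce

lemma sr_ideal_zero: "0 \<in> sr_ideal V \<Delta>"
  by (simp add: sr_ideal_def)

lemma sr_ideal_sum: "(\<And>t. t \<in> T \<Longrightarrow> f t \<in> sr_ideal V \<Delta>) \<Longrightarrow> sum f T \<in> sr_ideal V \<Delta>"
  by (induction T rule: infinite_finite_induct) (auto simp: sr_ideal_add sr_ideal_zero)

lemma ideal_sr_ideal: "ideal (sr_ideal V \<Delta> :: ('v, 'k::field) mvpoly set) (poly_ring V)"
proof -
  interpret cring "poly_ring V :: ('v, 'k) mvpoly ring" by (rule cring_poly_ring)
  have sub: "(sr_ideal V \<Delta> :: ('v, 'k) mvpoly set) \<subseteq> polys V" by (auto simp: sr_ideal_def)
  have mult: "x * a \<in> sr_ideal V \<Delta>" if a: "a \<in> sr_ideal V \<Delta>" and x: "x \<in> polys V"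
    for a x :: "('v, 'k) mvpoly"
    unfolding sr_ideal_def mem_Collect_eq
  proof (intro conjI ballI)
    show "x * a \<in> polys V" using a x by (simp add: sr_ideal_def)
    fix m assume "m \<in> keys (x * a)"
    then obtain b c where "m = b + c" "c \<in> keys a" using keys_mult[of x a] by blast
    then have "keys c \<subseteq> keys m" "keys c \<notin> \<Delta>"
      using a by (auto simp: keys_add_nat sr_ideal_def)
    then show "keys m \<notin> \<Delta>" using down by blast
  qed
  show ?thesis
  proof (rule idealI)
    show "subgroup (sr_ideal V \<Delta>) (add_monoid (poly_ring V :: ('v, 'k) mvpoly ring))"
    proof (rule add.subgroupI)
      show "\<ominus>\<^bsub>poly_ring V\<^esub> a \<in> sr_ideal V \<Delta>" if "a \<in> sr_ideal V \<Delta>" for a :: "('v, 'k) mvpoly"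
        using that sub by (subst poly_ring_minus) (auto simp: sr_ideal_def)
    qed (use sub sr_ideal_zero sr_ideal_add in auto)
  qed (use mult in \<open>auto simp: mult.commute intro: ring_axioms\<close>)
qed

lemma support_monomial_insert:
  "finite G \<Longrightarrow> v \<notin> G \<Longrightarrow> single (support_monomial (insert v G)) 1 =
    single (support_monomial G) 1 * mvar v"
  by (simp add: support_monomial_def mvar_def mult_single add.commute)

lemma augmentation_koszul_mem:
  assumes c: "\<And>p. c p \<in> polys V"
  shows "augmentation V \<Delta> (koszul V r \<Delta> mvar c) \<in> sr_ideal V \<Delta>"
proof -
  have "augmentation V \<Delta> (koszul V r \<Delta> mvar c) =
    (\<Sum>v\<in>V. \<Sum>G | G \<in> \<Delta> \<inter> Pow V \<and> v \<notin> G \<and> insert v G \<notin> \<Delta>.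
      single (support_monomial (insert v G)) 1 * c ({v}, G))"
    unfolding augmentation_def
    using finite_V by (intro augmentation_koszul support_monomial_insert) (auto intro: finite_subset)
  also have "\<dots> \<in> sr_ideal V \<Delta>"
  proof (intro sr_ideal_sum single_mult_sr_ideal c)
    fix v G assume "v \<in> V" and G: "G \<in> {G. G \<in> \<Delta> \<inter> Pow V \<and> v \<notin> G \<and> insert v G \<notin> \<Delta>}"
    then have "keys (support_monomial (insert v G)) = insert v G"
      using finite_V by (intro keys_support_monomial) (auto intro: finite_subset)
    with G \<open>v \<in> V\<close> show "keys (support_monomial (insert v G)) \<subseteq> V"
      "keys (support_monomial (insert v G)) \<notin> \<Delta>" by auto
  qed
  finally show ?thesis .
qed

abbreviation free_cells :: "nat \<Rightarrow> (('v, 'k::field) mvpoly, 'v set \<times> 'v set \<Rightarrow> ('v, 'k) mvpoly) module" where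
  "free_cells i \<equiv> free_mod (poly_ring V) (cells V \<Delta> i)"

lemma free_cells_iff:
  "c \<in> carrier (free_cells i) \<longleftrightarrow> (\<forall>p. c p \<in> polys V) \<and> (\<forall>p. p \<notin> cells V \<Delta> i \<longrightarrow> c p = 0)"
  by auto

lemma free_cellsD:
  "c \<in> carrier (free_cells i) \<Longrightarrow> c p \<in> polys V"
  "c \<in> carrier (free_cells i) \<Longrightarrow> p \<notin> cells V \<Delta> i \<Longrightarrow> c p = 0"
  unfolding free_cells_iff by blast+

lemma koszul_polys:
  assumes "\<And>v. v \<in> V \<Longrightarrow> e v \<in> polys V" "\<And>p. c p \<in> polys V"
  shows "koszul V r \<Delta> e c p \<in> polys V"
proof -
  have "vsign r v F * (if v \<in> G then - c (insert v F, G - {v}) else e v * c (insert v F, G)) \<in> polys V"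
    if "v \<in> V" for v F G
    using assms(1)[OF that] assms(2) by simp
  then have "(\<Sum>v\<in>V - F. vsign r v F * (if v \<in> G then - c (insert v F, G - {v}) else e v * c (insert v F, G)))
      \<in> polys V" for F G
    by (intro polys_sum) blast
  then show ?thesis by (cases p) (simp add: koszul_def)
qed

lemma koszul_free_cells:
  assumes "\<And>v. v \<in> V \<Longrightarrow> e v \<in> polys V" "c \<in> carrier (free_cells (Suc i))"
  shows "koszul V r \<Delta> e c \<in> carrier (free_cells i)"
  unfolding free_cells_iff
  by (intro conjI allI impI koszul_polys assms(1) free_cellsD(1)[OF assms(2)]
      koszul_supp[OF finite_V free_cellsD(2)[OF assms(2)]])

lemma koszul_linear:
  assumes "\<And>v. v \<in> V \<Longrightarrow> e v \<in> polys V"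
  shows "koszul V r \<Delta> e \<in> linear_maps (poly_ring V) (free_cells (Suc i)) (free_cells i)"
  using koszul_free_cells[OF assms]
  by (intro linear_mapsI) (simp_all only: free_mod_simps poly_ring_simps koszul_add koszul_scale)

lemma augmentation_polys: "(\<And>p. c p \<in> polys V) \<Longrightarrow> augmentation V \<Delta> c \<in> polys V"
  unfolding augmentation_def
proof (intro polys_sum polys_mult polys_single)
  fix G assume "G \<in> \<Delta> \<inter> Pow V"
  moreover from this have "finite G" using finite_V by (auto intro: finite_subset)
  ultimately show "keys (support_monomial G) \<subseteq> V" by (simp add: keys_support_monomial)
qed

theorem resolution_koszul:
  assumes "{} \<in> \<Delta>"
  shows "resolution (poly_ring V) (quot_module (poly_ring V) (sr_ideal V \<Delta> :: ('v, 'k::field) mvpoly set))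
    free_cells (\<lambda>i. koszul V r \<Delta> mvar)
    (\<lambda>c. sr_ideal V \<Delta> +>\<^bsub>poly_ring V\<^esub> augmentation V \<Delta> c)"
proof -
  let ?R = "poly_ring V :: ('v, 'k) mvpoly ring"
  let ?I = "sr_ideal V \<Delta> :: ('v, 'k) mvpoly set"
  let ?M = "quot_module ?R ?I"
  let ?d = "koszul V r \<Delta> (mvar :: 'v \<Rightarrow> ('v, 'k) mvpoly)"
  interpret R: cring ?R by (rule cring_poly_ring)
  interpret I: ideal ?I ?R by (rule ideal_sr_ideal)
  have coset_eq: "?I +>\<^bsub>?R\<^esub> p = \<zero>\<^bsub>?M\<^esub> \<longleftrightarrow> p \<in> ?I" if "p \<in> polys V" for p
  proof -
    have "?I +>\<^bsub>?R\<^esub> p = ?I \<longleftrightarrow> p \<in> ?I"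
      using that I.a_rcos_const I.a_rcos_self by blast
    then show ?thesis by (simp add: quot_module_def FactRing_def)
  qed
  have e: "(\<lambda>c. ?I +>\<^bsub>?R\<^esub> augmentation V \<Delta> c) \<in> linear_maps ?R (free_cells 0) ?M"
  proof (rule linear_mapsI)
    fix a b :: "'v set \<times> 'v set \<Rightarrow> ('v, 'k) mvpoly" and x :: "('v, 'k) mvpoly"
    assume a: "a \<in> carrier (free_cells 0)"
    note pa = augmentation_polys[OF free_cellsD(1)[OF a]]
    then show "?I +>\<^bsub>?R\<^esub> augmentation V \<Delta> a \<in> carrier ?M"
      by (auto simp: quot_module_def FactRing_def A_RCOSETS_def')
    show "?I +>\<^bsub>?R\<^esub> augmentation V \<Delta> (x \<odot>\<^bsub>free_cells 0\<^esub> a) =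
        x \<odot>\<^bsub>?M\<^esub> (?I +>\<^bsub>?R\<^esub> augmentation V \<Delta> a)" if x: "x \<in> polys V"
    proof -
      have "augmentation V \<Delta> (x \<odot>\<^bsub>free_cells 0\<^esub> a) = x \<otimes>\<^bsub>?R\<^esub> augmentation V \<Delta> a"
        by (simp add: augmentation_def sum_distrib_left mult_ac)
      then show ?thesis
        using ring_hom_mult[OF I.rcos_ring_hom x pa] by (simp only: quot_module_def module.simps)
    qed
    assume b: "b \<in> carrier (free_cells 0)"
    have "augmentation V \<Delta> (a \<oplus>\<^bsub>free_cells 0\<^esub> b) = augmentation V \<Delta> a \<oplus>\<^bsub>?R\<^esub> augmentation V \<Delta> b"
      by (simp add: augmentation_def distrib_left sum.distrib)
    then show "?I +>\<^bsub>?R\<^esub> augmentation V \<Delta> (a \<oplus>\<^bsub>free_cells 0\<^esub> b) =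
        (?I +>\<^bsub>?R\<^esub> augmentation V \<Delta> a) \<oplus>\<^bsub>?M\<^esub> (?I +>\<^bsub>?R\<^esub> augmentation V \<Delta> b)"
      using ring_hom_add[OF I.rcos_ring_hom pa augmentation_polys[OF free_cellsD(1)[OF b]]]
      by (simp only: quot_module_def ring.simps)
  qed
  have surj: "(\<lambda>c. ?I +>\<^bsub>?R\<^esub> augmentation V \<Delta> c) ` carrier (free_cells 0) = carrier ?M"
  proof (intro equalityI subsetI)
    fix C assume "C \<in> carrier ?M"
    then obtain p where p: "p \<in> polys V" and C: "C = ?I +>\<^bsub>?R\<^esub> p"
      by (auto simp: quot_module_def FactRing_def A_RCOSETS_def')
    \<comment> \<open>The class of \<open>p\<close> comes from the coefficient \<open>p\<close> at
      the cell of two empty sets, which is a cell because the empty set is a face.\<close>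
    let ?c = "\<lambda>q. if q = ({}, {}) then p else 0"
    have "augmentation V \<Delta> ?c = (\<Sum>G\<in>\<Delta> \<inter> Pow V. if G = {} then p else 0)"
      unfolding augmentation_def by (intro sum.cong) (auto simp: support_monomial_def)
    also have "\<dots> = p" using assms finite_V by (subst sum.delta) auto
    finally have "C = ?I +>\<^bsub>?R\<^esub> augmentation V \<Delta> ?c" by (simp only: C)
    moreover have "?c \<in> carrier (free_cells 0)"
      using p assms unfolding free_cells_iff by (auto simp: cells_def)
    ultimately show "C \<in> (\<lambda>c. ?I +>\<^bsub>?R\<^esub> augmentation V \<Delta> c) ` carrier (free_cells 0)" by (rule image_eqI)
  next
    fix C assume "C \<in> (\<lambda>c. ?I +>\<^bsub>?R\<^esub> augmentation V \<Delta> c) ` carrier (free_cells 0)"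
    then show "C \<in> carrier ?M" by (elim imageE) (simp only: linear_maps_closed[OF e])
  qed
  have d: "?d \<in> linear_maps ?R (free_cells (Suc i)) (free_cells i)" for i
    by (rule koszul_linear) simp
  have ex0: "?d ` carrier (free_cells 1) =
    {a \<in> carrier (free_cells 0). ?I +>\<^bsub>?R\<^esub> augmentation V \<Delta> a = \<zero>\<^bsub>?M\<^esub>}"
  proof (intro equalityI subsetI)
    fix a assume "a \<in> ?d ` carrier (free_cells 1)"
    then obtain b where b: "b \<in> carrier (free_cells (Suc 0))" "a = ?d b" by auto
    have "augmentation V \<Delta> a \<in> ?I" unfolding b(2) by (rule augmentation_koszul_mem) (rule free_cellsD(1)[OF b(1)])
    moreover have a: "a \<in> carrier (free_cells 0)" unfolding b(2) by (rule linear_maps_closed[OF d b(1)])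
    ultimately show "a \<in> {a \<in> carrier (free_cells 0). ?I +>\<^bsub>?R\<^esub> augmentation V \<Delta> a = \<zero>\<^bsub>?M\<^esub>}"
      using coset_eq[OF augmentation_polys[OF free_cellsD(1)[OF a]]] by (simp only: mem_Collect_eq)
  next
    fix a assume "a \<in> {a \<in> carrier (free_cells 0). ?I +>\<^bsub>?R\<^esub> augmentation V \<Delta> a = \<zero>\<^bsub>?M\<^esub>}"
    then have a: "a \<in> carrier (free_cells 0)" "?I +>\<^bsub>?R\<^esub> augmentation V \<Delta> a = \<zero>\<^bsub>?M\<^esub>"
      by (simp_all only: mem_Collect_eq)
    then have "augmentation V \<Delta> a \<in> ?I" using coset_eq[OF augmentation_polys[OF free_cellsD(1)[OF a(1)]]] by (simp only:)
    then have "\<exists>b\<in>carrier (free_cells (Suc 0)). ?d b = a" by (intro koszul_exact_poly[OF a(1)]) simp_all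
    then show "a \<in> ?d ` carrier (free_cells 1)" by auto
  qed
  have exS: "?d ` carrier (free_cells (Suc (Suc i))) = {a \<in> carrier (free_cells (Suc i)). ?d a = \<zero>\<^bsub>free_cells i\<^esub>}" for i
  proof (intro equalityI subsetI)
    fix a assume "a \<in> ?d ` carrier (free_cells (Suc (Suc i)))"
    then obtain b where b: "b \<in> carrier (free_cells (Suc (Suc i)))" "a = ?d b" by auto
    have "a \<in> carrier (free_cells (Suc i))" unfolding b(2) by (rule linear_maps_closed[OF d b(1)])
    moreover have "?d a = \<zero>\<^bsub>free_cells i\<^esub>" unfolding b(2) koszul_koszul by simp
    ultimately show "a \<in> {a \<in> carrier (free_cells (Suc i)). ?d a = \<zero>\<^bsub>free_cells i\<^esub>}"
      by (simp only: mem_Collect_eq)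
  next
    fix a assume "a \<in> {a \<in> carrier (free_cells (Suc i)). ?d a = \<zero>\<^bsub>free_cells i\<^esub>}"
    then have "a \<in> carrier (free_cells (Suc i))" "?d a = \<zero>\<^bsub>free_cells i\<^esub>"
      by (simp_all only: mem_Collect_eq)
    then have "a \<in> carrier (free_cells (Suc i))" "?d a = (\<lambda>_. 0)"
      by (simp_all only: free_mod_simps(2) poly_ring_simps)
    then have "\<exists>b\<in>carrier (free_cells (Suc (Suc i))). ?d b = a" by (intro koszul_exact_poly) simp_all
    then show "a \<in> ?d ` carrier (free_cells (Suc (Suc i)))" by auto
  qed
  show ?thesis
    unfolding resolution_def
    by (intro conjI allI d e surj ex0 exS)
qed

end

section \<open>Projective dimension and cohomology of induced subcomplexes\<close>

definition coboundary :: "('v \<Rightarrow> nat) \<Rightarrow> ('v set \<Rightarrow> 'k::comm_ring_1) \<Rightarrow> 'v set \<Rightarrow> 'k" where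
  "coboundary r c G = (\<Sum>v\<in>G. vsign r v (G - {v}) * c (G - {v}))"

text \<open>
  Faces are counted by their cardinality \<open>j\<close>, so this is the vanishing of the reduced cohomology
  in dimension \<open>j - 1\<close>, with coefficients in \<open>'k\<close>, of the subcomplex of \<open>\<Delta>\<close> induced on \<open>\<sigma>\<close>.
\<close>

definition acyclic_at :: "'k::field itself \<Rightarrow> ('v \<Rightarrow> nat) \<Rightarrow> 'v set set \<Rightarrow> 'v set \<Rightarrow> nat \<Rightarrow> bool" where
  "acyclic_at K r \<Delta> \<sigma> j \<longleftrightarrow>
     (\<forall>c :: 'v set \<Rightarrow> 'k. (\<forall>G\<in>\<Delta>. G \<subseteq> \<sigma> \<and> card G = Suc j \<longrightarrow> coboundary r c G = 0) \<longrightarrow>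
        (\<exists>b. \<forall>G\<in>\<Delta>. G \<subseteq> \<sigma> \<and> card G = j \<longrightarrow> c G = coboundary r b G))"

lemma coboundary_cong:
  assumes "\<And>v. v \<in> G \<Longrightarrow> b (G - {v}) = c (G - {v})"
  shows "coboundary r b G = coboundary r c G"
  using assms by (simp add: coboundary_def)

lemma coboundary_uminus: "coboundary r (\<lambda>G. - c G) G = - coboundary r c G"
  by (simp add: coboundary_def sum_negf)

lemma lookup_vsign_mult:
  "lookup (vsign r v F * p) m = (vsign r v F * lookup p m :: 'k::field)"
  by (simp add: vsign_def minus_one_power_iff)

text \<open>Without the variables the differential has entries in the field, so it acts separately
  on the coefficients of each monomial.\<close>

lemma lookup_koszul_zero:
  "lookup (koszul V r \<Delta> (\<lambda>_. 0) c p) m =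
    koszul V r \<Delta> (\<lambda>_. 0 :: 'k::field) (\<lambda>q. lookup (c q) m) p"
  by (cases p) (auto simp: koszul_def lookup_sum' lookup_vsign_mult intro!: sum.cong)

text \<open>The part independent of \<open>e\<close> plus the part carrying a factor
  \<open>e v\<close>. The second is written as a combination of explicit vectors, so that linear
  maps can be pulled past the scalars.\<close>

lemma koszul_split:
  "koszul V r \<Delta> e c p = koszul V r \<Delta> (\<lambda>_. 0) c p +
    (\<Sum>v\<in>V. e v * (if fst p \<subseteq> V \<and> snd p \<subseteq> V \<and> fst p \<inter> snd p = {} \<and> snd p \<in> \<Delta> \<and> v \<notin> fst p \<and> v \<notin> snd p
      then vsign r v (fst p) * c (insert v (fst p), snd p) else 0))"
  if "finite V"
proof (cases p)
  case (Pair F G)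
  show ?thesis
  proof (cases "F \<subseteq> V \<and> G \<subseteq> V \<and> F \<inter> G = {} \<and> G \<in> \<Delta>")
    case True
    have "(\<Sum>v\<in>V. e v * (if v \<notin> F \<and> v \<notin> G then vsign r v F * c (insert v F, G) else 0)) =
      (\<Sum>v\<in>V - F. e v * (if v \<notin> F \<and> v \<notin> G then vsign r v F * c (insert v F, G) else 0))"
      using that by (intro sum.mono_neutral_right) auto
    moreover have "(\<Sum>v\<in>V - F. vsign r v F * (if v \<in> G then - c (insert v F, G - {v}) else e v * c (insert v F, G))) =
      (\<Sum>v\<in>V - F. vsign r v F * (if v \<in> G then - c (insert v F, G - {v}) else 0 * c (insert v F, G))) +
      (\<Sum>v\<in>V - F. e v * (if v \<notin> F \<and> v \<notin> G then vsign r v F * c (insert v F, G) else 0))"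
      unfolding sum.distrib[symmetric] by (intro sum.cong) (auto simp: mult_ac)
    ultimately show ?thesis using True unfolding Pair fst_conv snd_conv by (simp add: koszul_def)
  next
    case False
    then have "(if F \<subseteq> V \<and> G \<subseteq> V \<and> F \<inter> G = {} \<and> G \<in> \<Delta> \<and> v \<notin> F \<and> v \<notin> G
      then vsign r v F * c (insert v F, G) else 0) = 0" for v by auto
    moreover have "koszul V r \<Delta> e c (F, G) = 0" "koszul V r \<Delta> (\<lambda>_. 0) c (F, G) = 0"
      using False by (auto simp: koszul_def)
    ultimately show ?thesis unfolding Pair fst_conv snd_conv by simp
  qed
qed

lemma lookup_mvar_mult_zero: "lookup (mvar v * p) 0 = 0"
proof (rule ccontr)
  assume "lookup (mvar v * p) 0 \<noteq> 0"
  then have "0 \<in> keys (mvar v * p)" by (simp add: in_keys_iff)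
  then obtain b where "0 = single v (1 :: nat) + b"
    using keys_mult[of "mvar v" p] by (auto simp: mvar_def split: if_splits)
  then have "lookup 0 v = lookup (single v (1 :: nat) + b) v"
    by (rule arg_cong)
  then show False by (simp add: lookup_add)
qed

context ranked_complex
begin

text \<open>
  The signs of the Koszul complex depend on \<open>F = \<sigma> - G\<close> rather than on \<open>G\<close>; the product of the
  signs below translates between the two conventions.
\<close>

definition twist :: "'v set \<Rightarrow> 'v set \<Rightarrow> 'r::comm_ring_1" where
  "twist \<sigma> G = (\<Prod>v\<in>G. vsign r v (\<sigma> - {v}))"

lemma twist_square [simp]: "twist \<sigma> G * twist \<sigma> G = 1"
  unfolding twist_def prod.distrib[symmetric] by simp

lemma twist_square_left [simp]: "twist \<sigma> G * (twist \<sigma> G * a) = a"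
  by (simp flip: mult.assoc)

text \<open>The sign of \<open>v\<close> in \<open>\<sigma> - {v}\<close> is the product of its
  signs in \<open>\<sigma> - G\<close> and in \<open>G - {v}\<close>, so the factor that
  \<open>twist\<close> gains with \<open>v\<close> exchanges one sign for the other. The outer minus
  is that of the moves from \<open>F\<close> to \<open>G\<close>.\<close>

lemma coboundary_twist:
  assumes \<sigma>: "\<sigma> \<subseteq> V" and G: "G \<subseteq> \<sigma>" "G \<in> \<Delta>"
  shows "coboundary r (\<lambda>G. twist \<sigma> G * c (\<sigma> - G, G)) G =
    - (twist \<sigma> G * koszul V r \<Delta> (\<lambda>_. 0) c (\<sigma> - G, G))"
proof -
  have fin: "finite \<sigma>" "finite G" using \<sigma> G finite_V by (auto intro: finite_subset)
  have "koszul V r \<Delta> (\<lambda>_. 0) c (\<sigma> - G, G) =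
    (\<Sum>v\<in>V - (\<sigma> - G). vsign r v (\<sigma> - G) * (if v \<in> G then - c (insert v (\<sigma> - G), G - {v}) else 0))"
  proof -
    have "\<sigma> - G \<subseteq> V \<and> G \<subseteq> V \<and> (\<sigma> - G) \<inter> G = {} \<and> G \<in> \<Delta>" using \<sigma> G by auto
    then show ?thesis by (simp add: koszul_def cong: if_cong)
  qed
  also have "\<dots> = (\<Sum>v\<in>G. vsign r v (\<sigma> - G) * (if v \<in> G then - c (insert v (\<sigma> - G), G - {v}) else 0))"
    using \<sigma> G finite_V by (intro sum.mono_neutral_right) auto
  finally have "- (twist \<sigma> G * koszul V r \<Delta> (\<lambda>_. 0) c (\<sigma> - G, G)) =
    (\<Sum>v\<in>G. twist \<sigma> G * (vsign r v (\<sigma> - G) * c (insert v (\<sigma> - G), G - {v})))"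
    by (simp add: sum_negf sum_distrib_left)
  also have "\<dots> = (\<Sum>v\<in>G. vsign r v (G - {v}) * (twist \<sigma> (G - {v}) * c (\<sigma> - (G - {v}), G - {v})))"
  proof (intro sum.cong refl)
    fix v assume v: "v \<in> G"
    have "\<sigma> - {v} = (\<sigma> - G) \<union> (G - {v})" using G v by blast
    then have "vsign r v (\<sigma> - {v}) = vsign r v (\<sigma> - G) * (vsign r v (G - {v}) :: 'a)"
      using fin by (simp only:) (rule vsign_union, auto)
    moreover have "twist \<sigma> G = vsign r v (\<sigma> - {v}) * (twist \<sigma> (G - {v}) :: 'a)"
      unfolding twist_def using prod.remove[OF fin(2) v] .
    moreover have "insert v (\<sigma> - G) = \<sigma> - (G - {v})" using G v by blast
    ultimately show "twist \<sigma> G * (vsign r v (\<sigma> - G) * c (insert v (\<sigma> - G), G - {v})) =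
      vsign r v (G - {v}) * (twist \<sigma> (G - {v}) * c (\<sigma> - (G - {v}), G - {v}))"
      by (simp add: mult_ac)
  qed
  finally show ?thesis by (simp add: coboundary_def)
qed

text \<open>A cocycle on \<open>\<sigma>\<close> becomes a constant vector \<open>?c\<close> on the
  cells with union \<open>\<sigma>\<close>, whose differential involves only multiples of variables.
  The contraction is linear over the polynomial ring and preserves this, so the constant terms of
  the homotopy identity exhibit the cocycle as a coboundary.\<close>

theorem acyclic_at_of_proj_dim_le:
  assumes empty: "{} \<in> \<Delta>"
    and pd: "proj_dim (poly_ring V) (quot_module (poly_ring V) (sr_ideal V \<Delta> :: ('v, 'k::field) mvpoly set)) \<le> enat n"
    and \<sigma>: "\<sigma> \<subseteq> V" and j: "n + j < card \<sigma>"
  shows "acyclic_at TYPE('k) r \<Delta> \<sigma> j"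
  unfolding acyclic_at_def
proof (intro allI impI)
  fix \<phi> :: "'v set \<Rightarrow> 'k"
  assume \<phi>: "\<forall>G\<in>\<Delta>. G \<subseteq> \<sigma> \<and> card G = Suc j \<longrightarrow> coboundary r \<phi> G = 0"
  let ?R = "poly_ring V :: ('v, 'k) mvpoly ring"
  let ?d = "koszul V r \<Delta> (mvar :: 'v \<Rightarrow> ('v, 'k) mvpoly)"
  let ?D = "koszul V r \<Delta> (\<lambda>_. 0 :: 'k)"
  have fin: "finite \<sigma>" using \<sigma> finite_V by (rule finite_subset)
  \<comment> \<open>For a face of cardinality \<open>j\<close> the cell
    \<open>(\<sigma> - G, G)\<close> has homological degree
    \<open>card \<sigma> - j = Suc k\<close>, and the hypothesis on \<open>j\<close> gives
    \<open>n \<le> k\<close>, the range of the contraction.\<close>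
  define k where "k = card \<sigma> - j - 1"
  have k: "n \<le> k" "card \<sigma> = Suc k + j" using j by (simp_all add: k_def)
  \<comment> \<open>A coset is determined by a chosen representative, here taken as a constant
    sequence.\<close>
  have emb: "\<exists>i :: ('v, 'k) mvpoly set \<Rightarrow> nat \<Rightarrow> ('v, 'k) mvpoly.
    inj_on i (carrier (quot_module ?R (sr_ideal V \<Delta>)))"
  proof -
    interpret I: ideal "sr_ideal V \<Delta>" ?R by (rule ideal_sr_ideal)
    let ?i = "\<lambda>(C :: ('v, 'k) mvpoly set) (_ :: nat). SOME p. p \<in> C"
    have coset: "C = sr_ideal V \<Delta> +>\<^bsub>?R\<^esub> ?i C 0" if "C \<in> carrier (quot_module ?R (sr_ideal V \<Delta>))" for C
    proof -
      from that obtain a where a: "a \<in> polys V" "C = sr_ideal V \<Delta> +>\<^bsub>?R\<^esub> a"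
        by (auto simp: quot_module_def FactRing_def A_RCOSETS_def')
      then have "a \<in> C" using I.a_rcos_self by blast
      then have "?i C 0 \<in> C" by (rule someI)
      then show ?thesis using I.a_repr_independence'[of "?i C 0" a] a by simp
    qed
    have "inj_on ?i (carrier (quot_module ?R (sr_ideal V \<Delta>)))"
    proof (rule inj_onI)
      fix C D assume CD: "C \<in> carrier (quot_module ?R (sr_ideal V \<Delta>))"
        "D \<in> carrier (quot_module ?R (sr_ideal V \<Delta>))" and "?i C = ?i D"
      then have "?i C 0 = ?i D 0" by (rule_tac fun_cong)
      then show "C = D" using coset[OF CD(1)] coset[OF CD(2)] by (simp only:)
    qed
    then show ?thesis by (rule exI[of _ ?i])
  qed
  then obtain i :: "('v, 'k) mvpoly set \<Rightarrow> nat \<Rightarrow> ('v, 'k) mvpoly"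
    where i: "inj_on i (carrier (quot_module ?R (sr_ideal V \<Delta>)))" by blast
  have ex: "\<exists>s. (\<forall>l. s l \<in> linear_maps ?R (free_cells l) (free_cells (Suc l))) \<and>
      (\<forall>l c. n \<le> l \<longrightarrow> c \<in> carrier (free_cells (Suc l)) \<longrightarrow>
        c = ?d (s (Suc l) c) \<oplus>\<^bsub>free_cells (Suc l)\<^esub> s l (?d c))"
    using ex_contraction_above_proj_dim[OF cring_poly_ring module_quot_module[OF cring_poly_ring ideal_sr_ideal]
      i finite_cells[OF finite_V] resolution_koszul[OF empty] pd] by metis
  then obtain s where s: "\<And>l. s l \<in> linear_maps ?R (free_cells l) (free_cells (Suc l))"
    and sd: "\<And>l c. n \<le> l \<Longrightarrow> c \<in> carrier (free_cells (Suc l)) \<Longrightarrow>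
        c = ?d (s (Suc l) c) \<oplus>\<^bsub>free_cells (Suc l)\<^esub> s l (?d c)" by blast
  define c0 where "c0 = (\<lambda>(F, G). if (F, G) \<in> cells V \<Delta> (Suc k) \<and> F \<union> G = \<sigma> then twist \<sigma> G * \<phi> G else 0)"
  have c0_face: "c0 (\<sigma> - G, G) = twist \<sigma> G * \<phi> G" if "G \<in> \<Delta>" "G \<subseteq> \<sigma>" "card G = j" for G
    using that \<sigma> fin k by (auto simp: c0_def cells_def card_Diff_subset finite_subset)
  have d0c0: "?D c0 = (\<lambda>_. 0)"
  proof (intro ext)
    fix p
    show "?D c0 p = 0"
    proof (cases "p \<in> cells V \<Delta> k")
      case False
      then show ?thesis
        by (intro koszul_supp[OF finite_V]) (auto simp: c0_def)
    next
      case True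
      then obtain F G where p: "p = (F, G)" and FG: "(F, G) \<in> cells V \<Delta> k"
        "F \<subseteq> V" "G \<subseteq> V" "F \<inter> G = {}" "G \<in> \<Delta>" "card F = k" by (auto simp: cells_def)
      show ?thesis
      proof (cases "F \<union> G = \<sigma>")
        case False
        have "c0 (insert v F, G - {v}) = 0" if "v \<in> G" for v
        proof -
          have "insert v F \<union> (G - {v}) \<noteq> \<sigma>" using False that by blast
          then show ?thesis by (simp only: c0_def split simp_thms if_False)
        qed
        then show ?thesis unfolding p koszul_cells[OF FG(1)] by (intro sum.neutral) auto
      next
        case True
        then have F: "F = \<sigma> - G" "G \<subseteq> \<sigma>" using FG by auto
        have finG: "finite G" using F(2) fin by (rule finite_subset)
        have cG: "card G = Suc j"
          using card_Un_disjoint[of F G] FG True k finG fin F by (auto simp: finite_subset)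
        have "coboundary r (\<lambda>G. twist \<sigma> G * c0 (\<sigma> - G, G)) G = coboundary r \<phi> G"
        proof (rule coboundary_cong)
          fix v assume v: "v \<in> G"
          then have "c0 (\<sigma> - (G - {v}), G - {v}) = twist \<sigma> (G - {v}) * \<phi> (G - {v})"
            using down[of G "G - {v}"] FG F cG finG by (intro c0_face) auto
          then show "twist \<sigma> (G - {v}) * c0 (\<sigma> - (G - {v}), G - {v}) = \<phi> (G - {v})" by simp
        qed
        also have "\<dots> = 0" using \<phi> FG F cG by blast
        finally have "twist \<sigma> G * ?D c0 (\<sigma> - G, G) = 0"
          using coboundary_twist[OF \<sigma> F(2) FG(5), of c0] by simp
        then have "twist \<sigma> G * (twist \<sigma> G * ?D c0 (\<sigma> - G, G)) = twist \<sigma> G * 0" by (simp only:)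
        then show ?thesis by (simp add: p F(1))
      qed
    qed
  qed
  let ?c = "\<lambda>p. single 0 (c0 p) :: ('v, 'k) mvpoly"
  have c: "?c \<in> carrier (free_cells (Suc k))"
    unfolding free_cells_iff by (auto simp: c0_def)
  have d0c: "koszul V r \<Delta> (\<lambda>_. 0) ?c p = 0" for p
  proof (rule poly_mapping_eqI)
    fix m
    have "(\<lambda>q. lookup (?c q) m) = (\<lambda>q. (if m = 0 then 1 else 0) * c0 q)"
      by (auto simp: lookup_single when_def)
    then show "lookup (koszul V r \<Delta> (\<lambda>_. 0) ?c p) m = lookup 0 m"
      by (simp only: lookup_koszul_zero koszul_scale d0c0) simp
  qed
  \<comment> \<open>The vector that multiplies the variable \<open>v\<close> in
    \<open>?d ?c\<close>; the constant part of \<open>?d ?c\<close> is zero by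
    \<open>d0c\<close>.\<close>
  define w where "w v p = (if fst p \<subseteq> V \<and> snd p \<subseteq> V \<and> fst p \<inter> snd p = {} \<and> snd p \<in> \<Delta> \<and> v \<notin> fst p \<and> v \<notin> snd p
      then vsign r v (fst p) * ?c (insert v (fst p), snd p) else 0)" for v p
  have w: "w v \<in> carrier (free_cells k)" if "v \<in> V" for v
    unfolding free_cells_iff
  proof (intro conjI allI impI)
    show "w v p \<in> polys V" for p using free_cellsD(1)[OF c] by (simp add: w_def)
    fix p assume p: "p \<notin> cells V \<Delta> k"
    show "w v p = 0"
    proof (cases "fst p \<subseteq> V \<and> v \<notin> fst p")
      case True
      then have "finite (fst p)" using finite_V by (auto intro: finite_subset)
      then show ?thesis using p True by (cases p) (auto simp: w_def c0_def cells_def)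
    qed (auto simp: w_def)
  qed
  have dc: "?d ?c = (\<lambda>p. \<Sum>v\<in>V. mvar v * w v p)"
    by (intro ext) (simp only: koszul_split[OF finite_V, of r \<Delta> mvar] d0c w_def add_0_left)
  have "s k (\<lambda>p. \<Sum>v\<in>W. mvar v * w v p) p = (\<Sum>v\<in>W. mvar v * s k (w v) p) \<and>
    (\<lambda>p. \<Sum>v\<in>W. mvar v * w v p) \<in> carrier (free_cells k)" if "W \<subseteq> V" for W p
    using finite_subset[OF that finite_V] that
  proof (induction W arbitrary: p rule: finite_induct)
    case empty
    have "s k (\<lambda>p. 0) = (\<lambda>p. 0)"
      using linear_maps_zero[OF module_free_mod module_free_mod s, OF cring_poly_ring cring_poly_ring] by simp
    then show ?case by (simp add: free_cells_iff del: free_mod_simps(1))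
  next
    case (insert v W)
    have v: "v \<in> V" and W: "W \<subseteq> V" using insert.prems by auto
    interpret M: Module.module ?R "free_cells k" by (rule module_free_mod[OF cring_poly_ring])
    have 1: "(\<lambda>p. mvar v * w v p) \<in> carrier (free_cells k)"
      using M.smult_closed[of "mvar v" "w v", OF polys_mvar[OF v] w[OF v]] by (simp only: free_mod_simps(4) poly_ring_simps)
    have 2: "(\<lambda>p. \<Sum>v\<in>W. mvar v * w v p) \<in> carrier (free_cells k)" using insert.IH[OF W] by blast
    have "s k (\<lambda>p. mvar v * w v p + (\<Sum>v\<in>W. mvar v * w v p)) p =
        s k (\<lambda>p. mvar v * w v p) p + s k (\<lambda>p. \<Sum>v\<in>W. mvar v * w v p) p"
      using linear_maps_add[OF s 1 2] by (simp only: free_mod_simps(3) poly_ring_simps)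
    also have "s k (\<lambda>p. mvar v * w v p) = (\<lambda>p. mvar v * s k (w v) p)"
      using linear_maps_smult[OF s polys_mvar[OF v] w[OF v]] by (simp only: free_mod_simps(4) poly_ring_simps)
    finally have "s k (\<lambda>p. mvar v * w v p + (\<Sum>v\<in>W. mvar v * w v p)) p =
        mvar v * s k (w v) p + (\<Sum>v\<in>W. mvar v * s k (w v) p)"
      using insert.IH[OF W] by (simp only:)
    moreover have "(\<lambda>p. mvar v * w v p + (\<Sum>v\<in>W. mvar v * w v p)) \<in> carrier (free_cells k)"
      using M.M.a_closed[OF 1 2] by (simp only: free_mod_simps(3) poly_ring_simps)
    ultimately show ?case using insert.hyps by (simp only: sum.insert simp_thms)
  qed
  then have "s k (?d ?c) p = (\<Sum>v\<in>V. mvar v * s k (w v) p)" for p unfolding dc by blast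
  then have sdc: "lookup (s k (?d ?c) p) 0 = 0" for p
    by (simp add: lookup_sum' lookup_mvar_mult_zero)
  \<comment> \<open>Constant terms of the contraction applied to \<open>?c\<close>; the other
    summand of the homotopy identity has none by \<open>sdc\<close>.\<close>
  define b where "b = (\<lambda>q. lookup (s (Suc k) ?c q) 0)"
  have c0b: "c0 p = ?D b p" for p
  proof -
    have "?c p = ?d (s (Suc k) ?c) p + s k (?d ?c) p"
      using fun_cong[OF sd[OF k(1) c], of p] by (simp only: free_mod_simps(3) poly_ring_simps)
    then have "lookup (?c p) 0 = lookup (?d (s (Suc k) ?c) p) 0"
      using sdc by (simp add: lookup_add)
    also have "\<dots> = ?D b p"
      unfolding koszul_split[OF finite_V, of r \<Delta> mvar] b_def
      by (simp add: lookup_add lookup_koszul_zero lookup_sum' lookup_mvar_mult_zero)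
    finally show ?thesis by simp
  qed
  show "\<exists>\<psi>. \<forall>G\<in>\<Delta>. G \<subseteq> \<sigma> \<and> card G = j \<longrightarrow> \<phi> G = coboundary r \<psi> G"
  proof (intro exI ballI impI, elim conjE)
    fix G assume G: "G \<in> \<Delta>" "G \<subseteq> \<sigma>" "card G = j"
    have "coboundary r (\<lambda>G. - (twist \<sigma> G * b (\<sigma> - G, G))) G = twist \<sigma> G * c0 (\<sigma> - G, G)"
      unfolding coboundary_uminus coboundary_twist[OF \<sigma> G(2,1)] c0b by simp
    also have "\<dots> = \<phi> G" using c0_face[OF G] by simp
    finally show "\<phi> G = coboundary r (\<lambda>G. - (twist \<sigma> G * b (\<sigma> - G, G))) G" by simp
  qed
qed

end

section \<open>From acyclic induced subcomplexes to a bound on the projective dimension\<close>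

lemma lookup_const_mult:
  "lookup (single 0 x * f) m = x * lookup f m"
  for f :: "('v, 'k::field) mvpoly"
  by (simp add: lookup_mult lookup_single when_mult)

text \<open>Over a field a linear map has a linear section on the image of a subspace. Linearity is
  essential here: the section becomes a matrix, which can then act on vectors of
  polynomials.\<close>

lemma ex_linear_right_inverse:
  fixes D :: "('b \<Rightarrow> 'k::field) \<Rightarrow> ('b \<Rightarrow> 'k)"
  assumes D: "\<And>a b. D (\<lambda>p. a p + b p) = (\<lambda>p. D a p + D b p)" "\<And>x a. D (\<lambda>p. x * a p) = (\<lambda>p. x * D a p)"
  shows "\<exists>K. (\<forall>a b. K (\<lambda>p. a p + b p) = (\<lambda>p. K a p + K b p)) \<and>
    (\<forall>x a. K (\<lambda>p. x * a p) = (\<lambda>p. x * K a p)) \<and>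
    (\<forall>a. \<forall>p. p \<notin> A \<longrightarrow> K a p = 0) \<and>
    (\<forall>a. (\<forall>p. p \<notin> A \<longrightarrow> a p = 0) \<longrightarrow> D (K (D a)) = D a)"
proof -
  let ?s = "\<lambda>(x :: 'k) (a :: 'b \<Rightarrow> 'k) p. x * a p"
  interpret vector_space ?s
    by unfold_locales (simp_all add: fun_eq_iff algebra_simps)
  interpret vector_space_pair ?s ?s ..
  have lin: "Vector_Spaces.linear ?s ?s D"
    unfolding Vector_Spaces.linear_iff using D by (auto simp: plus_fun_def vector_space_axioms)
  have sub: "subspace {a. \<forall>p. p \<notin> A \<longrightarrow> a p = 0}"
    by (simp add: subspace_def)
  obtain K where K: "range K \<subseteq> {a. \<forall>p. p \<notin> A \<longrightarrow> a p = 0}" "Vector_Spaces.linear ?s ?s K"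
    "\<forall>a\<in>D ` {a. \<forall>p. p \<notin> A \<longrightarrow> a p = 0}. D (K a) = a"
    using linear_exists_right_inverse_on[OF lin sub] by blast
  have "K (\<lambda>p. a p + b p) = (\<lambda>p. K a p + K b p)" for a b
    using K(2) unfolding Vector_Spaces.linear_iff by (simp add: plus_fun_def)
  moreover have "K (\<lambda>p. x * a p) = (\<lambda>p. x * K a p)" for x a
    using K(2) unfolding Vector_Spaces.linear_iff by simp
  ultimately show ?thesis using K(1,3) by (intro exI[of _ K]) blast
qed

lemma linear_expansion:
  fixes K :: "('b \<Rightarrow> 'k::field) \<Rightarrow> ('b \<Rightarrow> 'k)"
  assumes add: "\<And>a b. K (\<lambda>p. a p + b p) = (\<lambda>p. K a p + K b p)"
    and scale: "\<And>x a. K (\<lambda>p. x * a p) = (\<lambda>p. x * K a p)"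
    and "finite A" and "\<And>p. p \<notin> A \<Longrightarrow> a p = 0"
  shows "K a p = (\<Sum>q\<in>A. a q * K (\<lambda>q'. if q' = q then 1 else 0) p)"
  using assms(3,4)
proof (induction A arbitrary: a p rule: finite_induct)
  case empty
  then have "a = (\<lambda>p. 0 * a p)" by auto
  then have "K a = (\<lambda>p. 0 * K a p)" using scale[of 0 a] by simp
  then show ?case by simp
next
  case (insert x A)
  let ?e = "\<lambda>q. if q = x then 1 else 0" and ?a = "\<lambda>p. if p = x then 0 else a p"
  have "a = (\<lambda>p. ?a p + a x * ?e p)" by auto
  then have "K a p = K ?a p + a x * K ?e p" using add[of ?a "\<lambda>p. a x * ?e p"] by (simp add: scale)
  also have "K ?a p = (\<Sum>q\<in>A. ?a q * K (\<lambda>q'. if q' = q then 1 else 0) p)"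
    using insert.prems by (intro insert.IH) auto
  also have "\<dots> = (\<Sum>q\<in>A. a q * K (\<lambda>q'. if q' = q then 1 else 0) p)"
    using insert.hyps by (intro sum.cong) auto
  finally show ?case using insert.hyps by (simp add: add.commute)
qed

abbreviation cell_verts :: "'v set \<times> 'v set \<Rightarrow> 'v set" where
  "cell_verts p \<equiv> fst p \<union> snd p"

text \<open>With \<open>e = 0\<close> only the moves of a vertex between \<open>F\<close> and
  \<open>G\<close> remain, and they keep the union.\<close>

lemma koszul_zero_local:
  assumes "\<And>q. cell_verts q = cell_verts p \<Longrightarrow> a q = b q"
  shows "koszul V r \<Delta> (\<lambda>_. 0) a p = koszul V r \<Delta> (\<lambda>_. 0) b p"
proof (cases p)
  case (Pair F G)
  have "a (insert v F, G - {v}) = b (insert v F, G - {v})" if "v \<in> G" for v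
    using that by (intro assms) (auto simp: Pair)
  then show ?thesis by (auto simp: Pair koszul_def intro!: sum.cong)
qed

text \<open>Extension of scalars of a linear map from the field to the polynomial ring.\<close>

definition const_matrix ::
  "('b \<Rightarrow> 'b \<Rightarrow> 'k) \<Rightarrow> 'b set \<Rightarrow> ('b \<Rightarrow> ('v, 'k::field) mvpoly) \<Rightarrow> 'b \<Rightarrow> ('v, 'k) mvpoly" where
  "const_matrix M A c p = (\<Sum>q\<in>A. single 0 (M p q) * c q)"

lemma lookup_const_matrix:
  "lookup (const_matrix M A c p) m = (\<Sum>q\<in>A. M p q * lookup (c q) m)"
  by (simp add: const_matrix_def lookup_sum' lookup_const_mult)

lemma const_matrix_add: "const_matrix M A (\<lambda>p. a p + b p) = (\<lambda>p. const_matrix M A a p + const_matrix M A b p)"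
  by (simp add: const_matrix_def fun_eq_iff algebra_simps sum.distrib)

lemma const_matrix_scale: "const_matrix M A (\<lambda>p. x * a p) = (\<lambda>p. x * const_matrix M A a p)"
  by (simp add: const_matrix_def fun_eq_iff algebra_simps sum_distrib_left)

context ranked_complex
begin

text \<open>With \<open>e = 0\<close> the complex decomposes by the union \<open>\<sigma>\<close> of
  the cells. After the sign change by \<open>twist\<close> each summand is the cochain complex on
  \<open>\<sigma>\<close>, where acyclicity gives a primitive; \<open>b\<close> glues these
  primitives.\<close>

lemma koszul_zero_exact:
  fixes c :: "'v set \<times> 'v set \<Rightarrow> 'k::field"
  assumes acyc: "\<And>\<sigma> j. \<sigma> \<subseteq> V \<Longrightarrow> card \<sigma> = i + j \<Longrightarrow> acyclic_at TYPE('k) r \<Delta> \<sigma> j"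
    and c: "\<And>p. p \<notin> cells V \<Delta> i \<Longrightarrow> c p = 0"
    and cyc: "koszul V r \<Delta> (\<lambda>_. 0) c = (\<lambda>_. 0)"
  shows "\<exists>b. (\<forall>p. p \<notin> cells V \<Delta> (Suc i) \<longrightarrow> b p = 0) \<and> koszul V r \<Delta> (\<lambda>_. 0) b = c"
proof -
  let ?D = "koszul V r \<Delta> (\<lambda>_. 0 :: 'k)"
  have "\<exists>\<psi>. \<forall>G\<in>\<Delta>. G \<subseteq> \<sigma> \<and> card \<sigma> = i + card G \<longrightarrow> twist \<sigma> G * c (\<sigma> - G, G) = coboundary r \<psi> G"
    if \<sigma>: "\<sigma> \<subseteq> V" for \<sigma>
  proof (cases "i \<le> card \<sigma>")
    case True
    then obtain j where j: "card \<sigma> = i + j" by (auto simp: le_iff_add)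
    have "coboundary r (\<lambda>G. twist \<sigma> G * c (\<sigma> - G, G)) G = 0" if "G \<in> \<Delta>" "G \<subseteq> \<sigma>" for G
      using coboundary_twist[OF \<sigma> that(2,1), of c] by (simp add: cyc)
    then have "\<exists>\<psi>. \<forall>G\<in>\<Delta>. G \<subseteq> \<sigma> \<and> card G = j \<longrightarrow> twist \<sigma> G * c (\<sigma> - G, G) = coboundary r \<psi> G"
      using acyc[OF \<sigma> j] unfolding acyclic_at_def by blast
    then show ?thesis using j by (simp add: eq_commute[of j])
  qed auto
  then obtain \<psi> where \<psi>: "\<And>\<sigma> G. \<sigma> \<subseteq> V \<Longrightarrow> G \<in> \<Delta> \<Longrightarrow> G \<subseteq> \<sigma> \<Longrightarrow> card \<sigma> = i + card G \<Longrightarrow>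
    twist \<sigma> G * c (\<sigma> - G, G) = coboundary r (\<psi> \<sigma>) G" by metis
  define b where "b = (\<lambda>(F, G). if (F, G) \<in> cells V \<Delta> (Suc i) then - (twist (F \<union> G) G * \<psi> (F \<union> G) G) else 0)"
  have b: "b p = 0" if "p \<notin> cells V \<Delta> (Suc i)" for p
    using that by (cases p) (simp add: b_def)
  have "?D b p = c p" for p
  proof (cases "p \<in> cells V \<Delta> i")
    case True
    then obtain F G where p: "p = (F, G)" "F \<subseteq> V" "G \<subseteq> V" "F \<inter> G = {}" "G \<in> \<Delta>" "card F = i"
      by (auto simp: cells_def)
    define \<sigma> where "\<sigma> = F \<union> G"
    have \<sigma>: "\<sigma> \<subseteq> V" "G \<subseteq> \<sigma>" "F = \<sigma> - G" using p by (auto simp: \<sigma>_def)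
    have fin: "finite F" "finite G" using p finite_V by (auto intro: finite_subset)
    have card: "card \<sigma> = i + card G" using p fin by (simp add: \<sigma>_def card_Un_disjoint)
    have "- (twist \<sigma> G * ?D b (\<sigma> - G, G)) = coboundary r (\<lambda>G. twist \<sigma> G * b (\<sigma> - G, G)) G"
      by (rule coboundary_twist[OF \<sigma>(1,2) p(5), symmetric])
    also have "\<dots> = coboundary r (\<lambda>G. - \<psi> \<sigma> G) G"
    proof (rule coboundary_cong)
      fix v assume v: "v \<in> G"
      have eq: "\<sigma> - (G - {v}) = insert v F" "(\<sigma> - (G - {v})) \<union> (G - {v}) = \<sigma>"
        using v \<sigma> by auto
      have vF: "v \<notin> F" using v p by auto
      have "G - {v} \<in> \<Delta>" using down[OF p(5)] by blast
      then have "(\<sigma> - (G - {v}), G - {v}) \<in> cells V \<Delta> (Suc i)"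
        using v p fin card_insert_disjoint[OF fin(1) vF] unfolding eq cells_def by auto
      then show "twist \<sigma> (G - {v}) * b (\<sigma> - (G - {v}), G - {v}) = - \<psi> \<sigma> (G - {v})"
        by (simp only: b_def split if_True eq(2)) simp
    qed
    also have "\<dots> = - (twist \<sigma> G * c (\<sigma> - G, G))"
      unfolding coboundary_uminus \<psi>[OF \<sigma>(1) p(5) \<sigma>(2) card] ..
    finally have "twist \<sigma> G * ?D b (\<sigma> - G, G) = twist \<sigma> G * c (\<sigma> - G, G)"
      by (simp only: neg_equal_iff_equal)
    from arg_cong[OF this, of "\<lambda>x. twist \<sigma> G * x"] show ?thesis
      by (simp only: twist_square_left p(1) \<sigma>(3))
  next
    case False
    then show ?thesis using koszul_supp[OF finite_V b] c by simp
  qed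
  with b show ?thesis by blast
qed

text \<open>A contraction in the single degree \<open>n + 1\<close> of the complex without
  variables. The condition that the matrices preserve \<open>cell_verts\<close> is what makes the
  later correction process stop.\<close>

lemma ex_const_contraction:
  assumes acyc: "\<And>\<sigma> j. \<sigma> \<subseteq> V \<Longrightarrow> card \<sigma> = Suc n + j \<Longrightarrow> acyclic_at TYPE('k::field) r \<Delta> \<sigma> j"
  shows "\<exists>M0 M1 :: 'v set \<times> 'v set \<Rightarrow> 'v set \<times> 'v set \<Rightarrow> 'k.
    (\<forall>p q. M0 p q \<noteq> 0 \<longrightarrow> p \<in> cells V \<Delta> (Suc n) \<and> cell_verts p = cell_verts q) \<and>
    (\<forall>p q. M1 p q \<noteq> 0 \<longrightarrow> p \<in> cells V \<Delta> (Suc (Suc n)) \<and> cell_verts p = cell_verts q) \<and>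
    (\<forall>c\<in>carrier (free_cells (Suc n)). \<forall>p. c p =
      koszul V r \<Delta> (\<lambda>_. 0) (const_matrix M1 (cells V \<Delta> (Suc n)) c) p +
      const_matrix M0 (cells V \<Delta> n) (koszul V r \<Delta> (\<lambda>_. 0) c) p)"
proof -
  let ?D = "koszul V r \<Delta> (\<lambda>_. 0 :: 'k)"
  obtain K0 where K0':
    "(\<forall>a b. K0 (\<lambda>p. a p + b p) = (\<lambda>p. K0 a p + K0 b p)) \<and>
    (\<forall>x a. K0 (\<lambda>p. x * a p) = (\<lambda>p. x * K0 a p)) \<and>
    (\<forall>a. \<forall>p. p \<notin> cells V \<Delta> (Suc n) \<longrightarrow> K0 a p = 0) \<and>
    (\<forall>a. (\<forall>p. p \<notin> cells V \<Delta> (Suc n) \<longrightarrow> a p = 0) \<longrightarrow> ?D (K0 (?D a)) = ?D a)"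
    using ex_linear_right_inverse[of ?D "cells V \<Delta> (Suc n)", OF koszul_add koszul_scale] by (rule exE)
  note K0 = K0'[THEN conjunct1, rule_format] K0'[THEN conjunct2, THEN conjunct1, rule_format]
    K0'[THEN conjunct2, THEN conjunct2, THEN conjunct1, rule_format]
    K0'[THEN conjunct2, THEN conjunct2, THEN conjunct2, rule_format]
  obtain K2 where K2':
    "(\<forall>a b. K2 (\<lambda>p. a p + b p) = (\<lambda>p. K2 a p + K2 b p)) \<and>
    (\<forall>x a. K2 (\<lambda>p. x * a p) = (\<lambda>p. x * K2 a p)) \<and>
    (\<forall>a. \<forall>p. p \<notin> cells V \<Delta> (Suc (Suc n)) \<longrightarrow> K2 a p = 0) \<and>
    (\<forall>a. (\<forall>p. p \<notin> cells V \<Delta> (Suc (Suc n)) \<longrightarrow> a p = 0) \<longrightarrow> ?D (K2 (?D a)) = ?D a)"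
    using ex_linear_right_inverse[of ?D "cells V \<Delta> (Suc (Suc n))", OF koszul_add koszul_scale] by (rule exE)
  note K2 = K2'[THEN conjunct1, rule_format] K2'[THEN conjunct2, THEN conjunct1, rule_format]
    K2'[THEN conjunct2, THEN conjunct2, THEN conjunct1, rule_format]
    K2'[THEN conjunct2, THEN conjunct2, THEN conjunct2, rule_format]
  \<comment> \<open>\<open>a - K0 (D a)\<close> is a cycle because \<open>K0\<close> is a section of
    \<open>D\<close>, hence a boundary by acyclicity; \<open>K2\<close> picks a preimage
    linearly.\<close>
  define K1 where "K1 a = K2 (\<lambda>p. a p + - 1 * K0 (?D a) p)" for a
  have K1_add: "K1 (\<lambda>p. a p + b p) = (\<lambda>p. K1 a p + K1 b p)" for a b
  proof -
    have "(\<lambda>p. (a p + b p) + - 1 * (K0 (?D a) p + K0 (?D b) p)) =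
      (\<lambda>p. (a p + - 1 * K0 (?D a) p) + (b p + - 1 * K0 (?D b) p))" by (simp add: algebra_simps)
    then show ?thesis unfolding K1_def koszul_add K0(1) by (simp only: K2(1))
  qed
  have K1_scale: "K1 (\<lambda>p. x * a p) = (\<lambda>p. x * K1 a p)" for x a
  proof -
    have "(\<lambda>p. x * a p + - 1 * (x * K0 (?D a) p)) = (\<lambda>p. x * (a p + - 1 * K0 (?D a) p))"
      by (simp add: algebra_simps)
    then show ?thesis unfolding K1_def koszul_scale K0(2) by (simp only: K2(2))
  qed
  have contr: "a p = ?D (K1 a) p + K0 (?D a) p" if a: "\<And>p. p \<notin> cells V \<Delta> (Suc n) \<Longrightarrow> a p = 0" for a p
  proof -
    let ?a = "\<lambda>p. a p + - 1 * K0 (?D a) p"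
    have "\<exists>b. (\<forall>p. p \<notin> cells V \<Delta> (Suc (Suc n)) \<longrightarrow> b p = 0) \<and> ?D b = ?a"
    proof (rule koszul_zero_exact[OF acyc])
      show "?a p = 0" if "p \<notin> cells V \<Delta> (Suc n)" for p using a[OF that] K0(3)[OF that] by simp
      have "?D (K0 (?D a)) = ?D a" by (rule K0(4)) (rule a)
      then show "?D ?a = (\<lambda>_. 0)" by (simp only: koszul_add koszul_scale) simp
    qed
    then obtain b where b: "\<And>p. p \<notin> cells V \<Delta> (Suc (Suc n)) \<Longrightarrow> b p = 0" "?D b = ?a" by blast
    have "?D (K1 a) = ?a" unfolding K1_def b(2)[symmetric] by (rule K2(4)[OF b(1)])
    then show ?thesis by simp
  qed
  define E :: "'v set \<times> 'v set \<Rightarrow> 'v set \<times> 'v set \<Rightarrow> 'k" where "E q = (\<lambda>q'. if q' = q then 1 else 0)" for q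
  \<comment> \<open>The sections need not respect unions, so entries between cells with different
    unions are discarded. The contraction identity survives because \<open>D\<close> itself respects
    unions.\<close>
  define M0 where "M0 p q = (if cell_verts p = cell_verts q then K0 (E q) p else 0)" for p q
  define M1 where "M1 p q = (if cell_verts p = cell_verts q then K1 (E q) p else 0)" for p q
  have entry: "(\<Sum>q\<in>A. (if cell_verts p = cell_verts q then K (E q) p else 0) * a q) =
      K (\<lambda>q. if cell_verts q = cell_verts p then a q else 0) p"
    if K: "\<And>a b. K (\<lambda>p. a p + b p) = (\<lambda>p. K a p + K b p)" "\<And>x a. K (\<lambda>p. x * a p) = (\<lambda>p. x * K a p)"
      and A: "finite A" "\<And>q. q \<notin> A \<Longrightarrow> a q = 0" for K a A and p :: "'v set \<times> 'v set"
  proof -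
    have "K (\<lambda>q. if cell_verts q = cell_verts p then a q else 0) p =
      (\<Sum>q\<in>A. (if cell_verts q = cell_verts p then a q else 0) * K (\<lambda>q'. if q' = q then 1 else 0) p)"
      using A by (intro linear_expansion K) auto
    also have "\<dots> = (\<Sum>q\<in>A. (if cell_verts p = cell_verts q then K (E q) p else 0) * a q)"
      by (intro sum.cong) (auto simp: E_def)
    finally show ?thesis by simp
  qed
  note fin = finite_cells[OF finite_V, of \<Delta>]
  have "c p = koszul V r \<Delta> (\<lambda>_. 0) (const_matrix M1 (cells V \<Delta> (Suc n)) c) p +
      const_matrix M0 (cells V \<Delta> n) (koszul V r \<Delta> (\<lambda>_. 0) c) p" (is "_ = ?rhs")
    if c: "c \<in> carrier (free_cells (Suc n))" for c :: "'v set \<times> 'v set \<Rightarrow> ('v, 'k) mvpoly" and p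
  proof (rule poly_mapping_eqI)
    fix m
    define a where "a q = lookup (c q) m" for q
    define a' where "a' q = (if cell_verts q = cell_verts p then a q else 0)" for q
    have a_eq: "(\<lambda>q. lookup (c q) m) = a" by (simp add: a_def fun_eq_iff)
    have a: "a q = 0" if "q \<notin> cells V \<Delta> (Suc n)" for q using free_cellsD(2)[OF c that] by (simp add: a_def)
    have Da: "?D a q = 0" if "q \<notin> cells V \<Delta> n" for q using koszul_supp[OF finite_V a that] .
    have "lookup (koszul V r \<Delta> (\<lambda>_. 0) (const_matrix M1 (cells V \<Delta> (Suc n)) c) p) m =
      ?D (\<lambda>q. \<Sum>q'\<in>cells V \<Delta> (Suc n). M1 q q' * a q') p"
      by (simp only: lookup_koszul_zero lookup_const_matrix a_def)
    also have "\<dots> = ?D (K1 a') p"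
    proof (rule koszul_zero_local)
      fix q assume q: "cell_verts q = cell_verts p"
      show "(\<Sum>q'\<in>cells V \<Delta> (Suc n). M1 q q' * a q') = K1 a' q"
        unfolding M1_def a'_def q[symmetric] by (rule entry[OF K1_add K1_scale fin a])
    qed
    finally have 1: "lookup (koszul V r \<Delta> (\<lambda>_. 0) (const_matrix M1 (cells V \<Delta> (Suc n)) c) p) m =
      ?D (K1 a') p" .
    have "lookup (const_matrix M0 (cells V \<Delta> n) (koszul V r \<Delta> (\<lambda>_. 0) c) p) m =
      (\<Sum>q\<in>cells V \<Delta> n. M0 p q * ?D a q)"
      by (simp only: lookup_koszul_zero lookup_const_matrix a_eq)
    also have "\<dots> = K0 (\<lambda>q. if cell_verts q = cell_verts p then ?D a q else 0) p"
      unfolding M0_def by (rule entry[OF K0(1,2) fin Da])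
    also have "(\<lambda>q. if cell_verts q = cell_verts p then ?D a q else 0) = ?D a'"
    proof (intro ext)
      fix q
      show "(if cell_verts q = cell_verts p then ?D a q else 0) = ?D a' q"
      proof (cases "cell_verts q = cell_verts p")
        case True
        have "?D a q = ?D a' q" by (rule koszul_zero_local) (simp add: a'_def True)
        then show ?thesis using True by simp
      next
        case False
        have "?D a' q = ?D (\<lambda>_. 0) q"
          by (rule koszul_zero_local) (simp add: a'_def False)
        then show ?thesis using False by simp
      qed
    qed
    finally have 2: "lookup (const_matrix M0 (cells V \<Delta> n) (koszul V r \<Delta> (\<lambda>_. 0) c) p) m =
      K0 (?D a') p" .
    have "a' p = ?D (K1 a') p + K0 (?D a') p"
      by (rule contr) (simp add: a'_def a)
    then show "lookup (c p) m = lookup ?rhs m"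
      unfolding lookup_add 1 2 by (simp add: a'_def a_def)
  qed
  moreover have "K1 a p = 0" if "p \<notin> cells V \<Delta> (Suc (Suc n))" for a p
    unfolding K1_def by (rule K2(3)[OF that])
  then have "p \<in> cells V \<Delta> (Suc (Suc n)) \<and> cell_verts p = cell_verts q" if "M1 p q \<noteq> 0" for p q
    using that by (metis M1_def)
  moreover have "p \<in> cells V \<Delta> (Suc n) \<and> cell_verts p = cell_verts q" if "M0 p q \<noteq> 0" for p q
    using that K0(3) by (metis M0_def)
  ultimately show ?thesis
    by (rule_tac exI[where x = M0], rule_tac exI[where x = M1]) (intro conjI allI impI ballI; blast)
qed

text \<open>Acyclicity in homological degree \<open>n + 1\<close> suffices, since only a projection
  onto the image of the differential in degree \<open>n\<close> is wanted. It is built from the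
  contraction over the field by successive corrections, as in homological perturbation.\<close>

theorem proj_dim_le_of_acyclic_at:
  assumes empty: "{} \<in> \<Delta>"
    and acyc: "\<And>\<sigma> j. \<sigma> \<subseteq> V \<Longrightarrow> card \<sigma> = Suc n + j \<Longrightarrow> acyclic_at TYPE('k::field) r \<Delta> \<sigma> j"
  shows "proj_dim (poly_ring V) (quot_module (poly_ring V) (sr_ideal V \<Delta> :: ('v, 'k) mvpoly set)) \<le> enat n"
proof -
  let ?R = "poly_ring V :: ('v, 'k) mvpoly ring"
  let ?d = "koszul V r \<Delta> (mvar :: 'v \<Rightarrow> ('v, 'k) mvpoly)"
  let ?D = "koszul V r \<Delta> (\<lambda>_. 0 :: ('v, 'k) mvpoly)"
  have "\<exists>M0 M1 :: 'v set \<times> 'v set \<Rightarrow> 'v set \<times> 'v set \<Rightarrow> 'k.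
    (\<forall>p q. M0 p q \<noteq> 0 \<longrightarrow> p \<in> cells V \<Delta> (Suc n) \<and> cell_verts p = cell_verts q) \<and>
    (\<forall>p q. M1 p q \<noteq> 0 \<longrightarrow> p \<in> cells V \<Delta> (Suc (Suc n)) \<and> cell_verts p = cell_verts q) \<and>
    (\<forall>c\<in>carrier (free_cells (Suc n)). \<forall>p. c p =
      ?D (const_matrix M1 (cells V \<Delta> (Suc n)) c) p + const_matrix M0 (cells V \<Delta> n) (?D c) p)"
    by (rule ex_const_contraction) (rule acyc)
  then obtain M0 M1 :: "'v set \<times> 'v set \<Rightarrow> 'v set \<times> 'v set \<Rightarrow> 'k"
    where M0': "\<forall>p q. M0 p q \<noteq> 0 \<longrightarrow> p \<in> cells V \<Delta> (Suc n) \<and> cell_verts p = cell_verts q"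
      and M1': "\<forall>p q. M1 p q \<noteq> 0 \<longrightarrow> p \<in> cells V \<Delta> (Suc (Suc n)) \<and> cell_verts p = cell_verts q"
      and M': "\<forall>c\<in>carrier (free_cells (Suc n)). \<forall>p. c p =
        ?D (const_matrix M1 (cells V \<Delta> (Suc n)) c) p + const_matrix M0 (cells V \<Delta> n) (?D c) p"
    by (elim exE conjE) (rule that)
  note M0 = M0'[rule_format] and M1 = M1'[rule_format] and M = bspec[OF M', THEN spec]
  define s0 :: "('v set \<times> 'v set \<Rightarrow> ('v, 'k) mvpoly) \<Rightarrow> 'v set \<times> 'v set \<Rightarrow> ('v, 'k) mvpoly"
    where "s0 = const_matrix M0 (cells V \<Delta> n)"
  define s1 :: "('v set \<times> 'v set \<Rightarrow> ('v, 'k) mvpoly) \<Rightarrow> 'v set \<times> 'v set \<Rightarrow> ('v, 'k) mvpoly"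
    where "s1 = const_matrix M1 (cells V \<Delta> (Suc n))"
  have cm: "const_matrix M A c p \<in> polys V" if "\<And>q. c q \<in> polys V"
    for M :: "'v set \<times> 'v set \<Rightarrow> 'v set \<times> 'v set \<Rightarrow> 'k" and A p
      and c :: "'v set \<times> 'v set \<Rightarrow> ('v, 'k) mvpoly"
    unfolding const_matrix_def using that by (intro polys_sum polys_mult polys_single) simp_all
  have s0: "s0 c \<in> carrier (free_cells (Suc n))" if "\<And>q. c q \<in> polys V" for c
    unfolding free_cells_iff s0_def
  proof (intro conjI allI impI cm that)
    fix p assume "p \<notin> cells V \<Delta> (Suc n)"
    then have "M0 p q = 0" for q using M0 by blast
    then show "const_matrix M0 (cells V \<Delta> n) c p = 0" by (simp add: const_matrix_def)
  qed
  have s1: "s1 c \<in> carrier (free_cells (Suc (Suc n)))" if "\<And>q. c q \<in> polys V" for c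
    unfolding free_cells_iff s1_def
  proof (intro conjI allI impI cm that)
    fix p assume "p \<notin> cells V \<Delta> (Suc (Suc n))"
    then have "M1 p q = 0" for q using M1 by blast
    then show "const_matrix M1 (cells V \<Delta> (Suc n)) c p = 0" by (simp add: const_matrix_def)
  qed
  have s0_small: "s0 c p = 0" if "\<And>q. t \<le> card (cell_verts q) \<Longrightarrow> c q = 0" "t \<le> card (cell_verts p)" for c p t
    unfolding s0_def const_matrix_def using that M0[of p] by (intro sum.neutral) (metis mult_zero_left mult_zero_right single_zero)
  have s1_small: "s1 c p = 0" if "\<And>q. t \<le> card (cell_verts q) \<Longrightarrow> c q = 0" "t \<le> card (cell_verts p)" for c p t
    unfolding s1_def const_matrix_def using that M1[of p] by (intro sum.neutral) (metis mult_zero_left mult_zero_right single_zero)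
  \<comment> \<open>The part of the differential that contains variables. It passes from a cell to
    one with a vertex less in the union, whereas \<open>s0\<close> and \<open>s1\<close> keep the
    union.\<close>
  define d1 :: "('v set \<times> 'v set \<Rightarrow> ('v, 'k) mvpoly) \<Rightarrow> 'v set \<times> 'v set \<Rightarrow> ('v, 'k) mvpoly"
    where "d1 c p = ?d c p - ?D c p" for c p
  have d1_small: "d1 c p = 0" if "\<And>q. Suc t \<le> card (cell_verts q) \<Longrightarrow> c q = 0" "t \<le> card (cell_verts p)" for c p t
  proof (cases p)
    case (Pair F G)
    have "c (insert v F, G) = 0" if "F \<subseteq> V" "G \<subseteq> V" "v \<in> V" "v \<notin> F" "v \<notin> G" for v
    proof -
      have "finite (F \<union> G)" using that finite_V by (auto intro: finite_subset)
      then have "card (insert v F \<union> G) = Suc (card (F \<union> G))" using that by simp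
      then show ?thesis using \<open>t \<le> card (cell_verts p)\<close> Pair by (intro \<open>\<And>q. Suc t \<le> card (cell_verts q) \<Longrightarrow> c q = 0\<close>) simp
    qed
    then show ?thesis
      unfolding d1_def koszul_split[OF finite_V, of r \<Delta> mvar] Pair by (auto intro!: sum.neutral)
  qed
  have d: "?d \<in> linear_maps ?R (free_cells (Suc i)) (free_cells i)" for i
    by (rule koszul_linear) simp
  note dc = linear_maps_closed[OF d]
  \<comment> \<open>The error is \<open>c' = d1 (s1 c) + s0 (d1 c)\<close>, which equals
    \<open>d (s1 c) + s0 (d c) - c\<close> by the contraction identity. One application of
    \<open>d1\<close> in each summand lowers the bound on the unions by one.\<close>
  have step: "\<exists>c'\<in>carrier (free_cells (Suc n)). (\<forall>p. t \<le> card (cell_verts p) \<longrightarrow> c' p = 0) \<and>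
      ?d (s0 (?d c)) = (\<lambda>p. ?d c p + ?d c' p)"
    if c: "c \<in> carrier (free_cells (Suc n))" and small: "\<And>p. Suc t \<le> card (cell_verts p) \<Longrightarrow> c p = 0" for c t
  proof
    note pc = free_cellsD(1)[OF c]
    let ?c' = "\<lambda>p. d1 (s1 c) p + s0 (d1 c) p"
    have s0_diff: "s0 (d1 c) p = s0 (?d c) p - s0 (?D c) p" for p
      unfolding d1_def s0_def const_matrix_def by (simp add: algebra_simps sum_subtractf)
    have c'_eq: "?c' p = ?d (s1 c) p + s0 (?d c) p - c p" for p
      using M[OF c, of p] unfolding s0_def[symmetric] s1_def[symmetric] s0_diff d1_def by simp
    have "?d (s1 c) \<in> carrier (free_cells (Suc n))" by (rule dc[OF s1[OF pc]])
    moreover have "s0 (?d c) \<in> carrier (free_cells (Suc n))" by (rule s0[OF free_cellsD(1)[OF dc[OF c]]])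
    ultimately show "?c' \<in> carrier (free_cells (Suc n))"
      using c unfolding c'_eq free_cells_iff by (simp add: diff_conv_add_uminus del: add_uminus_conv_diff)
    have "?d ?c' = (\<lambda>p. ?d (?d (s1 c)) p + ?d (s0 (?d c)) p - ?d c p)"
      unfolding c'_eq koszul_diff koszul_add ..
    then have "?d (s0 (?d c)) = (\<lambda>p. ?d c p + ?d ?c' p)" by (simp add: koszul_koszul fun_eq_iff)
    moreover have "?c' p = 0" if p: "t \<le> card (cell_verts p)" for p
    proof -
      have "d1 (s1 c) p = 0" by (rule d1_small[OF s1_small p]) (rule small)
      moreover have "s0 (d1 c) p = 0" by (rule s0_small[OF d1_small p]) (rule small)
      ultimately show ?thesis by simp
    qed
    ultimately show "(\<forall>p. t \<le> card (cell_verts p) \<longrightarrow> ?c' p = 0) \<and>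
      ?d (s0 (?d c)) = (\<lambda>p. ?d c p + ?d ?c' p)" by blast
  qed
  have "\<exists>q\<in>linear_maps ?R (free_cells n) (free_cells n).
      q ` carrier (free_cells n) \<subseteq> ?d ` carrier (free_cells (Suc n)) \<and>
      (\<forall>c\<in>carrier (free_cells (Suc n)). (\<forall>p. t \<le> card (cell_verts p) \<longrightarrow> c p = 0) \<longrightarrow> q (?d c) = ?d c)" for t
  proof (induction t)
    case 0
    have zero: "(\<lambda>p. 0) \<in> carrier (free_cells i)" for i by (simp add: free_cells_iff del: free_mod_simps(1))
    have "(\<lambda>c p. 0) \<in> linear_maps ?R (free_cells n) (free_cells n)"
      by (rule linear_mapsI) (simp_all add: zero del: free_mod_simps(1))
    moreover have "(\<lambda>p. 0) \<in> ?d ` carrier (free_cells (Suc n))"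
      by (rule image_eqI[OF _ zero]) simp
    moreover have "?d c = (\<lambda>p. 0)" if "\<forall>p. 0 \<le> card (cell_verts p) \<longrightarrow> c p = 0" for c
    proof -
      have "c = (\<lambda>p. 0)" using that by auto
      then show ?thesis by simp
    qed
    ultimately show ?case by (intro bexI[where x = "\<lambda>c p. 0"]) auto
  next
    case (Suc t)
    then obtain q where q: "q \<in> linear_maps ?R (free_cells n) (free_cells n)"
      and qd: "q ` carrier (free_cells n) \<subseteq> ?d ` carrier (free_cells (Suc n))"
      and qid: "\<And>c. c \<in> carrier (free_cells (Suc n)) \<Longrightarrow> (\<And>p. t \<le> card (cell_verts p) \<Longrightarrow> c p = 0) \<Longrightarrow> q (?d c) = ?d c"
      by blast
    interpret Fn: Module.module ?R "free_cells n" by (rule module_free_mod[OF cring_poly_ring])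
    have s0_lin: "s0 \<in> linear_maps ?R (free_cells n) (free_cells (Suc n))"
      using s0[OF free_cellsD(1)] unfolding s0_def
      by (intro linear_mapsI) (simp_all only: free_mod_simps(3,4) poly_ring_simps const_matrix_add const_matrix_scale)
    have ds: "(\<lambda>a. ?d (s0 a)) \<in> linear_maps ?R (free_cells n) (free_cells n)"
      by (rule linear_maps_comp[OF s0_lin d])
    have modn: "Module.module ?R (free_cells n)" by (rule Fn.module_axioms)
    have rest: "(\<lambda>a. a \<ominus>\<^bsub>free_cells n\<^esub> ?d (s0 a)) \<in> linear_maps ?R (free_cells n) (free_cells n)"
      by (rule linear_maps_minus[OF modn linear_maps_id ds])
    \<comment> \<open>On \<open>d c\<close> the first summand gives \<open>d c + d c'\<close>, and
      \<open>q\<close>, which already fixes \<open>d c'\<close>, removes the excess. All values stay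
      boundaries.\<close>
    let ?q = "\<lambda>a. ?d (s0 a) \<oplus>\<^bsub>free_cells n\<^esub> q (a \<ominus>\<^bsub>free_cells n\<^esub> ?d (s0 a))"
    show ?case
    proof (rule bexI[where x = ?q], intro conjI ballI impI)
      show "?q \<in> linear_maps ?R (free_cells n) (free_cells n)"
        by (rule linear_maps_plus[OF modn ds linear_maps_comp[OF rest q]])
      show "?q ` carrier (free_cells n) \<subseteq> ?d ` carrier (free_cells (Suc n))"
      proof (rule image_subsetI)
        fix a :: "'v set \<times> 'v set \<Rightarrow> ('v, 'k) mvpoly" assume a: "a \<in> carrier (free_cells n)"
        obtain b where b: "b \<in> carrier (free_cells (Suc n))" "q (a \<ominus>\<^bsub>free_cells n\<^esub> ?d (s0 a)) = ?d b"
          using subsetD[OF qd imageI[OF linear_maps_closed[OF rest a]]] by (elim imageE) (rule that, assumption+)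
        interpret Fs: Module.module ?R "free_cells (Suc n)" by (rule module_free_mod[OF cring_poly_ring])
        show "?q a \<in> ?d ` carrier (free_cells (Suc n))"
        proof (rule image_eqI)
          show "s0 a \<oplus>\<^bsub>free_cells (Suc n)\<^esub> b \<in> carrier (free_cells (Suc n))"
            by (rule Fs.M.a_closed[OF linear_maps_closed[OF s0_lin a] b(1)])
          show "?q a = ?d (s0 a \<oplus>\<^bsub>free_cells (Suc n)\<^esub> b)"
            unfolding linear_maps_add[OF d linear_maps_closed[OF s0_lin a] b(1)] b(2) ..
        qed
      qed
      fix c :: "'v set \<times> 'v set \<Rightarrow> ('v, 'k) mvpoly" 
      assume c: "c \<in> carrier (free_cells (Suc n))"
        and small: "\<forall>p. Suc t \<le> card (cell_verts p) \<longrightarrow> c p = 0"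
      obtain c' where c': "c' \<in> carrier (free_cells (Suc n))" "\<And>p. t \<le> card (cell_verts p) \<Longrightarrow> c' p = 0"
        "?d (s0 (?d c)) = (\<lambda>p. ?d c p + ?d c' p)"
        using step[OF c, of t] small by blast
      have qc': "q (?d c') = ?d c'" by (rule qid[OF c'(1)]) (rule c'(2))
      have eq: "?d (s0 (?d c)) = ?d c \<oplus>\<^bsub>free_cells n\<^esub> ?d c'" unfolding c'(3) by simp
      have "?d c \<ominus>\<^bsub>free_cells n\<^esub> ?d (s0 (?d c)) = \<ominus>\<^bsub>free_cells n\<^esub> ?d c'"
        unfolding eq using dc[OF c] dc[OF c'(1)]
        by (simp add: a_minus_def Fn.M.minus_add Fn.M.r_neg2 del: free_mod_simps)
      also have "\<dots> = \<zero>\<^bsub>free_cells n\<^esub> \<ominus>\<^bsub>free_cells n\<^esub> ?d c'"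
        using dc[OF c'(1)] by (simp add: a_minus_def del: free_mod_simps)
      finally have "q (?d c \<ominus>\<^bsub>free_cells n\<^esub> ?d (s0 (?d c))) = q \<zero>\<^bsub>free_cells n\<^esub> \<ominus>\<^bsub>free_cells n\<^esub> q (?d c')"
        using linear_maps_a_minus[OF modn modn q Fn.M.zero_closed dc[OF c'(1)]] by (simp only:)
      also have "\<dots> = \<zero>\<^bsub>free_cells n\<^esub> \<ominus>\<^bsub>free_cells n\<^esub> ?d c'"
        unfolding qc' linear_maps_zero[OF modn modn q] by (rule refl)
      finally show "?q (?d c) = ?d c"
        unfolding eq using dc[OF c] dc[OF c'(1)]
        by (simp add: a_minus_def Fn.M.a_assoc Fn.M.r_neg del: free_mod_simps)
    qed
  qed
  from this[of "Suc (card V)"] obtain q where q: "q \<in> linear_maps ?R (free_cells n) (free_cells n)"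
    and qd: "q ` carrier (free_cells n) \<subseteq> ?d ` carrier (free_cells (Suc n))"
    and qid: "\<And>c. c \<in> carrier (free_cells (Suc n)) \<Longrightarrow>
      (\<And>p. Suc (card V) \<le> card (cell_verts p) \<Longrightarrow> c p = 0) \<Longrightarrow> q (?d c) = ?d c"
    by blast
  show ?thesis
  proof (rule proj_dim_le_of_retraction[OF cring_poly_ring module_quot_module[OF cring_poly_ring ideal_sr_ideal]
      finite_cells[OF finite_V] resolution_koszul[OF empty] q qd])
    fix c :: "'v set \<times> 'v set \<Rightarrow> ('v, 'k) mvpoly" 
    assume c: "c \<in> carrier (free_cells (Suc n))"
    show "q (?d c) = ?d c"
    proof (rule qid[OF c])
      fix p :: "'v set \<times> 'v set" assume "Suc (card V) \<le> card (cell_verts p)"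
      then have "\<not> cell_verts p \<subseteq> V" using card_mono[OF finite_V, of "cell_verts p"] by auto
      then have "p \<notin> cells V \<Delta> (Suc n)" by (auto simp: cells_def)
      then show "c p = 0" by (rule free_cellsD(2)[OF c])
    qed
  qed
qed

theorem proj_dim_le_iff_acyclic_at:
  assumes "{} \<in> \<Delta>"
  shows "proj_dim (poly_ring V) (quot_module (poly_ring V) (sr_ideal V \<Delta> :: ('v, 'k::field) mvpoly set)) \<le> enat n
    \<longleftrightarrow> (\<forall>\<sigma> j. \<sigma> \<subseteq> V \<longrightarrow> n + j < card \<sigma> \<longrightarrow> acyclic_at TYPE('k) r \<Delta> \<sigma> j)"
proof (intro iffI allI impI)
  assume *: "\<forall>\<sigma> j. \<sigma> \<subseteq> V \<longrightarrow> n + j < card \<sigma> \<longrightarrow> acyclic_at TYPE('k) r \<Delta> \<sigma> j"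
  show "proj_dim (poly_ring V) (quot_module (poly_ring V) (sr_ideal V \<Delta> :: ('v, 'k) mvpoly set)) \<le> enat n"
    by (rule proj_dim_le_of_acyclic_at[OF assms]) (use * in simp)
qed (rule acyclic_at_of_proj_dim_le[OF assms])

end

section \<open>Deletion, link and suspension\<close>

lemma acyclic_at_cong:
  assumes "\<And>G. G \<subseteq> \<sigma> \<Longrightarrow> G \<in> \<Delta> \<longleftrightarrow> G \<in> \<Delta>'"
  shows "acyclic_at K r \<Delta> \<sigma> j \<longleftrightarrow> acyclic_at K r \<Delta>' \<sigma> j"
  using assms unfolding acyclic_at_def by (simp add: Ball_def cong: conj_cong imp_cong) blast

lemma acyclic_atD:
  fixes c :: "'v set \<Rightarrow> 'k::field"
  assumes "acyclic_at (K :: 'k itself) r \<Delta> \<sigma> j"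
    and "\<forall>G\<in>\<Delta>. G \<subseteq> \<sigma> \<and> card G = Suc j \<longrightarrow> coboundary r c G = 0"
  shows "\<exists>b. \<forall>G\<in>\<Delta>. G \<subseteq> \<sigma> \<and> card G = j \<longrightarrow> c G = coboundary r b G"
  using assms(1) unfolding acyclic_at_def by (elim allE[of _ c] impE) (rule assms(2))

text \<open>The complex whose only face is empty has nonzero reduced cohomology in dimension -1: a
  coboundary at the empty face is an empty sum.\<close>

lemma not_acyclic_at_empty:
  assumes "{} \<in> \<Delta>"
  shows "\<not> acyclic_at (K :: 'a::field itself) r \<Delta> {} 0"
proof
  assume "acyclic_at K r \<Delta> {} 0"
  then have "\<exists>b. \<forall>G\<in>\<Delta>. G \<subseteq> {} \<and> card G = 0 \<longrightarrow> (1 :: 'a) = coboundary r b G"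
    unfolding acyclic_at_def by (elim allE[of _ "\<lambda>_. 1"]) auto
  with assms show False by (auto simp: coboundary_def)
qed

text \<open>The common basis of the arguments with a cone, a link and a suspension: on faces through
  \<open>y\<close> the coboundary compares \<open>c\<close> on the opposite face with the coboundary
  of the cochain that \<open>c\<close> induces on the link.\<close>

lemma coboundary_insert:
  fixes c :: "'v set \<Rightarrow> 'k::comm_ring_1"
  assumes "finite G" "y \<notin> G" "inj_on r (insert y G)"
  shows "coboundary r c (insert y G) =
    vsign r y G * (c G - coboundary r (\<lambda>F. vsign r y F * c (insert y F)) G)"
proof -
  have "vsign r g (insert y G - {g}) * c (insert y G - {g}) =
    - (vsign r y G * (vsign r g (G - {g}) * (vsign r y (G - {g}) * c (insert y (G - {g})))))"
    if g: "g \<in> G" for g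
  proof -
    define F where "F = G - {g}"
    have F: "G = insert g F" "g \<notin> F" "y \<notin> F" "finite F" "g \<noteq> y"
      using g assms by (auto simp: F_def)
    have "r g \<noteq> r y" using inj_onD[OF assms(3), of g y] assms(2) g by auto
    then have "vsign r g (insert y F) * vsign r y F = (- (vsign r y (insert g F) * vsign r g F) :: 'k)"
      using F by (intro vsign_anticommute) auto
    then have "vsign r g (insert y F) * (vsign r y F * (vsign r y F * c (insert y F))) =
      - (vsign r y G * (vsign r g F * (vsign r y F * c (insert y F))))"
      unfolding F(1) by (simp only: mult.assoc[symmetric] mult_minus_left)
    moreover have "insert y G - {g} = insert y F" using F by auto
    ultimately show ?thesis by (simp add: F_def)
  qed
  moreover have "insert y G - {y} = G" using assms by auto
  ultimately show ?thesis
    using assms by (simp add: coboundary_def right_diff_distrib sum_distrib_left sum_negf)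
qed

lemma coboundary_coboundary:
  fixes c :: "'v set \<Rightarrow> 'k::comm_ring_1"
  assumes "finite G" "inj_on r G"
  shows "coboundary r (coboundary r c) G = 0"
proof -
  have "coboundary r (coboundary r c) G =
    (\<Sum>v\<in>G. \<Sum>w\<in>G - {v}. vsign r v (G - {v}) * vsign r w (G - {v} - {w}) * c (G - {v} - {w}))"
    by (simp add: coboundary_def sum_distrib_left mult.assoc)
  also have "\<dots> = 0"
  proof (rule sum_antisymmetric[OF assms])
    fix v w assume vw: "v \<in> G" "w \<in> G" "v \<noteq> w"
    define F where "F = G - {v} - {w}"
    have F: "G - {v} = insert w F" "G - {w} = insert v F" "G - {w} - {v} = F" "finite F" "v \<notin> F" "w \<notin> F"
      using vw assms by (auto simp: F_def)
    have "r v \<noteq> r w" using assms vw by (auto dest: inj_onD)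
    then have "vsign r v (insert w F) * vsign r w F = (- (vsign r w (insert v F) * vsign r v F) :: 'k)"
      using F by (intro vsign_anticommute) auto
    then show "vsign r v (G - {v}) * vsign r w (G - {v} - {w}) * c (G - {v} - {w}) =
      - (vsign r w (G - {w}) * vsign r v (G - {w} - {v}) * c (G - {w} - {v}))"
      unfolding F(3) F_def[symmetric] unfolding F(1,2) by simp
  qed
  finally show ?thesis .
qed

lemma coboundary_zeroI:
  assumes "\<And>v. v \<in> G \<Longrightarrow> c (G - {v}) = 0"
  shows "coboundary r c G = 0"
  using assms by (simp add: coboundary_def)

lemma coboundary_plus: "coboundary r (\<lambda>G. a G + b G) G = coboundary r a G + coboundary r b G"
  by (simp add: coboundary_def distrib_left sum.distrib)

lemma coboundary_diff: "coboundary r (\<lambda>G. a G - b G) G = coboundary r a G - coboundary r b G"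
  by (simp add: coboundary_def right_diff_distrib sum_subtractf)

locale ordered_faces =
  fixes r :: "'v \<Rightarrow> nat" and \<Delta> :: "'v set set"
  assumes down: "G \<in> \<Delta> \<Longrightarrow> G' \<subseteq> G \<Longrightarrow> G' \<in> \<Delta>"
begin

text \<open>The cochain \<open>b\<close> in the proof is the standard cone contraction with apex
  \<open>w\<close>. Faces without \<open>w\<close> use the cocycle condition at
  \<open>insert w G\<close>, and faces through \<open>w\<close> follow from the definition of
  \<open>b\<close>.\<close>

lemma acyclic_at_cone:
  assumes \<sigma>: "finite \<sigma>" "inj_on r \<sigma>" and w: "w \<in> \<sigma>"
    and cone: "\<And>G. G \<in> \<Delta> \<Longrightarrow> G \<subseteq> \<sigma> \<Longrightarrow> insert w G \<in> \<Delta>"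
  shows "acyclic_at (K :: 'k::field itself) r \<Delta> \<sigma> j"
  unfolding acyclic_at_def
proof (intro allI impI)
  fix c :: "'v set \<Rightarrow> 'k"
  assume c: "\<forall>G\<in>\<Delta>. G \<subseteq> \<sigma> \<and> card G = Suc j \<longrightarrow> coboundary r c G = 0"
  define b where "b G = (if w \<in> G then 0 else vsign r w G * c (insert w G))" for G
  have "c G = coboundary r b G" if G: "G \<in> \<Delta>" "G \<subseteq> \<sigma>" "card G = j" for G
  proof (cases "w \<in> G")
    case False
    have fin: "finite G" "inj_on r (insert w G)"
      using finite_subset[OF G(2) \<sigma>(1)] inj_on_subset[OF \<sigma>(2), of "insert w G"] G(2) w by auto
    have "coboundary r c (insert w G) = 0"
      using c cone[OF G(1,2)] G w fin False by simp
    then have "vsign r w G * (vsign r w G * (c G - coboundary r (\<lambda>F. vsign r w F * c (insert w F)) G)) = 0"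
      using coboundary_insert[OF fin(1) False fin(2), of c] by simp
    then have "c G = coboundary r (\<lambda>F. vsign r w F * c (insert w F)) G" by simp
    also have "\<dots> = coboundary r b G" using False by (intro coboundary_cong) (simp add: b_def)
    finally show ?thesis .
  next
    case True
    define F where "F = G - {w}"
    have F: "G = insert w F" "w \<notin> F" using True by (auto simp: F_def)
    have fin: "finite F" "inj_on r (insert w F)"
      using finite_subset[OF G(2) \<sigma>(1)] inj_on_subset[OF \<sigma>(2) G(2)] F by auto
    have "coboundary r b G = vsign r w F * (b F - coboundary r (\<lambda>F. vsign r w F * b (insert w F)) F)"
      unfolding F(1) by (rule coboundary_insert[OF fin(1) F(2) fin(2)])
    also have "\<dots> = c G" using F by (simp add: b_def coboundary_def)
    finally show ?thesis by simp
  qed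
  then show "\<exists>b. \<forall>G\<in>\<Delta>. G \<subseteq> \<sigma> \<and> card G = j \<longrightarrow> c G = coboundary r b G" by blast
qed

text \<open>The long exact sequence of the deletion and the link \<open>L\<close> of the vertex \<open>y\<close>.\<close>

lemma acyclic_at_vertex:
  assumes \<sigma>: "finite \<sigma>" "inj_on r \<sigma>" and y: "y \<in> \<sigma>" and L: "L \<subseteq> \<sigma> - {y}"
    and link: "\<And>G. G \<subseteq> \<sigma> - {y} \<Longrightarrow> insert y G \<in> \<Delta> \<longleftrightarrow> G \<in> \<Delta> \<and> G \<subseteq> L"
    and del: "acyclic_at (K :: 'k::field itself) r \<Delta> (\<sigma> - {y}) j"
    and acL: "\<And>i. j = Suc i \<Longrightarrow> acyclic_at K r \<Delta> L i"
  shows "acyclic_at K r \<Delta> \<sigma> j"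
  unfolding acyclic_at_def
proof (intro allI impI)
  fix c :: "'v set \<Rightarrow> 'k"
  assume c: "\<forall>G\<in>\<Delta>. G \<subseteq> \<sigma> \<and> card G = Suc j \<longrightarrow> coboundary r c G = 0"
  then have "\<forall>G\<in>\<Delta>. G \<subseteq> \<sigma> - {y} \<and> card G = Suc j \<longrightarrow> coboundary r c G = 0" by blast
  from acyclic_atD[OF del this] obtain a
    where a: "\<forall>G\<in>\<Delta>. G \<subseteq> \<sigma> - {y} \<and> card G = j \<longrightarrow> c G = coboundary r a G" ..
  \<comment> \<open>Extension of \<open>a\<close> by zero to faces through \<open>y\<close>.
    Subtracting its coboundary leaves a cohomologous cocycle that vanishes on the deletion and so is
    carried by the link.\<close>
  define a' where "a' G = (if y \<in> G then 0 else a G)" for G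
  define c' where "c' G = c G - coboundary r a' G" for G
  have finG: "finite G" "inj_on r G" if "G \<subseteq> \<sigma>" for G
    using finite_subset[OF that \<sigma>(1)] inj_on_subset[OF \<sigma>(2) that] by auto
  have c'_del: "c' G = 0" if "G \<in> \<Delta>" "G \<subseteq> \<sigma> - {y}" "card G = j" for G
  proof -
    have "coboundary r a' G = coboundary r a G"
      using that(2) by (intro coboundary_cong) (auto simp: a'_def)
    then show ?thesis using a that by (simp add: c'_def)
  qed
  have c'_cyc: "coboundary r c' G = 0" if "G \<in> \<Delta>" "G \<subseteq> \<sigma>" "card G = Suc j" for G
    unfolding c'_def coboundary_diff using c that by (simp add: coboundary_coboundary finG)
  define d where "d F = vsign r y F * c' (insert y F)" for F
  have d_eq: "d = (\<lambda>F. vsign r y F * c' (insert y F))" by (simp add: d_def fun_eq_iff)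
  \<comment> \<open>The condition \<open>Suc (card G) = j\<close> is empty for \<open>j = 0\<close>,
    where the link contributes nothing.\<close>
  have "\<exists>e. \<forall>G\<in>\<Delta>. G \<subseteq> L \<and> Suc (card G) = j \<longrightarrow> d G = coboundary r e G"
  proof (cases j)
    case (Suc i)
    have "coboundary r d G = 0" if G: "G \<in> \<Delta>" "G \<subseteq> L" "card G = Suc i" for G
    proof -
      have yG: "y \<notin> G" "G \<subseteq> \<sigma>" "insert y G \<subseteq> \<sigma>" "G \<subseteq> \<sigma> - {y}" using G(2) L y by auto
      have "insert y G \<in> \<Delta>" using link[OF yG(4)] G by blast
      then have "coboundary r c' (insert y G) = 0"
        using G yG finG(1)[OF yG(2)] Suc by (intro c'_cyc) auto
      then have "vsign r y G * (vsign r y G * (c' G - coboundary r d G)) = 0"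
        using coboundary_insert[OF finG(1)[OF yG(2)] yG(1) finG(2)[OF yG(3)], of c']
        unfolding d_eq by simp
      moreover have "c' G = 0" using G yG Suc by (intro c'_del) auto
      ultimately show ?thesis by simp
    qed
    then have "\<exists>e. \<forall>G\<in>\<Delta>. G \<subseteq> L \<and> card G = i \<longrightarrow> d G = coboundary r e G"
      by (intro acyclic_atD[OF acL[OF Suc]]) blast
    then show ?thesis using Suc by simp
  qed simp
  then obtain e where e: "\<And>G. G \<in> \<Delta> \<Longrightarrow> G \<subseteq> L \<Longrightarrow> Suc (card G) = j \<Longrightarrow> d G = coboundary r e G" by blast
  define b where "b G = (if y \<in> G then - (vsign r y (G - {y}) * e (G - {y})) else 0)" for G
  have "c' G = coboundary r b G" if G: "G \<in> \<Delta>" "G \<subseteq> \<sigma>" "card G = j" for G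
  proof (cases "y \<in> G")
    case False
    then have "coboundary r b G = 0" by (intro coboundary_zeroI) (auto simp: b_def)
    then show ?thesis using c'_del G False by (metis Diff_insert_absorb insert_Diff_single subset_insert_iff subset_Diff_insert Diff_empty)
  next
    case True
    define F where "F = G - {y}"
    have F: "G = insert y F" "y \<notin> F" "F \<subseteq> \<sigma>" "F \<subseteq> \<sigma> - {y}" using True G by (auto simp: F_def)
    then have FL: "F \<in> \<Delta>" "F \<subseteq> L" using link[OF F(4)] G by blast+
    have card: "Suc (card F) = j" using G F finG(1)[OF F(3)] by auto
    have "coboundary r b G = vsign r y F * (b F - coboundary r (\<lambda>F. vsign r y F * b (insert y F)) F)"
      using coboundary_insert[OF finG(1)[OF F(3)] F(2), of r b] finG(2)[OF G(2)] unfolding F(1) by simp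
    also have "coboundary r (\<lambda>F. vsign r y F * b (insert y F)) F = coboundary r (\<lambda>F. - e F) F"
      using F(2) by (intro coboundary_cong) (auto simp: b_def)
    also have "\<dots> = - d F" unfolding coboundary_uminus e[OF FL card] ..
    also have "vsign r y F * (b F - - d F) = c' G" using F by (simp add: b_def d_def)
    finally show ?thesis by (rule sym)
  qed
  then have "c G = coboundary r (\<lambda>G. b G + a' G) G" if "G \<in> \<Delta>" "G \<subseteq> \<sigma>" "card G = j" for G
    using that unfolding coboundary_plus by (simp add: c'_def diff_eq_eq)
  then show "\<exists>b. \<forall>G\<in>\<Delta>. G \<subseteq> \<sigma> \<and> card G = j \<longrightarrow> c G = coboundary r b G" by blast
qed

text \<open>
  The faces avoiding \<open>U\<close> form a cone with apex \<open>z\<close>, those avoiding \<open>W\<close> a cone with apex \<open>x\<close>; together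
  they cover, and they meet in the faces inside \<open>\<sigma>\<close>. The proof is the Mayer-Vietoris connecting
  homomorphism: extend a cocycle on \<open>\<sigma>\<close> by zero and take its coboundary on the faces that meet \<open>U\<close>.
\<close>

lemma acyclic_at_suspension:
  assumes fin: "finite (\<sigma> \<union> U \<union> W)" and inj: "inj_on r (\<sigma> \<union> U \<union> W)"
    and x: "x \<in> U" and z: "z \<in> W" and disj: "\<sigma> \<inter> U = {}" "z \<notin> \<sigma>" "z \<notin> U"
    and sep: "\<And>G. G \<in> \<Delta> \<Longrightarrow> G \<subseteq> \<sigma> \<union> U \<union> W \<Longrightarrow> G \<inter> U = {} \<or> G \<inter> W = {}"
    and cone: "\<And>G. G \<in> \<Delta> \<Longrightarrow> G \<subseteq> \<sigma> \<Longrightarrow> insert x G \<in> \<Delta> \<and> insert z G \<in> \<Delta>"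
    and ac: "acyclic_at (K :: 'k::field itself) r \<Delta> (\<sigma> \<union> U \<union> W) (Suc j)"
  shows "acyclic_at K r \<Delta> \<sigma> j"
  unfolding acyclic_at_def
proof (intro allI impI)
  fix \<phi> :: "'v set \<Rightarrow> 'k"
  assume \<phi>: "\<forall>G\<in>\<Delta>. G \<subseteq> \<sigma> \<and> card G = Suc j \<longrightarrow> coboundary r \<phi> G = 0"
  let ?T = "\<sigma> \<union> U \<union> W"
  have finG: "finite G" "inj_on r G" if "G \<subseteq> ?T" for G
    using finite_subset[OF that fin] inj_on_subset[OF inj that] by auto
  define e where "e G = (if G \<subseteq> \<sigma> then \<phi> G else 0)" for G
  define c where "c G = (if G \<inter> U = {} then 0 else coboundary r e G)" for G
  have "coboundary r c G = 0" if G: "G \<in> \<Delta>" "G \<subseteq> ?T" "card G = Suc (Suc j)" for G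
  proof (cases "G \<inter> U = {}")
    case True
    then show ?thesis by (intro coboundary_zeroI) (auto simp: c_def)
  next
    case False
    then have GW: "G \<subseteq> \<sigma> \<union> U" using sep[OF G(1,2)] G(2) by blast
    have "coboundary r c G = coboundary r (coboundary r e) G"
    proof (rule coboundary_cong)
      fix v assume v: "v \<in> G"
      show "c (G - {v}) = coboundary r e (G - {v})"
      proof (cases "(G - {v}) \<inter> U = {}")
        case True
        then have sub: "G - {v} \<subseteq> \<sigma>" using GW by blast
        have "coboundary r e (G - {v}) = coboundary r \<phi> (G - {v})"
          using sub by (intro coboundary_cong) (auto simp: e_def)
        also have "\<dots> = 0"
          using \<phi> sub down[OF G(1), of "G - {v}"] v G(3) finG(1)[OF G(2)] by auto
        finally show ?thesis using True by (simp add: c_def)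
      qed (simp add: c_def)
    qed
    also have "\<dots> = 0" by (rule coboundary_coboundary[OF finG[OF G(2)]])
    finally show ?thesis .
  qed
  then have "\<exists>b. \<forall>G\<in>\<Delta>. G \<subseteq> ?T \<and> card G = Suc j \<longrightarrow> c G = coboundary r b G"
    by (intro acyclic_atD[OF ac]) blast
  then obtain b where b: "\<forall>G\<in>\<Delta>. G \<subseteq> ?T \<and> card G = Suc j \<longrightarrow> c G = coboundary r b G" ..
  \<comment> \<open>\<open>e - b\<close> is a cocycle on the faces through \<open>x\<close> and
    \<open>b\<close> one on the faces through \<open>z\<close>. Each is contracted by its cone, and
    the two add up to \<open>e\<close>, which is \<open>\<phi>\<close> on
    \<open>\<sigma>\<close>.\<close>
  let ?b = "\<lambda>F. vsign r x F * (e (insert x F) - b (insert x F)) + vsign r z F * b (insert z F)"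
  have "\<phi> G = coboundary r ?b G" if G: "G \<in> \<Delta>" "G \<subseteq> \<sigma>" "card G = j" for G
  proof -
    have sub: "G \<subseteq> ?T" "insert x G \<subseteq> ?T" "insert z G \<subseteq> ?T" "x \<notin> G" "z \<notin> G" using G x z disj by auto
    have "c (insert x G) = coboundary r b (insert x G)" "c (insert z G) = coboundary r b (insert z G)"
      using cone[OF G(1,2)] sub G finG(1)[OF sub(1)] b by auto
    moreover have "insert x G \<inter> U \<noteq> {}" "insert z G \<inter> U = {}" using x G disj by auto
    ultimately have 1: "coboundary r (\<lambda>F. e F - b F) (insert x G) = 0" and 2: "coboundary r b (insert z G) = 0"
      by (simp_all add: c_def coboundary_diff)
    have "vsign r x G * (vsign r x G * (e G - b G - coboundary r (\<lambda>F. vsign r x F * (e (insert x F) - b (insert x F))) G)) = 0"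
      using 1 unfolding coboundary_insert[OF finG(1)[OF sub(1)] sub(4) finG(2)[OF sub(2)]] by simp
    moreover have "vsign r z G * (vsign r z G * (b G - coboundary r (\<lambda>F. vsign r z F * b (insert z F)) G)) = 0"
      using 2 unfolding coboundary_insert[OF finG(1)[OF sub(1)] sub(5) finG(2)[OF sub(3)]] by simp
    ultimately have "e G = coboundary r (\<lambda>F. vsign r x F * (e (insert x F) - b (insert x F))) G +
      coboundary r (\<lambda>F. vsign r z F * b (insert z F)) G" by (simp add: algebra_simps)
    then show ?thesis using G(2) unfolding coboundary_plus by (simp add: e_def)
  qed
  then show "\<exists>b. \<forall>G\<in>\<Delta>. G \<subseteq> \<sigma> \<and> card G = j \<longrightarrow> \<phi> G = coboundary r b G" by blast
qed

end

section \<open>Edge ideals of graphs\<close>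

definition indep_sets :: "'v sgraph \<Rightarrow> 'v set set" where
  "indep_sets G = {A. A \<subseteq> verts G \<and> (\<forall>e\<in>edges G. \<not> e \<subseteq> A)}"

lemma indep_sets_down: "A \<in> indep_sets G \<Longrightarrow> A' \<subseteq> A \<Longrightarrow> A' \<in> indep_sets G"
  unfolding indep_sets_def by blast

lemma simple_graph_edgeE:
  assumes "simple_graph G" "e \<in> edges G"
  obtains u w where "e = {u, w}" "u \<noteq> w" "u \<in> verts G" "w \<in> verts G"
  using assms unfolding simple_graph_def by (metis card_2_iff insert_subset)

lemma empty_indep_sets: "simple_graph G \<Longrightarrow> {} \<in> indep_sets G"
  unfolding indep_sets_def by (auto elim: simple_graph_edgeE)

lemma insert_indep_sets:
  assumes G: "simple_graph G" and y: "y \<in> verts G"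
  shows "insert y A \<in> indep_sets G \<longleftrightarrow> A \<in> indep_sets G \<and> A \<inter> nbhd G y = {}"
proof
  assume *: "insert y A \<in> indep_sets G"
  then have "\<not> {y, w} \<subseteq> insert y A" if "w \<in> nbhd G y" for w
    using that by (auto simp: indep_sets_def nbhd_def)
  with * show "A \<in> indep_sets G \<and> A \<inter> nbhd G y = {}"
    using indep_sets_down[OF *, of A] by blast
next
  assume *: "A \<in> indep_sets G \<and> A \<inter> nbhd G y = {}"
  have "\<not> e \<subseteq> insert y A" if e: "e \<in> edges G" for e
  proof
    assume sub: "e \<subseteq> insert y A"
    obtain u w where uw: "e = {u, w}" "u \<noteq> w" using simple_graph_edgeE[OF G e] by metis
    have "y \<in> e" using sub e * by (auto simp: indep_sets_def)
    then obtain v where "e = {y, v}" "v \<noteq> y" using uw by (auto simp: insert_commute)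
    with sub e * show False by (auto simp: nbhd_def)
  qed
  with * y show "insert y A \<in> indep_sets G" by (auto simp: indep_sets_def)
qed

lemma finite_nbhd: "simple_graph G \<Longrightarrow> nbhd G v \<subseteq> verts G \<and> finite (nbhd G v)"
proof -
  assume G: "simple_graph G"
  then have "nbhd G v \<subseteq> verts G" by (auto simp: simple_graph_def nbhd_def)
  with G show ?thesis by (auto simp: simple_graph_def intro: finite_subset)
qed

text \<open>A monomial whose support is not independent has an edge in its support, hence is a
  multiple of the generator of that edge.\<close>

lemma edge_ideal_eq_sr_ideal:
  assumes G: "simple_graph G"
  shows "(edge_ideal G :: ('v, 'k::field) mvpoly set) = sr_ideal (verts G) (indep_sets G)"
proof -
  let ?R = "poly_ring (verts G) :: ('v, 'k) mvpoly ring"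
  let ?S = "{mvar u * mvar v |u v. {u, v} \<in> edges G} :: ('v, 'k) mvpoly set"
  obtain r :: "'v \<Rightarrow> nat" where r: "inj_on r (verts G)"
    using G finite_imp_inj_to_nat_seg unfolding simple_graph_def by metis
  interpret ranked_complex "verts G" r "indep_sets G"
    using G r by unfold_locales (auto simp: simple_graph_def intro: indep_sets_down)
  interpret R: cring ?R by (rule cring_poly_ring)
  have vertsE: "u \<in> verts G" "w \<in> verts G" if "{u, w} \<in> edges G" for u w
    using that G by (auto simp: simple_graph_def)
  have S: "?S \<subseteq> carrier ?R" using vertsE by auto
  interpret I: ideal "Idl\<^bsub>?R\<^esub> ?S" ?R by (rule R.genideal_ideal[OF S])
  have "mvar u * mvar w \<in> (sr_ideal (verts G) (indep_sets G) :: ('v, 'k) mvpoly set)" if e: "{u, w} \<in> edges G" for u w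
  proof -
    let ?m = "single u (1::nat) + single w 1"
    have keys: "keys ?m = {u, w}" by (simp add: keys_add_nat insert_commute)
    have "single ?m (1 :: 'k) * 1 \<in> sr_ideal (verts G) (indep_sets G)"
    proof (rule single_mult_sr_ideal)
      show "keys ?m \<subseteq> verts G" unfolding keys using vertsE[OF e] by simp
      show "keys ?m \<notin> indep_sets G" unfolding keys using e by (auto simp: indep_sets_def)
    qed simp
    then show ?thesis by (simp add: mvar_def mult_single)
  qed
  then have "?S \<subseteq> sr_ideal (verts G) (indep_sets G)" by blast
  then have 1: "Idl\<^bsub>?R\<^esub> ?S \<subseteq> sr_ideal (verts G) (indep_sets G)"
    by (rule R.genideal_minimal[OF ideal_sr_ideal])
  have 2: "p \<in> Idl\<^bsub>?R\<^esub> ?S" if p: "p \<in> sr_ideal (verts G) (indep_sets G)" for p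
  proof -
    have monom: "single m (lookup p m) \<in> Idl\<^bsub>?R\<^esub> ?S" if m: "m \<in> keys p" for m
    proof -
      have mV: "keys m \<subseteq> verts G" "keys m \<notin> indep_sets G"
        using p m by (auto simp: sr_ideal_def polys_iff)
      then obtain e where e: "e \<in> edges G" "e \<subseteq> keys m" by (auto simp: indep_sets_def)
      obtain u w where uw: "e = {u, w}" "u \<noteq> w" by (rule simple_graph_edgeE[OF G e(1)])
      let ?a = "lookup p m" and ?m = "m - support_monomial {w, u}"
      have "mvar w * single ?m ?a = single (m - support_monomial {u}) ?a"
        using uw e by (intro mvar_mult_single) auto
      moreover have "mvar u * single (m - support_monomial {u}) ?a =
        single (m - support_monomial {}) ?a"
        using uw e by (intro mvar_mult_single) auto
      ultimately have "single m ?a = (mvar u * mvar w) * single ?m ?a"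
        by (simp add: mult.assoc support_monomial_def)
      also have "\<dots> = (mvar u * mvar w) \<otimes>\<^bsub>?R\<^esub> single ?m ?a" by simp
      also have "\<dots> \<in> Idl\<^bsub>?R\<^esub> ?S"
      proof (rule I.I_r_closed)
        show "mvar u * mvar w \<in> Idl\<^bsub>?R\<^esub> ?S" using R.genideal_self[OF S] e uw by blast
        show "single ?m ?a \<in> carrier ?R"
          using subset_trans[OF keys_minus_subset mV(1)] by simp
      qed
      finally show ?thesis .
    qed
    have sum_mem: "sum f A \<in> Idl\<^bsub>?R\<^esub> ?S" if "\<And>m. m \<in> A \<Longrightarrow> f m \<in> Idl\<^bsub>?R\<^esub> ?S"
      for A :: "('v \<Rightarrow>\<^sub>0 nat) set" and f
      using that
    proof (induction A rule: infinite_finite_induct)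
      case (insert x A)
      then show ?case using I.a_closed[of "f x" "sum f A"] by simp
    qed (use I.zero_closed in auto)
    have "(\<Sum>m\<in>keys p. single m (lookup p m)) \<in> Idl\<^bsub>?R\<^esub> ?S"
      by (rule sum_mem) (rule monom)
    moreover have "(\<Sum>m\<in>keys p. single m (lookup p m)) = p"
      by (rule poly_mapping_eqI) (auto simp: lookup_sum' lookup_single when_def in_keys_iff)
    ultimately show ?thesis by simp
  qed
  show ?thesis unfolding edge_ideal_def using 1 2 by blast
qed

theorem proj_dim_edge_ideal_le_iff:
  assumes G: "simple_graph G" and r: "inj_on r (verts G)"
  shows "proj_dim (poly_ring (verts G)) (quot_module (poly_ring (verts G)) (edge_ideal G :: ('v, 'k::field) mvpoly set)) \<le> enat n
    \<longleftrightarrow> (\<forall>\<sigma> j. \<sigma> \<subseteq> verts G \<longrightarrow> n + j < card \<sigma> \<longrightarrow> acyclic_at TYPE('k) r (indep_sets G) \<sigma> j)"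
proof -
  interpret ranked_complex "verts G" r "indep_sets G"
    using G r by unfold_locales (auto simp: simple_graph_def intro: indep_sets_down)
  show ?thesis
    unfolding edge_ideal_eq_sr_ideal[OF G] by (rule proj_dim_le_iff_acyclic_at[OF empty_indep_sets[OF G]])
qed

text \<open>Independent sets inside a subset of \<open>verts G - T\<close> are the same in both
  graphs. All projective dimensions can thus be compared through one complex and one ranking
  \<open>r\<close>.\<close>

lemma proj_dim_remove_verts_le_iff:
  assumes G: "simple_graph G" and r: "inj_on r (verts G)"
  shows "proj_dim (poly_ring (verts (remove_verts G T)))
      (quot_module (poly_ring (verts (remove_verts G T))) (edge_ideal (remove_verts G T) :: ('v, 'k::field) mvpoly set)) \<le> enat n
    \<longleftrightarrow> (\<forall>\<sigma> j. \<sigma> \<subseteq> verts G - T \<longrightarrow> n + j < card \<sigma> \<longrightarrow> acyclic_at TYPE('k) r (indep_sets G) \<sigma> j)"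
proof -
  let ?G = "remove_verts G T"
  have verts: "verts ?G = verts G - T" by (auto simp: remove_verts_def induced_subgraph_def)
  have simple: "simple_graph ?G"
    using G by (auto simp: simple_graph_def remove_verts_def induced_subgraph_def)
  have "acyclic_at TYPE('k) r (indep_sets ?G) \<sigma> j \<longleftrightarrow> acyclic_at TYPE('k) r (indep_sets G) \<sigma> j"
    if "\<sigma> \<subseteq> verts G - T" for \<sigma> j
  proof (rule acyclic_at_cong)
    fix A assume "A \<subseteq> \<sigma>"
    with that have "A \<subseteq> verts G - T" by blast
    then show "A \<in> indep_sets ?G \<longleftrightarrow> A \<in> indep_sets G"
      unfolding indep_sets_def verts by (auto simp: remove_verts_def induced_subgraph_def dest: order_trans)
  qed
  then have eq: "(\<sigma> \<subseteq> verts ?G \<longrightarrow> n + j < card \<sigma> \<longrightarrow> acyclic_at TYPE('k) r (indep_sets ?G) \<sigma> j) \<longleftrightarrow>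
    (\<sigma> \<subseteq> verts G - T \<longrightarrow> n + j < card \<sigma> \<longrightarrow> acyclic_at TYPE('k) r (indep_sets G) \<sigma> j)" for \<sigma> j
    unfolding verts by blast
  have r': "inj_on r (verts ?G)" using r unfolding verts by (rule inj_on_subset) simp
  show ?thesis unfolding proj_dim_edge_ideal_le_iff[OF simple r'] eq ..
qed

text \<open>
  Delete the neighbours \<open>y l\<close> of \<open>v\<close> in \<open>\<sigma>\<close> from the largest index down. As long as another one is
  left, it is isolated in the link of \<open>y l\<close>, and the last deletion leaves \<open>v\<close> isolated, so only
  the link of the last neighbour contributes.
\<close>

lemma acyclic_at_nested_nbhds:
  fixes y :: "nat \<Rightarrow> 'v"
  assumes G: "simple_graph G" and r: "inj_on r (verts G)"
    and nv: "nbhd G v = y ` {a..m}" and inj_y: "inj_on y {a..m}"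
    and nested: "\<And>i j. a \<le> i \<Longrightarrow> i \<le> j \<Longrightarrow> j \<le> m \<Longrightarrow> nbhd G (y i) \<subseteq> nbhd G (y j)"
    and indep: "\<And>i j. i \<in> {a..m} \<Longrightarrow> j \<in> {a..m} \<Longrightarrow> y i \<notin> nbhd G (y j)"
    and rest: "\<And>\<sigma> j. \<sigma> \<subseteq> verts G - (nbhd G v \<union> nbhd G (y a)) \<Longrightarrow> n + j < card \<sigma> \<Longrightarrow>
      acyclic_at (K :: 'k::field itself) r (indep_sets G) \<sigma> j"
    and \<sigma>: "\<sigma> \<subseteq> verts G" "v \<in> \<sigma>" "\<sigma> \<inter> nbhd G v = y ` I" "I \<subseteq> {a..m}" "I \<noteq> {}"
    and card: "n + j + card (nbhd G (y (Min I))) + card I \<le> card \<sigma>"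
  shows "acyclic_at K r (indep_sets G) \<sigma> j"
  using \<sigma> card
proof (induction "card I" arbitrary: I \<sigma>)
  case 0
  have "finite I" by (rule finite_subset[OF 0(5)]) simp
  with 0 show ?case by simp
next
  case (Suc k)
  interpret ordered_faces r "indep_sets G" by unfold_locales (rule indep_sets_down)
  have finV: "finite (verts G)" using G by (simp add: simple_graph_def)
  have finI: "finite I" using Suc.prems(4) by (rule finite_subset) simp
  have fin: "finite \<tau>" "inj_on r \<tau>" if "\<tau> \<subseteq> \<sigma>" for \<tau>
    using that Suc.prems(1) finV r by (auto intro: finite_subset inj_on_subset)
  define M where "M = Max I"
  have MI: "M \<in> I" using finI Suc.prems(5) by (simp add: M_def)
  then have M: "M \<in> {a..m}" using Suc.prems(4) by blast
  let ?N = "nbhd G (y M)" and ?L = "\<sigma> - {y M} - nbhd G (y M)"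
  have yM: "y M \<in> \<sigma>" "y M \<notin> ?N" using Suc.prems(3) MI indep[OF M M] by auto
  then have yMV: "y M \<in> verts G" using Suc.prems(1) by blast
  show ?case
  proof (rule acyclic_at_vertex[where y = "y M" and L = ?L])
    show "insert (y M) A \<in> indep_sets G \<longleftrightarrow> A \<in> indep_sets G \<and> A \<subseteq> ?L" if "A \<subseteq> \<sigma> - {y M}" for A
      using that unfolding insert_indep_sets[OF G yMV] by blast
    have I': "(\<sigma> - {y M}) \<inter> nbhd G v = y ` (I - {M})"
    proof -
      have "y ` (I - {M}) = y ` I - y ` {M}"
        using inj_y Suc.prems(4) MI by (intro inj_on_image_set_diff) (auto intro: inj_on_subset)
      then show ?thesis using Suc.prems(3) by auto
    qed
    have v: "v \<in> \<sigma> - {y M}" "v \<in> verts G"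
    proof -
      have "v \<notin> nbhd G v" using G by (force simp: nbhd_def simple_graph_def)
      then show "v \<in> \<sigma> - {y M}" "v \<in> verts G" using nv M Suc.prems(1,2) by auto
    qed
    show "acyclic_at K r (indep_sets G) (\<sigma> - {y M}) j"
    proof (cases "I = {M}")
      case True
      show ?thesis
      proof (rule acyclic_at_cone[OF fin v(1)])
        fix A assume "A \<in> indep_sets G" "A \<subseteq> \<sigma> - {y M}"
        then show "insert v A \<in> indep_sets G"
          using I' True unfolding insert_indep_sets[OF G v(2)] by blast
      qed auto
    next
      case False
      \<comment> \<open>With more than one index left, removing the largest keeps the smallest. Both
        \<open>card I\<close> and \<open>card \<sigma>\<close> drop by one, so the inequality is
        preserved.\<close>
      have Min: "Min (I - {M}) = Min I"
      proof (rule Min_eqI)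
        have "I - {M} \<noteq> {}" using False MI by blast
        moreover have "M \<noteq> Min I"
          using False finI MI Suc.prems(5) Min_le[OF finI] Max_ge[OF finI] unfolding M_def
          by (metis insertI1 order_antisym singletonI subset_singletonD subsetI insert_not_empty)
        ultimately show "Min I \<in> I - {M}" using finI Suc.prems(5) by simp
      qed (use finI in auto)
      have cI: "card (I - {M}) = k" "card I = Suc k" using Suc.hyps(2) MI finI by auto
      have cs: "card (\<sigma> - {y M}) = card \<sigma> - 1" using yM fin by simp
      show ?thesis
      proof (rule Suc.hyps(1)[of "I - {M}"])
        show "I - {M} \<noteq> {}" using False MI by blast
        show "n + j + card (nbhd G (y (Min (I - {M})))) + card (I - {M}) \<le> card (\<sigma> - {y M})"
          unfolding Min cI cs using Suc.prems(6) cI by simp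
      qed (use cI I' v Suc.prems in auto)
    qed
    fix i assume i: "j = Suc i"
    show "acyclic_at K r (indep_sets G) ?L i"
    proof (cases "I = {M}")
      case True
      show ?thesis
      proof (rule rest)
        have "nbhd G (y a) \<subseteq> ?N" using nested[of a M] M by auto
        then show "?L \<subseteq> verts G - (nbhd G v \<union> nbhd G (y a))"
          using I' True Suc.prems(1) by blast
        \<comment> \<open>The link loses \<open>y M\<close> and at most its neighbours. Now
          \<open>card I = 1\<close> and \<open>j = Suc i\<close>, so the inequality leaves more than
          \<open>n + i\<close> vertices, as \<open>rest\<close> requires.\<close>
        have "card \<sigma> \<le> card ?L + card (insert (y M) ?N)"
          using card_Un_le[of ?L "insert (y M) ?N"] finite_nbhd[OF G, of "y M"] fin[of \<sigma>]
            card_mono[of "?L \<union> insert (y M) ?N" \<sigma>] by (fastforce intro: order_trans)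
        moreover have "card (insert (y M) ?N) = Suc (card ?N)"
          using finite_nbhd[OF G, of "y M"] yM by simp
        ultimately show "n + i < card ?L" using Suc.prems(6) i True by simp
      qed
    next
      case False
      then obtain l where l: "l \<in> I" "l \<noteq> M" using MI by blast
      then have lM: "l \<le> M" "l \<in> {a..m}" using finI Suc.prems(4) by (auto simp: M_def)
      have "y l \<noteq> y M" using inj_y l lM M by (auto dest: inj_onD)
      then have yl: "y l \<in> ?L" using l lM M indep[OF lM(2) M] Suc.prems(3) by auto
      then have ylV: "y l \<in> verts G" using Suc.prems(1) by blast
      have "nbhd G (y l) \<subseteq> ?N" using nested[of l M] lM M by auto
      then have "insert (y l) A \<in> indep_sets G" if "A \<in> indep_sets G" "A \<subseteq> ?L" for A
        using that unfolding insert_indep_sets[OF G ylV] by blast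
      moreover have "?L \<subseteq> \<sigma>" by blast
      ultimately show ?thesis by (intro acyclic_at_cone[OF fin yl])
    qed
  qed (use fin[of \<sigma>] yM in auto)
qed

theorem corollary4p2:
  fixes H B :: "'v sgraph"
    and x y :: "nat \<Rightarrow> 'v"
    and q f q' g :: nat
    and S S1 S2 :: "('v, 'k::field) mvpoly ring"
    and p1 p2 :: enat
  assumes "strongly_biconvex H x q f y q' g"
    and "no_isolated_vertices H"
    and "B = induced_subgraph H (nbhd H (x q) \<union> nbhd H (y q'))"
    and "S = poly_ring (verts H)"
    and "S1 = poly_ring (verts (remove_verts H (verts B)))"
    and "S2 = poly_ring (verts (remove_verts H {x q}))"
    and "p1 = proj_dim S1 (quot_module S1 (edge_ideal (remove_verts H (verts B))))"
    and "p2 = proj_dim S2 (quot_module S2 (edge_ideal (remove_verts H {x q})))"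
  shows "proj_dim S (quot_module S (edge_ideal H)) =
    max (p1 + enat (degree H (x q) + degree H (y q') - 1)) p2"
proof -
  have G: "simple_graph H" and le: "q \<le> f" "q' \<le> g"
    and inj: "inj_on x {q..f}" "inj_on y {q'..g}" and disj: "x ` {q..f} \<inter> y ` {q'..g} = {}"
    and vs: "verts H = x ` {q..f} \<union> y ` {q'..g}"
    and bip: "\<forall>e\<in>edges H. \<exists>i\<in>{q..f}. \<exists>j\<in>{q'..g}. e = {x i, y j}"
    using assms(1) unfolding strongly_biconvex_def by - (elim conjE, assumption)+
  have conv: "i < j \<and> (\<forall>k. i < k \<and> k < j \<longrightarrow>
      (k \<in> {q..f} \<longrightarrow> {x k, y j} \<in> edges H) \<and> (k \<in> {q'..g} \<longrightarrow> {x i, y k} \<in> edges H))"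
    if "i \<in> {q..f}" "j \<in> {q'..g}" "{x i, y j} \<in> edges H" for i j
    using assms(1) that unfolding strongly_biconvex_def
    by (elim conjE) (drule (1) bspec, drule (1) bspec, erule (1) mp)
  have e: "{x q, y q'} \<in> edges H" by (rule strongly_biconvex_first_edge[OF assms(1,2)])
  have q: "q \<in> {q..f}" "q' \<in> {q'..g}" using le by simp_all
  have qq': "q < q'" using conv[OF q e] by simp

  \<comment> \<open>Neighbourhoods of \<open>x q\<close> and of its neighbours\<close>
  have nx: "nbhd H (x i) = y ` {j \<in> {q'..g}. {x i, y j} \<in> edges H}" if i: "i \<in> {q..f}" for i
  proof (intro equalityI subsetI)
    fix w assume "w \<in> nbhd H (x i)"
    then have w: "{x i, w} \<in> edges H" by (simp add: nbhd_def)
    then obtain i' j where ij: "i' \<in> {q..f}" "j \<in> {q'..g}" "{x i, w} = {x i', y j}" using bip by blast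
    moreover have "x i \<noteq> y j" using disj i ij by blast
    ultimately have "w = y j" by (auto simp: doubleton_eq_iff)
    with w ij show "w \<in> y ` {j \<in> {q'..g}. {x i, y j} \<in> edges H}" by blast
  qed (auto simp: nbhd_def)
  have ny: "nbhd H (y j) = x ` {i \<in> {q..f}. {x i, y j} \<in> edges H}" if j: "j \<in> {q'..g}" for j
  proof (intro equalityI subsetI)
    fix w assume "w \<in> nbhd H (y j)"
    then have w: "{y j, w} \<in> edges H" by (simp add: nbhd_def)
    then obtain i j' where ij: "i \<in> {q..f}" "j' \<in> {q'..g}" "{y j, w} = {x i, y j'}" using bip by blast
    moreover have "x i \<noteq> y j" using disj j ij by blast
    ultimately have "w = x i" by (auto simp: doubleton_eq_iff)
    with w ij show "w \<in> x ` {i \<in> {q..f}. {x i, y j} \<in> edges H}" by (auto simp: insert_commute)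
  qed (auto simp: nbhd_def insert_commute)
  define m where "m = Max {j \<in> {q'..g}. {x q, y j} \<in> edges H}"
  have "m \<in> {j \<in> {q'..g}. {x q, y j} \<in> edges H}"
    unfolding m_def using e q by (intro Max_in) auto
  then have m: "m \<in> {q'..g}" "{x q, y m} \<in> edges H" by auto
  \<comment> \<open>Indices from \<open>q'\<close> up to \<open>m\<close> lie above
    \<open>q\<close>, so convexity along the edge from \<open>x q\<close> to \<open>y m\<close>
    gives all of them.\<close>
  have Jx: "{j \<in> {q'..g}. {x q, y j} \<in> edges H} = {q'..m}"
  proof (intro equalityI subsetI)
    fix j assume "j \<in> {j \<in> {q'..g}. {x q, y j} \<in> edges H}"
    then show "j \<in> {q'..m}" unfolding m_def by (auto intro: Max_ge)
  next
    fix j assume j: "j \<in> {q'..m}"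
    then show "j \<in> {j \<in> {q'..g}. {x q, y j} \<in> edges H}"
      using conv[OF q(1) m] m qq' by (cases "j = m") auto
  qed
  then have nxq: "nbhd H (x q) = y ` {q'..m}" using nx[OF q(1)] by simp
  \<comment> \<open>Since \<open>x q\<close> has the smallest index and is adjacent to
    \<open>y j\<close>, convexity makes every \<open>x i\<close> with \<open>i < j\<close> adjacent
    to \<open>y j\<close>. This makes the neighbourhoods nested and \<open>B_e\<close> complete
    bipartite.\<close>
  have nyj: "nbhd H (y j) = x ` {i \<in> {q..f}. i < j}" if j: "j \<in> {q'..m}" for j
  proof -
    have "j \<in> {j \<in> {q'..g}. {x q, y j} \<in> edges H}" unfolding Jx by (rule j)
    then have j': "j \<in> {q'..g}" "{x q, y j} \<in> edges H" by simp_all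
    have "{x i, y j} \<in> edges H \<longleftrightarrow> i < j" if i: "i \<in> {q..f}" for i
    proof
      assume "{x i, y j} \<in> edges H"
      from conv[OF i j'(1) this] show "i < j" by (rule conjunct1)
    next
      assume ij: "i < j"
      show "{x i, y j} \<in> edges H"
      proof (cases "i = q")
        case False
        then have "q < i \<and> i < j" using i ij by simp
        then show ?thesis using conv[OF q(1) j', THEN conjunct2, THEN spec[of _ i]] i by simp
      qed (use j'(2) in simp)
    qed
    then show ?thesis using ny[OF j'(1)] by auto
  qed
  have q'm: "q' \<in> {q'..m}" using m by simp
  have inj_y: "inj_on y {q'..m}" by (rule inj_on_subset[OF inj(2)]) (use m in auto)
  define a where "a = card {i \<in> {q..f}. i < q'}"
  \<comment> \<open>Only the indices in \<open>{q'..<j}\<close> can be new compared with the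
    neighbours of \<open>y q'\<close>.\<close>
  have card_nyj: "card (nbhd H (y j)) \<le> a + (j - q')" if j: "j \<in> {q'..m}" for j
  proof -
    have "card (nbhd H (y j)) \<le> card {i \<in> {q..f}. i < j}"
      unfolding nyj[OF j] by (rule card_image_le) simp
    also have "\<dots> \<le> card ({i \<in> {q..f}. i < q'} \<union> {q'..<j})" by (rule card_mono) auto
    also have "\<dots> \<le> a + (j - q')" unfolding a_def by (rule order_trans[OF card_Un_le]) simp
    finally show ?thesis .
  qed
  have deg_y: "card (nbhd H (y q')) = a"
    unfolding nyj[OF q'm] a_def by (intro card_image inj_on_subset[OF inj(1)]) auto
  have deg_x: "card (nbhd H (x q)) = Suc (m - q')"
    unfolding nxq card_image[OF inj_y] using m by (simp add: Suc_diff_le)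
  define d where "d = degree H (x q) + degree H (y q') - 1"
  have d: "d = a + (m - q')" unfolding d_def degree_def deg_x deg_y by simp
  have verts_B: "verts B = nbhd H (x q) \<union> nbhd H (y q')"
    using finite_nbhd[OF G] unfolding assms(3) induced_subgraph_def by auto
  obtain r :: "'v \<Rightarrow> nat" where r: "inj_on r (verts H)"
    using G finite_imp_inj_to_nat_seg unfolding simple_graph_def by metis
  interpret ordered_faces r "indep_sets H" by unfold_locales (rule indep_sets_down)
  let ?ac = "acyclic_at TYPE('k) r (indep_sets H)"
  have pd: "proj_dim S (quot_module S (edge_ideal H)) \<le> enat n \<longleftrightarrow>
      (\<forall>\<sigma> j. \<sigma> \<subseteq> verts H \<longrightarrow> n + j < card \<sigma> \<longrightarrow> ?ac \<sigma> j)" for n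
    unfolding assms(4) by (rule proj_dim_edge_ideal_le_iff[OF G r])
  have p1: "p1 \<le> enat n \<longleftrightarrow> (\<forall>\<sigma> j. \<sigma> \<subseteq> verts H - (nbhd H (x q) \<union> nbhd H (y q')) \<longrightarrow> n + j < card \<sigma> \<longrightarrow> ?ac \<sigma> j)" for n
    unfolding assms(7) assms(5) proj_dim_remove_verts_le_iff[OF G r] verts_B ..
  have p2: "p2 \<le> enat n \<longleftrightarrow> (\<forall>\<sigma> j. \<sigma> \<subseteq> verts H - {x q} \<longrightarrow> n + j < card \<sigma> \<longrightarrow> ?ac \<sigma> j)" for n
    unfolding assms(8) assms(6) by (rule proj_dim_remove_verts_le_iff[OF G r])
  have xV: "x q \<in> verts H" "y q' \<in> verts H" using vs q by auto
  have finV: "finite (verts H)" using G by (simp add: simple_graph_def)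
  have xy: "x q \<in> nbhd H (y q')" "y q' \<in> nbhd H (x q)" using e by (auto simp: nbhd_def insert_commute)
  have UW: "nbhd H (y q') \<inter> nbhd H (x q) = {}"
    unfolding nxq nyj[OF q'm] using disj m by fastforce

  \<comment> \<open>Adding both sides of \<open>B_e\<close> to a vertex set that avoids them\<close>
  have lower: "?ac \<sigma> j" if ac: "?ac (\<sigma> \<union> nbhd H (y q') \<union> nbhd H (x q)) (Suc j)"
    and \<sigma>: "\<sigma> \<subseteq> verts H - (nbhd H (x q) \<union> nbhd H (y q'))" for \<sigma> j
  proof (rule acyclic_at_suspension[OF _ _ xy _ _ _ _ _ ac])
    have sub: "\<sigma> \<union> nbhd H (y q') \<union> nbhd H (x q) \<subseteq> verts H" using \<sigma> finite_nbhd[OF G] by blast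
    show "finite (\<sigma> \<union> nbhd H (y q') \<union> nbhd H (x q))" by (rule finite_subset[OF sub finV])
    show "inj_on r (\<sigma> \<union> nbhd H (y q') \<union> nbhd H (x q))" by (rule inj_on_subset[OF r sub])
    show "\<sigma> \<inter> nbhd H (y q') = {}" "y q' \<notin> \<sigma>" "y q' \<notin> nbhd H (y q')" using \<sigma> xy UW by auto
    \<comment> \<open>No independent set meets both sides of a complete bipartite graph:
      \<open>i < q' \<le> j\<close> makes \<open>x i\<close> and \<open>y j\<close>
      adjacent.\<close>
    show "A \<inter> nbhd H (y q') = {} \<or> A \<inter> nbhd H (x q) = {}" if A: "A \<in> indep_sets H" for A
    proof (rule ccontr)
      assume "\<not> ?thesis"
      then obtain u w where "u \<in> A" "u \<in> nbhd H (y q')" "w \<in> A" "w \<in> nbhd H (x q)" by blast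
      then obtain i j where ij: "x i \<in> A" "y j \<in> A" "i \<in> {q..f}" "i < q'" "j \<in> {q'..m}"
        unfolding nxq nyj[OF q'm] by auto
      then have "x i \<in> nbhd H (y j)" unfolding nyj[OF ij(5)] by auto
      then have "{x i, y j} \<in> edges H" by (simp add: nbhd_def insert_commute)
      then show False using A ij by (auto simp: indep_sets_def)
    qed
    show "insert (x q) A \<in> indep_sets H \<and> insert (y q') A \<in> indep_sets H"
      if "A \<in> indep_sets H" "A \<subseteq> \<sigma>" for A
      unfolding insert_indep_sets[OF G xV(1)] insert_indep_sets[OF G xV(2)] using that \<sigma> by blast
  qed
  have card_UW: "card (\<sigma> \<union> nbhd H (y q') \<union> nbhd H (x q)) = card \<sigma> + Suc d"
    if \<sigma>: "\<sigma> \<subseteq> verts H - (nbhd H (x q) \<union> nbhd H (y q'))" for \<sigma>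
  proof -
    have "finite \<sigma>" using \<sigma> finV by (auto intro: finite_subset)
    moreover have "\<sigma> \<inter> nbhd H (y q') = {}" "(\<sigma> \<union> nbhd H (y q')) \<inter> nbhd H (x q) = {}" using \<sigma> UW by auto
    ultimately show ?thesis
      using finite_nbhd[OF G] by (simp add: card_Un_disjoint deg_x deg_y d)
  qed
  have sub_UW: "\<sigma> \<union> nbhd H (y q') \<union> nbhd H (x q) \<subseteq> verts H"
    if "\<sigma> \<subseteq> verts H - (nbhd H (x q) \<union> nbhd H (y q'))" for \<sigma>
    using that finite_nbhd[OF G] by blast

  \<comment> \<open>Equivalence of the two bounds\<close>
  have "proj_dim S (quot_module S (edge_ideal H)) \<le> enat n \<longleftrightarrow> d \<le> n \<and> p1 \<le> enat (n - d) \<and> p2 \<le> enat n" for n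
  proof
    assume "proj_dim S (quot_module S (edge_ideal H)) \<le> enat n"
    then have ac: "?ac \<sigma> j" if "\<sigma> \<subseteq> verts H" "n + j < card \<sigma>" for \<sigma> j
      using that unfolding pd by blast
    \<comment> \<open>Shown separately because \<open>n - d\<close> is truncated. Otherwise the
      vertex set of \<open>B_e\<close>, of cardinality \<open>d + 1\<close>, would be acyclic at 1,
      and by \<open>lower\<close> the empty set at 0.\<close>
    have "d \<le> n"
    proof (rule ccontr)
      assume "\<not> d \<le> n"
      then have "?ac ({} \<union> nbhd H (y q') \<union> nbhd H (x q)) (Suc 0)"
        using card_UW[of "{}"] sub_UW[of "{}"] by (intro ac) auto
      then have "?ac {} 0" by (rule lower) simp
      then show False using not_acyclic_at_empty[OF empty_indep_sets[OF G]] by blast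
    qed
    moreover have "p1 \<le> enat (n - d)"
      unfolding p1
    proof (intro allI impI)
      fix \<sigma> j assume \<sigma>: "\<sigma> \<subseteq> verts H - (nbhd H (x q) \<union> nbhd H (y q'))" and j: "n - d + j < card \<sigma>"
      show "?ac \<sigma> j"
        by (rule lower[OF ac[OF sub_UW[OF \<sigma>]] \<sigma>]) (use card_UW[OF \<sigma>] j in simp)
    qed
    moreover have "p2 \<le> enat n" unfolding p2 using ac by blast
    ultimately show "d \<le> n \<and> p1 \<le> enat (n - d) \<and> p2 \<le> enat n" by blast
  next
    assume *: "d \<le> n \<and> p1 \<le> enat (n - d) \<and> p2 \<le> enat n"
    show "proj_dim S (quot_module S (edge_ideal H)) \<le> enat n"
      unfolding pd
    proof (intro allI impI)
      fix \<sigma> j assume \<sigma>: "\<sigma> \<subseteq> verts H" and j: "n + j < card \<sigma>"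
      have fin: "finite \<sigma>" "inj_on r \<sigma>" using finite_subset[OF \<sigma> finV] inj_on_subset[OF r \<sigma>] by auto
      show "?ac \<sigma> j"
      proof (cases "x q \<in> \<sigma>")
        case False
        then show ?thesis using * \<sigma> j unfolding p2 by blast
      next
        case True
        define I where "I = {i \<in> {q'..m}. y i \<in> \<sigma>}"
        have I: "\<sigma> \<inter> nbhd H (x q) = y ` I" "I \<subseteq> {q'..m}" "finite I" unfolding nxq I_def by auto
        show ?thesis
        proof (cases "I = {}")
          case I0: True
          show ?thesis
          proof (rule acyclic_at_cone[OF fin True])
            show "insert (x q) A \<in> indep_sets H" if "A \<in> indep_sets H" "A \<subseteq> \<sigma>" for A
              unfolding insert_indep_sets[OF G xV(1)] using that I(1) I0 by blast
          qed
        next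
          case I0: False
          show ?thesis
          proof (rule acyclic_at_nested_nbhds[OF G r nxq inj_y _ _ _ \<sigma> True I(1,2) I0, where n = "n - d"])
            show "nbhd H (y i) \<subseteq> nbhd H (y j)" if "q' \<le> i" "i \<le> j" "j \<le> m" for i j
              using nyj[of i] nyj[of j] that by auto
            show "y i \<notin> nbhd H (y j)" if "i \<in> {q'..m}" "j \<in> {q'..m}" for i j
            proof -
              have "y i \<in> y ` {q'..g}" using that m by auto
              moreover have "nbhd H (y j) \<subseteq> x ` {q..f}" unfolding nyj[OF that(2)] by auto
              ultimately show ?thesis using disj by blast
            qed
            show "?ac \<tau> i" if "\<tau> \<subseteq> verts H - (nbhd H (x q) \<union> nbhd H (y q'))" "n - d + i < card \<tau>" for \<tau> i
              using * that unfolding p1 by blast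
            have l: "Min I \<in> I" using I(3) I0 by simp
            \<comment> \<open>With \<open>l = Min I\<close>, the bounds
              \<open>card I \<le> m + 1 - l\<close> and \<open>a + (l - q')\<close> for the
              neighbourhood add up to \<open>d + 1\<close>, independently of \<open>l\<close>.
              Together with \<open>n + j < card \<sigma>\<close> this is the required
              inequality.\<close>
            have "I \<subseteq> {Min I..m}" using I(2,3) by auto
            then have "card I \<le> Suc m - Min I" using card_mono[of "{Min I..m}" I] by simp
            moreover have "Min I \<in> {q'..m}" using l I(2) by blast
            ultimately show "n - d + j + card (nbhd H (y (Min I))) + card I \<le> card \<sigma>"
              using card_nyj[of "Min I"] j * unfolding d by auto
          qed
        qed
      qed
    qed
  qed
  moreover have "max (p1 + enat d) p2 \<le> enat n \<longleftrightarrow> d \<le> n \<and> p1 \<le> enat (n - d) \<and> p2 \<le> enat n" for n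
    by (cases p1) auto
  ultimately have iff: "proj_dim S (quot_module S (edge_ideal H)) \<le> enat n \<longleftrightarrow> max (p1 + enat d) p2 \<le> enat n" for n
    by blast
  \<comment> \<open>An extended natural number is determined by its finite upper bounds; infinity is
    the one that has none.\<close>
  have "a = b" if "\<And>n. a \<le> enat n \<longleftrightarrow> b \<le> enat n" for a b :: enat
    using that by (cases a; cases b) (metis antisym enat_ord_simps(1) order_refl enat_ord_simps(5) enat.simps(3) infinity_ileE)+
  from this[OF iff] show ?thesis by (simp add: d_def)
qed

end
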